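(* Let $\kappa>0$, $\theta>0$, $\xi>0$, $-1\le\rho\le1$ and $x_0>0$. In the stopped Heston stochastic volatility model $$dS_t=S_t\sqrt{Y_t}\,\mathbf{1}_{t\in[0,\zeta)}\,dW^{(1)}_t,\quad S_0=1,\qquad dY_t=\kappa(\theta-Y_t)\mathbf{1}_{t\in[0,\zeta)}\,dt+\xi\sqrt{Y_t}\,\mathbf{1}_{t\in[0,\zeta)}\,dW_t,\quad Y_0=x_0,$$ the stock price $(S_t)_{0\le t<\infty}$ is a true $P$-martingale.
   Context: Under $P$, $W$ and $W^{(1)}$ are standard Brownian motions for a common filtration with $\mathbb{E}^P[dW^{(1)}_t\,dW_t]=\rho\,dt$; precisely $W^{(1)}=\rho W+\sqrt{1-\rho^2}\,W^{(2)}$ with $W^{(2)}$ a Brownian motion independent of $(Y,W)$. The state space of $Y$ is $J=(0,\infty)$, $\zeta$ is the exit time of $Y$ from $J$ ($\zeta=\infty$ if $Y$ does not exit), and $Y$ is absorbed at its exit point. Explicitly $S_t=\exp\{\int_0^{t\wedge\zeta}\sqrt{Y_u}\,dW^{(1)}_u-\frac12\int_0^{t\wedge\zeta}Y_u\,du\}$ (taken as a limit, with value $0$, if the integral $\int_0^{t\wedge\zeta}Y_u\,du$ is infinite). *)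

theory Defs
  imports "HOL-Probability.Probability"
begin

text \<open>
  Time is \<^typ>\<open>real\<close>, and only times \<open>t \<ge> 0\<close> matter; a filtration on \<open>[0, \<infinity>)\<close> is extended to
  negative times arbitrarily (monotonically). The filtration is not required to be complete or
  right-continuous: all processes below are adapted to it, and continuous ones have all of their
  paths continuous.
\<close>

definition filtered_prob_space :: "'a measure \<Rightarrow> (real \<Rightarrow> 'a measure) \<Rightarrow> bool" where
  "filtered_prob_space M F \<longleftrightarrow>
     prob_space M \<and> filtration (space M) F \<and> (\<forall>t. subalgebra M (F t))"

definition adapted :: "(real \<Rightarrow> 'a measure) \<Rightarrow> (real \<Rightarrow> 'a \<Rightarrow> 'b::topological_space) \<Rightarrow> bool" where
  "adapted F X \<longleftrightarrow> (\<forall>t\<ge>0. X t \<in> borel_measurable (F t))"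

definition continuous_paths :: "'a measure \<Rightarrow> (real \<Rightarrow> 'a \<Rightarrow> 'b::topological_space) \<Rightarrow> bool" where
  "continuous_paths M X \<longleftrightarrow> (\<forall>\<omega>\<in>space M. continuous_on {0..} (\<lambda>t. X t \<omega>))"

definition martingale :: "'a measure \<Rightarrow> (real \<Rightarrow> 'a measure) \<Rightarrow> (real \<Rightarrow> 'a \<Rightarrow> real) \<Rightarrow> bool" where
  "martingale M F X \<longleftrightarrow>
     adapted F X \<and> (\<forall>t\<ge>0. integrable M (X t)) \<and>
     (\<forall>s t. 0 \<le> s \<and> s \<le> t \<longrightarrow> (AE \<omega> in M. real_cond_exp M (F s) (X t) \<omega> = X s \<omega>))"


subsection \<open>Brownian motion\<close>

definition generated_algebra ::
  "'a measure \<Rightarrow> real set \<Rightarrow> (real \<Rightarrow> 'a \<Rightarrow> 'b::topological_space) \<Rightarrow> 'a measure" where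
  "generated_algebra M T X =
     vimage_algebra (space M) (\<lambda>\<omega>. \<lambda>t\<in>T. X t \<omega>) (\<Pi>\<^sub>M t\<in>T. borel)"

definition natural_filtration ::
  "'a measure \<Rightarrow> (real \<Rightarrow> 'a \<Rightarrow> 'b::topological_space) \<Rightarrow> real \<Rightarrow> 'a measure" where
  "natural_filtration M X t = generated_algebra M {0..t} X"

definition brownian_motion ::
  "'a measure \<Rightarrow> (real \<Rightarrow> 'a measure) \<Rightarrow> (real \<Rightarrow> 'a \<Rightarrow> real) \<Rightarrow> bool" where
  "brownian_motion M F B \<longleftrightarrow>
     adapted F B \<and> continuous_paths M B \<and> (AE \<omega> in M. B 0 \<omega> = 0) \<and>
     (\<forall>s t. 0 \<le> s \<and> s < t \<longrightarrow>
        distributed M lborel (\<lambda>\<omega>. B t \<omega> - B s \<omega>) (normal_density 0 (sqrt (t - s))) \<and>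
        prob_space.indep_set M (sets (F s))
          (sets (vimage_algebra (space M) (\<lambda>\<omega>. B t \<omega> - B s \<omega>) borel)))"

definition independent_processes :: "'a measure \<Rightarrow> (real \<Rightarrow> 'a \<Rightarrow> 'b::topological_space) \<Rightarrow>
    (real \<Rightarrow> 'a \<Rightarrow> 'c::topological_space) \<Rightarrow> bool" where
  "independent_processes M X Z \<longleftrightarrow>
     prob_space.indep_set M (sets (generated_algebra M {0..} X)) (sets (generated_algebra M {0..} Z))"


subsection \<open>The Ito integral\<close>

text \<open>
  The triple \<open>k\<close>, \<open>\<tau>\<close>, \<open>c\<close> encodes the simple process
  \<open>\<Sum>i<k. c i * 1\<^bsub>(\<tau> i, \<tau> (i+1)]\<^esub>\<close>.
\<close>

definition simple_integrand ::
  "'a measure \<Rightarrow> (real \<Rightarrow> 'a measure) \<Rightarrow> nat \<Rightarrow> (nat \<Rightarrow> real) \<Rightarrow> (nat \<Rightarrow> 'a \<Rightarrow> real) \<Rightarrow> bool" where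
  "simple_integrand M F k \<tau> c \<longleftrightarrow>
     0 \<le> \<tau> 0 \<and> (\<forall>i<k. \<tau> i \<le> \<tau> (Suc i)) \<and>
     (\<forall>i<k. c i \<in> borel_measurable (F (\<tau> i)) \<and> (\<exists>C. \<forall>\<omega>\<in>space M. \<bar>c i \<omega>\<bar> \<le> C))"

definition simple_process ::
  "nat \<Rightarrow> (nat \<Rightarrow> real) \<Rightarrow> (nat \<Rightarrow> 'a \<Rightarrow> real) \<Rightarrow> real \<Rightarrow> 'a \<Rightarrow> real" where
  "simple_process k \<tau> c t \<omega> = (\<Sum>i<k. c i \<omega> * indicator {\<tau> i <.. \<tau> (Suc i)} t)"

definition simple_integral :: "(real \<Rightarrow> 'a \<Rightarrow> real) \<Rightarrow>
    nat \<Rightarrow> (nat \<Rightarrow> real) \<Rightarrow> (nat \<Rightarrow> 'a \<Rightarrow> real) \<Rightarrow> real \<Rightarrow> 'a \<Rightarrow> real" where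
  "simple_integral B k \<tau> c t \<omega> =
     (\<Sum>i<k. c i \<omega> * (B (min t (\<tau> (Suc i))) \<omega> - B (min t (\<tau> i)) \<omega>))"

definition progressively_measurable ::
  "(real \<Rightarrow> 'a measure) \<Rightarrow> (real \<Rightarrow> 'a \<Rightarrow> real) \<Rightarrow> bool" where
  "progressively_measurable F H \<longleftrightarrow>
     (\<forall>t\<ge>0. (\<lambda>(u, \<omega>). H u \<omega>) \<in> borel_measurable (restrict_space borel {0..t} \<Otimes>\<^sub>M F t))"

text \<open>
  \<open>is_ito_integral M F B H X\<close>: the process \<open>X\<close> is a continuous version of \<open>\<integral> H dB\<close>, where \<open>H\<close> is
  square integrable over \<open>[0, T] \<times> \<Omega>\<close> for every \<open>T\<close>. It is the \<open>L\<^sup>2\<close> limit of the integrals of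
  simple processes that converge to \<open>H\<close> in \<open>L\<^sup>2(dt \<otimes> P)\<close> on \<open>[0, T]\<close> for every \<open>T\<close>, and so unique
  up to indistinguishability. Square integrability of \<open>H\<close> follows from the approximation, as
  simple processes are bounded.
\<close>

definition is_ito_integral :: "'a measure \<Rightarrow> (real \<Rightarrow> 'a measure) \<Rightarrow> (real \<Rightarrow> 'a \<Rightarrow> real) \<Rightarrow>
    (real \<Rightarrow> 'a \<Rightarrow> real) \<Rightarrow> (real \<Rightarrow> 'a \<Rightarrow> real) \<Rightarrow> bool" where
  "is_ito_integral M F B H X \<longleftrightarrow>
     progressively_measurable F H \<and> adapted F X \<and> continuous_paths M X \<and>
     (\<exists>k \<tau> c. (\<forall>n. simple_integrand M F (k n) (\<tau> n) (c n)) \<and>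
        (\<forall>T\<ge>0. (\<lambda>n. \<integral>\<^sup>+\<omega>. (\<integral>\<^sup>+u\<in>{0..T}.
             ennreal ((simple_process (k n) (\<tau> n) (c n) u \<omega> - H u \<omega>)\<^sup>2) \<partial>lborel) \<partial>M)
           \<longlonglongrightarrow> 0) \<and>
        (\<forall>t\<ge>0. (\<lambda>n. \<integral>\<^sup>+\<omega>. ennreal ((simple_integral B (k n) (\<tau> n) (c n) t \<omega> - X t \<omega>)\<^sup>2) \<partial>M)
           \<longlonglongrightarrow> 0))"


subsection \<open>The stopped Heston model\<close>

text \<open>
  The variance process takes values in \<open>[0, \<infinity>]\<close>, a subset of \<^typ>\<open>ereal\<close>: both boundary points of
  \<open>J = (0, \<infinity>)\<close> are possible exit points, so that absence of explosion is not assumed.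
\<close>

definition exit_time :: "(real \<Rightarrow> 'a \<Rightarrow> ereal) \<Rightarrow> ereal set \<Rightarrow> 'a \<Rightarrow> ereal" where
  "exit_time Y A \<omega> = (INF t\<in>{t. 0 \<le> t \<and> Y t \<omega> \<notin> A}. ereal t)"

abbreviation (input) stopped_at :: "real \<Rightarrow> ereal \<Rightarrow> real" where
  "stopped_at t \<sigma> \<equiv> real_of_ereal (min (ereal t) \<sigma>)"

definition zeta :: "(real \<Rightarrow> 'a \<Rightarrow> ereal) \<Rightarrow> 'a \<Rightarrow> ereal" where
  "zeta Y = exit_time Y {0<..<\<infinity>}"

text \<open>The localizing sequence \<open>\<zeta>\<^sub>n\<close>, increasing to \<open>\<zeta>\<close>: exit times from \<open>(1/n, n)\<close>.\<close>

definition zeta_n :: "(real \<Rightarrow> 'a \<Rightarrow> ereal) \<Rightarrow> nat \<Rightarrow> 'a \<Rightarrow> ereal" where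
  "zeta_n Y n = exit_time Y {ereal (1 / real n) <..< ereal (real n)}"

text \<open>The integrand \<open>\<surd>Y\<^sub>u 1\<^bsub>u < \<zeta>\<^sub>n\<^esub>\<close>; it is bounded by \<open>\<surd>n\<close>.\<close>

definition sqrt_Y_n :: "(real \<Rightarrow> 'a \<Rightarrow> ereal) \<Rightarrow> nat \<Rightarrow> real \<Rightarrow> 'a \<Rightarrow> real" where
  "sqrt_Y_n Y n u \<omega> = (if ereal u < zeta_n Y n \<omega> then sqrt (real_of_ereal (Y u \<omega>)) else 0)"

text \<open>
  As usual for an equation whose solution may leave the state space, the stochastic differential
  equation means that the integrated equation holds up to \<open>\<zeta>\<^sub>n\<close> for every \<open>n\<close>.
\<close>

definition heston_variance :: "'a measure \<Rightarrow> (real \<Rightarrow> 'a measure) \<Rightarrow> real \<Rightarrow> real \<Rightarrow> real \<Rightarrow> real \<Rightarrow>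
    (real \<Rightarrow> 'a \<Rightarrow> real) \<Rightarrow> (real \<Rightarrow> 'a \<Rightarrow> ereal) \<Rightarrow> bool" where
  "heston_variance M F \<kappa> \<theta> \<xi> x0 W Y \<longleftrightarrow>
     adapted F Y \<and> continuous_paths M Y \<and>
     (\<forall>\<omega>\<in>space M. \<forall>t\<ge>0. 0 \<le> Y t \<omega>) \<and>
     (\<forall>\<omega>\<in>space M. \<forall>t\<ge>0. zeta Y \<omega> \<le> ereal t \<longrightarrow> Y t \<omega> = Y (real_of_ereal (zeta Y \<omega>)) \<omega>) \<and>
     (\<forall>n. \<exists>V. is_ito_integral M F W (sqrt_Y_n Y n) V \<and>
        (AE \<omega> in M. \<forall>t\<ge>0.
           Y (stopped_at t (zeta_n Y n \<omega>)) \<omega> =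
             ereal (x0
               + (LBINT u:{0..stopped_at t (zeta_n Y n \<omega>)}. \<kappa> * (\<theta> - real_of_ereal (Y u \<omega>)))
               + \<xi> * V t \<omega>)))"

definition integrated_variance :: "(real \<Rightarrow> 'a \<Rightarrow> ereal) \<Rightarrow> real \<Rightarrow> 'a \<Rightarrow> ennreal" where
  "integrated_variance Y t \<omega> =
     (\<integral>\<^sup>+u\<in>{0..stopped_at t (zeta Y \<omega>)}. e2ennreal (Y u \<omega>) \<partial>lborel)"

text \<open>
  \<open>I n\<close> stands for the Ito integral of \<open>\<surd>Y\<^sub>u 1\<^bsub>u < \<zeta>\<^sub>n\<^esub>\<close> with respect to the driver of the stock.
  Where the integrated variance is finite, \<open>I n t\<close> converges almost surely and the limit is
  \<open>\<integral> \<surd>Y\<^sub>u dW\<^sup>1\<^sub>u\<close> over \<open>[0, min t \<zeta>]\<close>.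
\<close>

definition heston_price ::
  "(real \<Rightarrow> 'a \<Rightarrow> ereal) \<Rightarrow> (nat \<Rightarrow> real \<Rightarrow> 'a \<Rightarrow> real) \<Rightarrow> real \<Rightarrow> 'a \<Rightarrow> real" where
  "heston_price Y I t \<omega> =
     (if integrated_variance Y t \<omega> = \<infinity> then 0
      else exp (lim (\<lambda>n. I n t \<omega>) - enn2real (integrated_variance Y t \<omega>) / 2))"

end

theory Submission
  imports Defs
begin

text \<open>
  Stopping \<open>Y\<close> on leaving \<open>(1/n, n)\<close> gives true exponential martingales \<open>Z n\<close> that converge to the
  price, so only their uniform integrability is at stake. Under the measure with density \<open>Z n\<close> the
  variance still has linear drift, \<open>\<kappa> * \<theta> - (\<kappa> - \<rho> * \<xi>) * Y\<close>, so by Gronwall the mean of the integrated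
  variance is bounded uniformly in \<open>n\<close>. Half of this mean is the entropy \<open>E (Z n * ln (Z n))\<close>, and
  bounded entropy implies uniform integrability.

  Ito's formula is avoided: for the bounded integrands at hand, Ito integrals are \<open>L\<^sup>2\<close> limits of
  Riemann sums, and both the martingale property of \<open>Z n\<close> and the drift formula under \<open>Z n\<close> are
  checked on the grid.
\<close>

section \<open>Square integrable functions\<close>

text \<open>The price is built from \<open>lim\<close> of the full sequence \<open>I n t\<close>, so
  convergence in L2 or along a subsequence would not identify it; almost sure convergence comes from
  a maximal inequality and from the behaviour of Ito integrals at the exit times
  \<open>zeta_n\<close>. The tilted measure is never constructed: it enters only through integrals
  weighted by \<open>Z n t\<close>. Riemann sums are available because \<open>sqrt_Y_n\<close> is
  bounded and each of its paths is discontinuous at most once, at \<open>zeta_n\<close>. In the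
  tilted equation the mean reversion \<open>- \<kappa> * Y\<close> only lowers the variance and is
  discarded, and \<open>\<rho>\<close> is bounded by \<open>1\<close>; this leaves \<open>y t \<le>
  x0 + \<kappa> * \<theta> * t + \<xi> * (\<integral> y)\<close> for the tilted second moment
  \<open>y\<close> of the integrand, with constants free of \<open>n\<close>. The bound
  \<open>sqrt n\<close> on the integrand controls errors for fixed \<open>n\<close> and never
  reaches the final estimate. Explosion is not excluded beforehand: under the original measure the
  same one-sided bound makes the mean integrated variance finite, so the value \<open>0\<close> of
  the price has probability \<open>0\<close>.\<close>

definition square_integrable :: "'a measure \<Rightarrow> ('a \<Rightarrow> real) \<Rightarrow> bool" where
  "square_integrable M f \<longleftrightarrow> f \<in> borel_measurable M \<and> integrable M (\<lambda>x. (f x)\<^sup>2)"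

lemma square_integrable_measurable: "square_integrable M f \<Longrightarrow> f \<in> borel_measurable M"
  by (simp add: square_integrable_def)

lemma square_integrable_imp: "square_integrable M f \<Longrightarrow> integrable M (\<lambda>x. (f x)\<^sup>2)"
  by (simp add: square_integrable_def)

lemma square_integrable_mult:
  assumes "square_integrable M f" "square_integrable M g"
  shows "integrable M (\<lambda>x. f x * g x)"
proof (rule Bochner_Integration.integrable_bound)
  show "integrable M (\<lambda>x. (f x)\<^sup>2 + (g x)\<^sup>2)"
    using assms by (auto simp: square_integrable_def)
  show "(\<lambda>x. f x * g x) \<in> borel_measurable M"
    using assms by (auto simp: square_integrable_def)
  have "\<bar>f x * g x\<bar> \<le> (f x)\<^sup>2 + (g x)\<^sup>2" for x
    using sum_squares_bound[of "\<bar>f x\<bar>" "\<bar>g x\<bar>"] abs_ge_zero[of "f x * g x"]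
    unfolding abs_mult by (simp, linarith)
  then show "AE x in M. norm (f x * g x) \<le> norm ((f x)\<^sup>2 + (g x)\<^sup>2)"
    by (intro AE_I2) (simp add: abs_mult)
qed

lemma square_integrable_add:
  assumes "square_integrable M f" "square_integrable M g"
  shows "square_integrable M (\<lambda>x. f x + g x)"
  using assms square_integrable_mult[OF assms]
  by (auto simp: square_integrable_def power2_sum mult.assoc)

lemma square_integrable_cmult:
  "square_integrable M f \<Longrightarrow> square_integrable M (\<lambda>x. c * f x)"
  by (auto simp: square_integrable_def power_mult_distrib)

lemma square_integrable_diff:
  assumes "square_integrable M f" "square_integrable M g"
  shows "square_integrable M (\<lambda>x. f x - g x)"
  using square_integrable_add[OF assms(1) square_integrable_cmult[OF assms(2), of "-1"]] by simp

lemma square_integrable_sum: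
  assumes "\<And>i. i \<in> J \<Longrightarrow> square_integrable M (f i)"
  shows "square_integrable M (\<lambda>x. \<Sum>i\<in>J. f i x)"
  using assms
proof (induction J rule: infinite_finite_induct)
  case (insert i J)
  then show ?case by (auto intro: square_integrable_add)
qed (auto simp: square_integrable_def)

lemma square_integrable_mult_bounded:
  assumes "square_integrable M f" "h \<in> borel_measurable M" "\<And>x. x \<in> space M \<Longrightarrow> \<bar>h x\<bar> \<le> C"
  shows "square_integrable M (\<lambda>x. h x * f x)"
  unfolding square_integrable_def
proof
  show m: "(\<lambda>x. h x * f x) \<in> borel_measurable M"
    using assms by (auto simp: square_integrable_def)
  show "integrable M (\<lambda>x. (h x * f x)\<^sup>2)"
  proof (rule Bochner_Integration.integrable_bound)
    show "integrable M (\<lambda>x. C\<^sup>2 * (f x)\<^sup>2)"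
      using assms by (auto simp: square_integrable_def)
    show "AE x in M. norm ((h x * f x)\<^sup>2) \<le> norm (C\<^sup>2 * (f x)\<^sup>2)"
      using assms(3) by (intro AE_I2) (auto simp: power_mult_distrib abs_mult intro!: mult_right_mono
         abs_le_square_iff[THEN iffD1] order_trans[OF _ abs_ge_self])
  qed (use m in simp)
qed

lemma (in finite_measure) square_integrable_bounded:
  assumes "h \<in> borel_measurable M" "\<And>x. x \<in> space M \<Longrightarrow> \<bar>h x\<bar> \<le> C"
  shows "square_integrable M h"
  using square_integrable_mult_bounded[of M "\<lambda>_. 1" h C] assms by (simp add: square_integrable_def)

lemma (in finite_measure) square_integrable_integrable:
  assumes "square_integrable M f" shows "integrable M f"
  using square_integrable_mult[OF assms, of "\<lambda>_. 1"] by (simp add: square_integrable_def)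

lemma Cauchy_Schwarz_integral:
  assumes f: "square_integrable M f" and g: "square_integrable M g"
  shows "\<bar>\<integral>x. f x * g x \<partial>M\<bar> \<le> sqrt (\<integral>x. (f x)\<^sup>2 \<partial>M) * sqrt (\<integral>x. (g x)\<^sup>2 \<partial>M)"
proof -
  define A where "A = (\<integral>x. (f x)\<^sup>2 \<partial>M)"
  define B where "B = (\<integral>x. (g x)\<^sup>2 \<partial>M)"
  define D where "D = (\<integral>x. f x * g x \<partial>M)"
  have i: "integrable M (\<lambda>x. (f x)\<^sup>2)" "integrable M (\<lambda>x. (g x)\<^sup>2)" "integrable M (\<lambda>x. f x * g x)"
    using f g square_integrable_mult[OF f g] by (auto simp: square_integrable_def)
  \<comment> \<open>Nonnegativity of this quadratic form is used at \<open>(- D, A)\<close> and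
    \<open>(B, - D)\<close>, where it equals \<open>A * (A * B - D\<^sup>2)\<close> and
    \<open>B * (A * B - D\<^sup>2)\<close>. If \<open>A\<close> and \<open>B\<close> both vanish,
    the points \<open>(1, 1)\<close> and \<open>(1, - 1)\<close> force \<open>D = 0\<close>.\<close>
  have q: "0 \<le> a\<^sup>2 * A + 2 * a * b * D + b\<^sup>2 * B" for a b
  proof -
    have "0 \<le> (\<integral>x. (a * f x + b * g x)\<^sup>2 \<partial>M)" by simp
    also have "\<dots> = (\<integral>x. a\<^sup>2 * (f x)\<^sup>2 + 2 * a * b * (f x * g x) + b\<^sup>2 * (g x)\<^sup>2 \<partial>M)"
      by (intro Bochner_Integration.integral_cong) (auto simp: power2_eq_square algebra_simps)
    also have "\<dots> = a\<^sup>2 * A + 2 * a * b * D + b\<^sup>2 * B"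
      using i by (simp add: A_def B_def D_def)
    finally show ?thesis .
  qed
  have "A \<ge> 0" "B \<ge> 0" by (auto simp: A_def B_def)
  have "D\<^sup>2 \<le> A * B"
  proof (cases "A = 0 \<and> B = 0")
    case True
    then show ?thesis using q[of 1 1] q[of 1 "-1"] by auto
  next
    case False
    have "0 \<le> A * (A * B - D\<^sup>2)" "0 \<le> B * (A * B - D\<^sup>2)"
      using q[of "- D" A] q[of B "- D"] by (auto simp: power2_eq_square algebra_simps)
    then show ?thesis using False \<open>A \<ge> 0\<close> \<open>B \<ge> 0\<close>
      by (smt (verit) zero_le_mult_iff)
  qed
  then have "\<bar>D\<bar> \<le> sqrt (A * B)" using real_le_rsqrt[of "\<bar>D\<bar>"] by simp
  then show ?thesis by (simp add: A_def B_def D_def real_sqrt_mult)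
qed

text \<open>Square integrability belongs to the notion because the Bochner integral of a
  non-integrable function is \<open>0\<close>, which would make the convergence clause true by
  default.\<close>

definition L2_lim :: "'a measure \<Rightarrow> (nat \<Rightarrow> 'a \<Rightarrow> real) \<Rightarrow> ('a \<Rightarrow> real) \<Rightarrow> bool" where
  "L2_lim M f g \<longleftrightarrow> (\<forall>n. square_integrable M (f n)) \<and> square_integrable M g \<and>
     (\<lambda>n. \<integral>x. (f n x - g x)\<^sup>2 \<partial>M) \<longlonglongrightarrow> 0"

lemma square_diff_le: "(a - b)\<^sup>2 \<le> 2 * a\<^sup>2 + 2 * (b::real)\<^sup>2"
  using zero_le_power2[of "a + b"] unfolding power2_sum power2_diff by linarith

lemma L2_lim_bound:
  assumes "\<And>n. square_integrable M (f n)" "square_integrable M g"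
    and "b \<longlonglongrightarrow> 0" "\<And>n. (\<integral>x. (f n x - g x)\<^sup>2 \<partial>M) \<le> b n"
  shows "L2_lim M f g"
proof -
  have "(\<lambda>n. \<integral>x. (f n x - g x)\<^sup>2 \<partial>M) \<longlonglongrightarrow> 0"
    by (rule tendsto_sandwich[of "\<lambda>_. 0" _ sequentially b]) (use assms in auto)
  then show ?thesis using assms by (simp add: L2_lim_def)
qed

lemma L2_lim_diff:
  assumes f: "L2_lim M f F" and g: "L2_lim M g G"
  shows "L2_lim M (\<lambda>n x. f n x - g n x) (\<lambda>x. F x - G x)"
proof (rule L2_lim_bound[where b="\<lambda>n. 2 * (\<integral>x. (f n x - F x)\<^sup>2 \<partial>M) + 2 * (\<integral>x. (g n x - G x)\<^sup>2 \<partial>M)"])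
  have s: "square_integrable M (f n)" "square_integrable M (g n)" "square_integrable M F"
     "square_integrable M G" for n
    using f g by (auto simp: L2_lim_def)
  then show "square_integrable M (\<lambda>x. f n x - g n x)" "square_integrable M (\<lambda>x. F x - G x)" for n
    by (auto intro: square_integrable_diff)
  show "(\<lambda>n. 2 * (\<integral>x. (f n x - F x)\<^sup>2 \<partial>M) + 2 * (\<integral>x. (g n x - G x)\<^sup>2 \<partial>M)) \<longlonglongrightarrow> 0"
    using f g by (auto simp: L2_lim_def intro!: tendsto_eq_intros)
  fix n
  have i: "integrable M (\<lambda>x. (f n x - F x)\<^sup>2)" "integrable M (\<lambda>x. (g n x - G x)\<^sup>2)"
    "integrable M (\<lambda>x. (f n x - g n x - (F x - G x))\<^sup>2)"
    using s by (auto intro!: square_integrable_diff square_integrable_imp)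
  have "(\<integral>x. (f n x - g n x - (F x - G x))\<^sup>2 \<partial>M) \<le> (\<integral>x. 2 * (f n x - F x)\<^sup>2 + 2 * (g n x - G x)\<^sup>2 \<partial>M)"
    using i square_diff_le[of "f n x - F x" "g n x - G x" for x]
    by (intro integral_mono) (auto simp: algebra_simps)
  then show "(\<integral>x. (f n x - g n x - (F x - G x))\<^sup>2 \<partial>M)
       \<le> 2 * (\<integral>x. (f n x - F x)\<^sup>2 \<partial>M) + 2 * (\<integral>x. (g n x - G x)\<^sup>2 \<partial>M)"
    using i by simp
qed

lemma L2_lim_mult_bounded:
  assumes f: "L2_lim M f F" and h: "h \<in> borel_measurable M" "\<And>x. x \<in> space M \<Longrightarrow> \<bar>h x\<bar> \<le> C"
  shows "L2_lim M (\<lambda>n x. h x * f n x) (\<lambda>x. h x * F x)"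
proof (rule L2_lim_bound[where b="\<lambda>n. C\<^sup>2 * (\<integral>x. (f n x - F x)\<^sup>2 \<partial>M)"])
  have s: "square_integrable M (f n)" "square_integrable M F" for n
    using f by (auto simp: L2_lim_def)
  then show "square_integrable M (\<lambda>x. h x * f n x)" "square_integrable M (\<lambda>x. h x * F x)" for n
    using h by (auto intro!: square_integrable_mult_bounded)
  show "(\<lambda>n. C\<^sup>2 * (\<integral>x. (f n x - F x)\<^sup>2 \<partial>M)) \<longlonglongrightarrow> 0"
    using f by (auto simp: L2_lim_def intro!: tendsto_eq_intros)
  fix n
  have d: "square_integrable M (\<lambda>x. f n x - F x)" by (intro square_integrable_diff s)
  have d': "square_integrable M (\<lambda>x. h x * (f n x - F x))"
    by (rule square_integrable_mult_bounded[OF d h])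
  have "(\<integral>x. (h x * f n x - h x * F x)\<^sup>2 \<partial>M) \<le> (\<integral>x. C\<^sup>2 * (f n x - F x)\<^sup>2 \<partial>M)"
    using d d' h(2)
    by (intro integral_mono)
       (auto simp: square_integrable_def power_mult_distrib right_diff_distrib[symmetric]
         intro!: mult_right_mono abs_le_square_iff[THEN iffD1] order_trans[OF _ abs_ge_self])
  then show "(\<integral>x. (h x * f n x - h x * F x)\<^sup>2 \<partial>M) \<le> C\<^sup>2 * (\<integral>x. (f n x - F x)\<^sup>2 \<partial>M)" by simp
qed

lemma L2_lim_const: "square_integrable M f \<Longrightarrow> L2_lim M (\<lambda>_. f) f"
  by (simp add: L2_lim_def)

lemma L2_lim_subseq: "L2_lim M f F \<Longrightarrow> strict_mono r \<Longrightarrow> L2_lim M (\<lambda>n. f (r n)) F"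
  unfolding L2_lim_def using LIMSEQ_subseq_LIMSEQ[of "\<lambda>n. \<integral>x. (f n x - F x)\<^sup>2 \<partial>M" 0 r]
  by (auto simp: o_def)

text \<open>The error is \<open>(f - F) * (g - G) + F * (g - G) + (f - F) * G\<close>, and
  Cauchy-Schwarz bounds each term by the L2 errors. Both factors are allowed to vary because later
  one is a discrete density and the other a Riemann sum.\<close>

lemma L2_lim_inner:
  assumes f: "L2_lim M f F" and g: "L2_lim M g G"
  shows "(\<lambda>n. \<integral>x. f n x * g n x \<partial>M) \<longlonglongrightarrow> (\<integral>x. F x * G x \<partial>M)"
proof -
  have s: "square_integrable M (f n)" "square_integrable M (g n)" "square_integrable M F"
     "square_integrable M G" for n
    using f g by (auto simp: L2_lim_def)
  define a where "a n = sqrt (\<integral>x. (f n x - F x)\<^sup>2 \<partial>M)" for n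
  define b where "b n = sqrt (\<integral>x. (g n x - G x)\<^sup>2 \<partial>M)" for n
  have a: "a \<longlonglongrightarrow> 0" and b: "b \<longlonglongrightarrow> 0"
    using f g unfolding a_def b_def by (auto simp: L2_lim_def intro!: tendsto_eq_intros)
  define e where "e n = a n * b n + sqrt (\<integral>x. (F x)\<^sup>2 \<partial>M) * b n + a n * sqrt (\<integral>x. (G x)\<^sup>2 \<partial>M)" for n
  have e: "e \<longlonglongrightarrow> 0" unfolding e_def by (auto intro!: tendsto_eq_intros a b)
  have "\<bar>(\<integral>x. f n x * g n x \<partial>M) - (\<integral>x. F x * G x \<partial>M)\<bar> \<le> e n" for n
  proof -
    have d: "square_integrable M (\<lambda>x. f n x - F x)" "square_integrable M (\<lambda>x. g n x - G x)"
      by (intro square_integrable_diff s)+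
    note i = square_integrable_mult
    have "(\<integral>x. f n x * g n x \<partial>M) - (\<integral>x. F x * G x \<partial>M) = (\<integral>x. f n x * g n x - F x * G x \<partial>M)"
      using i[OF s(1,2)] i[OF s(3,4)] by simp
    also have "\<dots> = (\<integral>x. (f n x - F x) * (g n x - G x) + F x * (g n x - G x) + (f n x - F x) * G x \<partial>M)"
      by (intro Bochner_Integration.integral_cong) (auto simp: algebra_simps)
    also have "\<dots> = (\<integral>x. (f n x - F x) * (g n x - G x) \<partial>M) + (\<integral>x. F x * (g n x - G x) \<partial>M)
         + (\<integral>x. (f n x - F x) * G x \<partial>M)"
      using i[OF d] i[OF s(3) d(2)] i[OF d(1) s(4)] by simp
    finally show ?thesis
      using Cauchy_Schwarz_integral[OF d] Cauchy_Schwarz_integral[OF s(3) d(2)]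
        Cauchy_Schwarz_integral[OF d(1) s(4)] unfolding e_def a_def b_def by linarith
  qed
  then have "(\<lambda>n. \<bar>(\<integral>x. f n x * g n x \<partial>M) - (\<integral>x. F x * G x \<partial>M)\<bar>) \<longlonglongrightarrow> 0"
    by (intro real_tendsto_sandwich[OF _ _ tendsto_const e] always_eventually) auto
  then show ?thesis by (rule LIM_zero_cancel[OF tendsto_rabs_zero_cancel])
qed

text \<open>The squared errors tend to \<open>0\<close> in L1, hence almost everywhere along a
  subsequence; a square root removes the square.\<close>

lemma L2_lim_AE_subseq:
  assumes f: "L2_lim M f F"
  obtains r :: "nat \<Rightarrow> nat" where "strict_mono r" "AE x in M. (\<lambda>n. f (r n) x) \<longlonglongrightarrow> F x"
proof -
  have s: "square_integrable M (f n)" "square_integrable M F" for n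
    using f by (auto simp: L2_lim_def)
  have "\<exists>r::nat\<Rightarrow>nat. strict_mono r \<and> (AE x in M. (\<lambda>n. (f (r n) x - F x)\<^sup>2) \<longlonglongrightarrow> 0)"
  proof (rule tendsto_L1_AE_subseq[of M "\<lambda>n x. (f n x - F x)\<^sup>2"])
    show "integrable M (\<lambda>x. (f n x - F x)\<^sup>2)" for n
      using square_integrable_diff[OF s(1) s(2)] by (auto simp: square_integrable_def)
    show "(\<lambda>n. \<integral>x. norm ((f n x - F x)\<^sup>2) \<partial>M) \<longlonglongrightarrow> 0"
      using f by (simp add: L2_lim_def)
  qed
  then obtain r where r: "strict_mono r" "AE x in M. (\<lambda>n. (f (r n) x - F x)\<^sup>2) \<longlonglongrightarrow> 0"
    by auto
  have "(\<lambda>n. f (r n) x) \<longlonglongrightarrow> F x" if "(\<lambda>n. (f (r n) x - F x)\<^sup>2) \<longlonglongrightarrow> 0" for x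
    by (rule LIM_zero_cancel[OF tendsto_rabs_zero_cancel]) (use tendsto_real_sqrt[OF that] in simp)
  then show ?thesis using r by (intro that[of r]) auto
qed

text \<open>Dominating \<open>h\<close> by \<open>min h a + h\<^sup>2 / a\<close> reduces the claim to bounded convergence.\<close>

lemma (in finite_measure) integral_tendsto_zero_of_L2_bounded:
  assumes h: "\<And>n. square_integrable M (h n)" "\<And>n x. 0 \<le> h n x"
    and lim: "AE x in M. (\<lambda>n. h n x) \<longlonglongrightarrow> 0" and K: "\<And>n. (\<integral>x. (h n x)\<^sup>2 \<partial>M) \<le> K"
  shows "(\<lambda>n. \<integral>x. h n x \<partial>M) \<longlonglongrightarrow> 0"
proof (rule LIMSEQ_I)
  fix r :: real assume "r > 0"
  \<comment> \<open>At this level the tail term \<open>K / a\<close> is at most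
    \<open>r / 2\<close>; the absolute value and the \<open>+ 1\<close> keep \<open>a\<close>
    positive whatever the sign of \<open>K\<close>.\<close>
  define a where "a = 2 * (\<bar>K\<bar> + 1) / r"
  have "r * K \<le> r * (\<bar>K\<bar> + 1)" using \<open>r > 0\<close> by (intro mult_left_mono) auto
  then have a: "a > 0" "K / a \<le> r / 2"
    using \<open>r > 0\<close> by (auto simp: a_def field_simps)
  have m[measurable]: "h n \<in> borel_measurable M" for n using h by (auto simp: square_integrable_def)
  have "(\<lambda>n. \<integral>x. min (h n x) a \<partial>M) \<longlonglongrightarrow> (\<integral>x. 0 \<partial>M)"
  proof (rule integral_dominated_convergence[where w="\<lambda>_. a"])
    show "AE x in M. (\<lambda>n. min (h n x) a) \<longlonglongrightarrow> 0"
      using lim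
    proof eventually_elim
      case (elim x)
      then show ?case using tendsto_min[OF elim tendsto_const[of a]] a by simp
    qed
    show "AE x in M. norm (min (h n x) a) \<le> a" for n using h(2) a by (intro AE_I2) (auto simp: min_def)
  qed auto
  then obtain N where N: "\<And>n. n \<ge> N \<Longrightarrow> norm ((\<integral>x. min (h n x) a \<partial>M) - 0) < r / 2"
    using LIMSEQ_D[of _ "0::real" "r/2"] \<open>r > 0\<close> by auto
  show "\<exists>no. \<forall>n\<ge>no. norm ((\<integral>x. h n x \<partial>M) - 0) < r"
  proof (intro exI allI impI)
    fix n assume "n \<ge> N"
    have i: "integrable M (\<lambda>x. min (h n x) a)"
      by (rule integrable_const_bound[of _ a]) (use h(2) a in \<open>auto simp: min_def\<close>)
    have i2: "integrable M (\<lambda>x. (h n x)\<^sup>2)" using h(1) by (auto simp: square_integrable_def)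
    have "(\<integral>x. h n x \<partial>M) \<le> (\<integral>x. min (h n x) a + (h n x)\<^sup>2 / a \<partial>M)"
    proof (intro integral_mono)
      show "h n x \<le> min (h n x) a + (h n x)\<^sup>2 / a" for x
      proof (cases "h n x \<le> a")
        case False
        then have "a * h n x \<le> h n x * h n x" using h(2) by (intro mult_right_mono) auto
        then have "h n x \<le> (h n x)\<^sup>2 / a" using a by (simp add: field_simps power2_eq_square)
        then show ?thesis using False a by (simp add: min_def)
      qed (use a in auto)
    qed (use i i2 square_integrable_integrable[OF h(1)] in auto)
    also have "\<dots> = (\<integral>x. min (h n x) a \<partial>M) + (\<integral>x. (h n x)\<^sup>2 \<partial>M) / a" using i i2 by simp
    also have "\<dots> < r / 2 + K / a"
      using N[OF \<open>n \<ge> N\<close>] K[of n] a(1) by (intro add_less_le_mono) (auto intro: divide_right_mono)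
    also have "\<dots> \<le> r" using a(2) by linarith
    finally show "norm ((\<integral>x. h n x \<partial>M) - 0) < r" using h(2) by simp
  qed
qed

section \<open>Brownian increments\<close>

locale filtered_space = prob_space M for M :: "'a measure" +
  fixes F :: "real \<Rightarrow> 'a measure"
  assumes filtered: "filtered_prob_space M F"
begin

lemma subalgebra_F: "subalgebra M (F t)"
  using filtered by (simp add: filtered_prob_space_def)

lemma subalgebra_F_mono: "s \<le> t \<Longrightarrow> subalgebra (F t) (F s)"
  using filtered by (auto simp: filtered_prob_space_def subalgebra_def filtration_def)

lemma space_F: "space (F t) = space M"
  using subalgebra_F by (simp add: subalgebra_def)

lemma measurable_F: "f \<in> measurable (F t) N \<Longrightarrow> f \<in> measurable M N"
  using measurable_from_subalg[OF subalgebra_F] .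

lemma measurable_F_mono: "f \<in> measurable (F s) N \<Longrightarrow> s \<le> t \<Longrightarrow> f \<in> measurable (F t) N"
  using measurable_from_subalg[OF subalgebra_F_mono] by blast

lemma sets_F: "A \<in> sets (F t) \<Longrightarrow> A \<in> sets M"
  using subalgebra_F by (auto simp: subalgebra_def)

lemma sigma_finite_subalgebra_F: "sigma_finite_subalgebra M (F t)"
proof -
  interpret finite_measure_subalgebra M "F t"
    by unfold_locales (rule subalgebra_F)
  show ?thesis by unfold_locales
qed

end

locale brownian_space = filtered_space M F for M :: "'a measure" and F +
  fixes B :: "real \<Rightarrow> 'a \<Rightarrow> real"
  assumes brownian: "brownian_motion M F B"
begin

lemma B_measurable_F: "0 \<le> t \<Longrightarrow> B t \<in> borel_measurable (F t)"
  using brownian by (simp add: brownian_motion_def adapted_def)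

lemma B_measurable [measurable]: "0 \<le> t \<Longrightarrow> B t \<in> borel_measurable M"
  using B_measurable_F measurable_F by blast

lemma B_measurable_F': "0 \<le> s \<Longrightarrow> s \<le> t \<Longrightarrow> B s \<in> borel_measurable (F t)"
  using B_measurable_F measurable_F_mono by blast

lemma increment_indep:
  assumes "0 \<le> s" "s < t" and X: "X \<in> measurable (F s) (N :: real measure)"
  shows "indep_var N X borel (\<lambda>\<omega>. B t \<omega> - B s \<omega>)"
proof -
  let ?D = "\<lambda>\<omega>. B t \<omega> - B s \<omega>"
  have D: "?D \<in> borel_measurable M" using B_measurable[of s] B_measurable[of t] assms by simp
  have i: "indep_set (sets (F s)) (sets (vimage_algebra (space M) ?D borel))"
    using brownian assms by (simp add: brownian_motion_def)
  have "{X -` A \<inter> space M |A. A \<in> sets N} \<subseteq> sets (F s)"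
    using measurable_sets[OF X] by (auto simp: space_F)
  then have 1: "sigma_sets (space M) {X -` A \<inter> space M |A. A \<in> sets N} \<subseteq> sets (F s)"
    using sets.sigma_sets_subset[of _ "F s"] by (simp add: space_F)
  have 2: "sigma_sets (space M) {?D -` A \<inter> space M |A. A \<in> sets borel}
      \<subseteq> sets (vimage_algebra (space M) ?D borel)"
    by (simp add: sets_vimage_algebra)
  show ?thesis
    unfolding indep_var_eq
    using i 1 2 D measurable_F[OF X] unfolding indep_sets2_eq by blast
qed

lemma increment_distributed:
  "0 \<le> s \<Longrightarrow> s < t \<Longrightarrow>
    distributed M lborel (\<lambda>\<omega>. B t \<omega> - B s \<omega>) (normal_density 0 (sqrt (t - s)))"
  using brownian by (simp add: brownian_motion_def)

text \<open>Freezing: given \<open>F s\<close>, everything known at time \<open>s\<close> is a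
  constant and the increment is integrated against its Gaussian density. The identity map is treated
  as a random variable with values in \<open>(\<Omega>, F s)\<close>; independence of the increment
  from all of \<open>F s\<close> then makes the joint law a product measure, and Tonelli applies.
  This form covers functions that do not split into a product, such as
  \<open>exp (c \<omega> * x)\<close>.\<close>

lemma increment_nn_integral:
  assumes st: "0 \<le> s" "s < t" and f: "f \<in> borel_measurable (F s \<Otimes>\<^sub>M borel)"
  shows "(\<integral>\<^sup>+\<omega>. f (\<omega>, B t \<omega> - B s \<omega>) \<partial>M) =
     (\<integral>\<^sup>+\<omega>. (\<integral>\<^sup>+x. ennreal (normal_density 0 (sqrt (t - s)) x) * f (\<omega>, x) \<partial>lborel) \<partial>M)"
proof -
  let ?D = "\<lambda>\<omega>. B t \<omega> - B s \<omega>"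
  let ?N = "density lborel (\<lambda>x. ennreal (normal_density 0 (sqrt (t - s)) x))"
  have D: "?D \<in> borel_measurable M" using B_measurable[of s] B_measurable[of t] st by simp
  have id: "(\<lambda>\<omega>. \<omega>) \<in> measurable M (F s)" by (rule measurable_F[of _ s]) simp
  have f'[measurable]: "f \<in> borel_measurable (F s \<Otimes>\<^sub>M lborel)"
    using f by (simp cong: measurable_cong_sets)
  interpret N: prob_space ?N
    using st by (intro prob_space_normal_density) simp
  have eq: "distr M (F s) (\<lambda>\<omega>. \<omega>) \<Otimes>\<^sub>M distr M borel ?D = distr M (F s \<Otimes>\<^sub>M borel) (\<lambda>\<omega>. (\<omega>, ?D \<omega>))"
  proof (rule pair_measure_eqI)
    show "sigma_finite_measure (distr M (F s) (\<lambda>\<omega>. \<omega>))" "sigma_finite_measure (distr M borel ?D)"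
      using prob_space_distr[OF id] prob_space_distr[OF D] by (auto intro: prob_space_imp_sigma_finite)
    fix A C assume AC: "A \<in> sets (distr M (F s) (\<lambda>\<omega>. \<omega>))" "C \<in> sets (distr M borel ?D)"
    have A: "A \<inter> space M = A" "A \<in> sets M" using AC sets_F sets.sets_into_space by fastforce+
    have C: "?D -` C \<inter> space M \<in> sets M" using AC D by auto
    have "prob (A \<inter> (?D -` C \<inter> space M)) = prob A * prob (?D -` C \<inter> space M)"
      using brownian st AC
      by (intro indep_setD[of "sets (F s)" "sets (vimage_algebra (space M) ?D borel)"])
         (auto simp: brownian_motion_def intro!: in_vimage_algebra)
    moreover have "(\<lambda>\<omega>. (\<omega>, ?D \<omega>)) -` (A \<times> C) \<inter> space M = A \<inter> (?D -` C \<inter> space M)" by auto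
    ultimately show "emeasure (distr M (F s) (\<lambda>\<omega>. \<omega>)) A * emeasure (distr M borel ?D) C
        = emeasure (distr M (F s \<Otimes>\<^sub>M borel) (\<lambda>\<omega>. (\<omega>, ?D \<omega>))) (A \<times> C)"
      using AC A C D id by (simp add: emeasure_distr emeasure_eq_measure ennreal_mult)
  qed simp
  have dD: "distr M borel ?D = ?N"
    using increment_distributed[OF st] distr_cong[of M M borel lborel ?D ?D]
    by (simp add: distributed_def)
  have "(\<integral>\<^sup>+\<omega>. f (\<omega>, ?D \<omega>) \<partial>M) = (\<integral>\<^sup>+z. f z \<partial>distr M (F s \<Otimes>\<^sub>M borel) (\<lambda>\<omega>. (\<omega>, ?D \<omega>)))"
    using f D id by (subst nn_integral_distr) auto
  also have "\<dots> = (\<integral>\<^sup>+z. f z \<partial>(distr M (F s) (\<lambda>\<omega>. \<omega>) \<Otimes>\<^sub>M ?N))"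
    unfolding eq[symmetric] dD ..
  also have "\<dots> = (\<integral>\<^sup>+\<omega>. (\<integral>\<^sup>+x. f (\<omega>, x) \<partial>?N) \<partial>distr M (F s) (\<lambda>\<omega>. \<omega>))"
    by (subst N.nn_integral_fst[symmetric]) (auto simp: f' cong: measurable_cong_sets)
  also have "\<dots> = (\<integral>\<^sup>+\<omega>. (\<integral>\<^sup>+x. f (\<omega>, x) \<partial>?N) \<partial>M)"
    by (subst nn_integral_distr[OF id]) (auto intro!: N.borel_measurable_nn_integral_fst cong: measurable_cong_sets)
  also have "\<dots> = (\<integral>\<^sup>+\<omega>. (\<integral>\<^sup>+x. ennreal (normal_density 0 (sqrt (t - s)) x) * f (\<omega>, x) \<partial>lborel) \<partial>M)"
    by (intro nn_integral_cong nn_integral_density)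
       (auto simp: space_F intro!: measurable_compose[OF measurable_Pair1' f'])
  finally show ?thesis .
qed

lemma increment_mult:
  assumes st: "0 \<le> s" "s < t" and g: "g \<in> borel_measurable (F s)" "integrable M g"
    and \<phi>: "\<phi> \<in> borel_measurable borel" "integrable M (\<lambda>\<omega>. \<phi> (B t \<omega> - B s \<omega>))"
  shows "integrable M (\<lambda>\<omega>. g \<omega> * \<phi> (B t \<omega> - B s \<omega>))"
    and "(\<integral>\<omega>. g \<omega> * \<phi> (B t \<omega> - B s \<omega>) \<partial>M) = (\<integral>\<omega>. g \<omega> \<partial>M) * (\<integral>\<omega>. \<phi> (B t \<omega> - B s \<omega>) \<partial>M :: real)"
proof -
  have i: "indep_var borel g borel (\<lambda>\<omega>. \<phi> (B t \<omega> - B s \<omega>))"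
    using indep_var_compose[OF increment_indep[OF st g(1)], of "\<lambda>x. x" borel \<phi> borel] \<phi>(1)
    by (simp add: o_def)
  show "integrable M (\<lambda>\<omega>. g \<omega> * \<phi> (B t \<omega> - B s \<omega>))"
    using indep_var_integrable[OF i g(2) \<phi>(2)] .
  show "(\<integral>\<omega>. g \<omega> * \<phi> (B t \<omega> - B s \<omega>) \<partial>M) = (\<integral>\<omega>. g \<omega> \<partial>M) * (\<integral>\<omega>. \<phi> (B t \<omega> - B s \<omega>) \<partial>M)"
    using indep_var_lebesgue_integral[OF i g(2) \<phi>(2)] .
qed

lemma increment_moments:
  assumes "0 \<le> s" "s < t"
  shows "integrable M (\<lambda>\<omega>. B t \<omega> - B s \<omega>)" "(\<integral>\<omega>. B t \<omega> - B s \<omega> \<partial>M) = 0"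
    and "integrable M (\<lambda>\<omega>. (B t \<omega> - B s \<omega>)\<^sup>2)" "(\<integral>\<omega>. (B t \<omega> - B s \<omega>)\<^sup>2 \<partial>M) = t - s"
proof -
  note d = increment_distributed[OF assms]
  have p: "sqrt (t - s) > 0" using assms by simp
  have int: "integrable M (\<lambda>\<omega>. (B t \<omega> - B s \<omega>) ^ k)" for k
    using integrable_normal_moment[OF p, of 0 k]
    by (subst distributed_integrable[OF d, symmetric]) auto
  show 1: "integrable M (\<lambda>\<omega>. B t \<omega> - B s \<omega>)" "integrable M (\<lambda>\<omega>. (B t \<omega> - B s \<omega>)\<^sup>2)"
    using int[of 1] int[of 2] by auto
  show 2: "(\<integral>\<omega>. B t \<omega> - B s \<omega> \<partial>M) = 0"
    using normal_distributed_expectation[OF p d] .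
  show "(\<integral>\<omega>. (B t \<omega> - B s \<omega>)\<^sup>2 \<partial>M) = t - s"
    using normal_distributed_variance[OF p d] assms unfolding 2 by simp
qed

lemma increment_mean:
  assumes st: "0 \<le> s" "s \<le> t" and g: "g \<in> borel_measurable (F s)" "integrable M g"
  shows "integrable M (\<lambda>\<omega>. g \<omega> * (B t \<omega> - B s \<omega>))"
    and "(\<integral>\<omega>. g \<omega> * (B t \<omega> - B s \<omega>) \<partial>M) = 0"
  using increment_mult[OF st(1) _ g, of t "\<lambda>x. x"] increment_moments[OF st(1), of t] st
  \<comment> \<open>The Gaussian law is postulated for \<open>s < t\<close> only; for
    \<open>s = t\<close> the increment is \<open>0\<close>.\<close>
  by (cases "s = t"; force)+

lemma increment_square:
  assumes st: "0 \<le> s" "s \<le> t" and g: "g \<in> borel_measurable (F s)" "integrable M g"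
  shows "integrable M (\<lambda>\<omega>. g \<omega> * (B t \<omega> - B s \<omega>)\<^sup>2)"
    and "(\<integral>\<omega>. g \<omega> * (B t \<omega> - B s \<omega>)\<^sup>2 \<partial>M) = (t - s) * (\<integral>\<omega>. g \<omega> \<partial>M)"
  using increment_mult[OF st(1) _ g, of t "\<lambda>x. x\<^sup>2"] increment_moments[OF st(1), of t] st
  by (cases "s = t"; force)+

lemma increment_square_integrable:
  assumes st: "0 \<le> s" "s \<le> t" and g: "g \<in> borel_measurable (F s)" "square_integrable M g"
  shows "square_integrable M (\<lambda>\<omega>. g \<omega> * (B t \<omega> - B s \<omega>))"
    and "(\<integral>\<omega>. (g \<omega> * (B t \<omega> - B s \<omega>))\<^sup>2 \<partial>M) = (t - s) * (\<integral>\<omega>. (g \<omega>)\<^sup>2 \<partial>M)"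
  using increment_square[OF st, of "\<lambda>\<omega>. (g \<omega>)\<^sup>2"] g st
  by (auto simp: square_integrable_def power_mult_distrib)

end

section \<open>Elementary stochastic integrals\<close>

lemma integral_double_sum:
  fixes f :: "'i \<Rightarrow> 'j \<Rightarrow> 'a \<Rightarrow> real"
  assumes "\<And>i j. i \<in> J \<Longrightarrow> j \<in> K \<Longrightarrow> integrable M (f i j)"
  shows "(\<integral>x. (\<Sum>i\<in>J. \<Sum>j\<in>K. f i j x) \<partial>M) = (\<Sum>i\<in>J. \<Sum>j\<in>K. \<integral>x. f i j x \<partial>M)"
proof -
  have "(\<integral>x. (\<Sum>i\<in>J. \<Sum>j\<in>K. f i j x) \<partial>M) = (\<Sum>i\<in>J. \<integral>x. (\<Sum>j\<in>K. f i j x) \<partial>M)"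
    by (intro Bochner_Integration.integral_sum Bochner_Integration.integrable_sum assms)
  also have "\<dots> = (\<Sum>i\<in>J. \<Sum>j\<in>K. \<integral>x. f i j x \<partial>M)"
    by (intro sum.cong refl Bochner_Integration.integral_sum assms)
  finally show ?thesis .
qed

context brownian_space
begin

text \<open>The longer increment is cut where the shorter one ends. The common piece contributes its
  variance, and the excess is centred given everything known when it begins.\<close>

lemma common_start_product:
  assumes p: "0 \<le> p" "p \<le> b" "p \<le> b'" and g: "g \<in> borel_measurable (F p)"
    "\<And>\<omega>. \<omega> \<in> space M \<Longrightarrow> \<bar>g \<omega>\<bar> \<le> C"
  shows "(\<integral>\<omega>. g \<omega> * (B b \<omega> - B p \<omega>) * (B b' \<omega> - B p \<omega>) \<partial>M) = (min b b' - p) * (\<integral>\<omega>. g \<omega> \<partial>M)"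
proof -
  have gM: "integrable M g"
    using square_integrable_bounded[of g C] g measurable_F square_integrable_integrable by blast
  have *: "(\<integral>\<omega>. g \<omega> * (B b \<omega> - B p \<omega>) * (B b' \<omega> - B p \<omega>) \<partial>M) = (b - p) * (\<integral>\<omega>. g \<omega> \<partial>M)"
    if b: "p \<le> b" "b \<le> b'" for b b'
  proof -
    have m: "(\<lambda>\<omega>. g \<omega> * (B b \<omega> - B p \<omega>)) \<in> borel_measurable (F b)"
      using p b g B_measurable_F'[of p b] B_measurable_F[of b] measurable_F_mono[OF g(1)] by auto
    have i: "integrable M (\<lambda>\<omega>. g \<omega> * (B b \<omega> - B p \<omega>))"
      using increment_mean(1)[OF p(1) b(1) g(1) gM] .
    note z = increment_mean[OF _ b(2) m i] and sq = increment_square[OF p(1) b(1) g(1) gM]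
    have "(\<integral>\<omega>. g \<omega> * (B b \<omega> - B p \<omega>) * (B b' \<omega> - B p \<omega>) \<partial>M)
       = (\<integral>\<omega>. g \<omega> * (B b \<omega> - B p \<omega>)\<^sup>2 + g \<omega> * (B b \<omega> - B p \<omega>) * (B b' \<omega> - B b \<omega>) \<partial>M)"
      by (intro Bochner_Integration.integral_cong) (auto simp: power2_eq_square algebra_simps)
    also have "\<dots> = (b - p) * (\<integral>\<omega>. g \<omega> \<partial>M)" using z sq p b by simp
    finally show ?thesis .
  qed
  show ?thesis
    using *[of b b'] *[of b' b] p by (cases "b \<le> b'") (auto simp: min_def mult.assoc mult.commute mult.left_commute)
qed

text \<open>For \<open>a \<le> a'\<close> the first interval is cut at \<open>q = min b a'\<close>.
  The part before \<open>a'\<close> is known at time \<open>a'\<close> and is annihilated by the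
  later increment; what remains of the two increments starts at the common point \<open>a'\<close>.
  The case \<open>a' \<le> a\<close> follows by symmetry.\<close>

lemma elementary_product:
  assumes a: "0 \<le> a" "a \<le> b" "0 \<le> a'" "a' \<le> b'"
    and c: "c \<in> borel_measurable (F a)" "\<And>\<omega>. \<omega> \<in> space M \<Longrightarrow> \<bar>c \<omega>\<bar> \<le> C"
    and c': "c' \<in> borel_measurable (F a')" "\<And>\<omega>. \<omega> \<in> space M \<Longrightarrow> \<bar>c' \<omega>\<bar> \<le> C'"
  shows "(\<integral>\<omega>. (c \<omega> * (B b \<omega> - B a \<omega>)) * (c' \<omega> * (B b' \<omega> - B a' \<omega>)) \<partial>M) =
     measure lborel ({a<..b} \<inter> {a'<..b'}) * (\<integral>\<omega>. c \<omega> * c' \<omega> \<partial>M)"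
proof -
  have *: "(\<integral>\<omega>. (c \<omega> * (B b \<omega> - B a \<omega>)) * (c' \<omega> * (B b' \<omega> - B a' \<omega>)) \<partial>M) =
     measure lborel ({a<..b} \<inter> {a'<..b'}) * (\<integral>\<omega>. c \<omega> * c' \<omega> \<partial>M)"
    if a: "0 \<le> a" "a \<le> b" "a' \<le> b'" "a \<le> a'"
    and c: "c \<in> borel_measurable (F a)" "\<And>\<omega>. \<omega> \<in> space M \<Longrightarrow> \<bar>c \<omega>\<bar> \<le> C"
    and c': "c' \<in> borel_measurable (F a')" "\<And>\<omega>. \<omega> \<in> space M \<Longrightarrow> \<bar>c' \<omega>\<bar> \<le> C'"
    for a b a' b' c C c' C'
  proof -
    define q where "q = min b a'"
    have q: "a \<le> q" "q \<le> a'" "q \<le> b" using a by (auto simp: q_def)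
    have ci: "square_integrable M c" "square_integrable M c'"
      using square_integrable_bounded c c' measurable_F by blast+
    have g: "(\<lambda>\<omega>. c \<omega> * c' \<omega>) \<in> borel_measurable (F a')"
      using measurable_F_mono[OF c(1), of a'] c' a by auto
    have gb: "\<bar>c \<omega> * c' \<omega>\<bar> \<le> C * C'" if "\<omega> \<in> space M" for \<omega>
      using c(2)[OF that] c'(2)[OF that] by (auto simp: abs_mult intro!: mult_mono)
    have d: "square_integrable M (\<lambda>\<omega>. c \<omega> * (B q \<omega> - B a \<omega>))"
      using increment_square_integrable(1)[of a q c] a q c ci by auto
    have dm: "(\<lambda>\<omega>. c \<omega> * (B q \<omega> - B a \<omega>)) \<in> borel_measurable (F a')"
      using measurable_F_mono[OF c(1), of a'] a q B_measurable_F'[of q a'] B_measurable_F'[of a a'] by auto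
    have e: "(\<lambda>\<omega>. c \<omega> * (B q \<omega> - B a \<omega>) * c' \<omega>) \<in> borel_measurable (F a')"
      "integrable M (\<lambda>\<omega>. c \<omega> * (B q \<omega> - B a \<omega>) * c' \<omega>)"
      using dm c' square_integrable_mult[OF d ci(2)] by auto
    note z = increment_mean[OF _ a(3) e]
    show ?thesis
    proof (cases "b \<le> a'")
      case True
      then have "q = b" and e: "{a<..b} \<inter> {a'<..b'} = {}" by (auto simp: q_def)
      have "measure lborel ({a<..b} \<inter> {a'<..b'}) = 0" by (simp only: e measure_empty)
      then show ?thesis using z a \<open>q = b\<close> by (simp add: mult.assoc del: Int_greaterThanAtMost)
    next
      case False
      then have qa: "q = a'" by (auto simp: q_def)
      have gi: "square_integrable M (\<lambda>\<omega>. c \<omega> * c' \<omega>)"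
        by (rule square_integrable_bounded[OF measurable_F[OF g] gb])
      have "square_integrable M (\<lambda>\<omega>. c \<omega> * c' \<omega> * (B b \<omega> - B a' \<omega>))"
        "square_integrable M (\<lambda>\<omega>. 1 * (B b' \<omega> - B a' \<omega>))"
        using increment_square_integrable(1)[OF _ _ g gi, of b] False a
          increment_square_integrable(1)[of a' b' "\<lambda>_. 1"] square_integrable_bounded[of "\<lambda>_. 1" 1] by auto
      from square_integrable_mult[OF this]
      have i: "integrable M (\<lambda>\<omega>. c \<omega> * c' \<omega> * (B b \<omega> - B a' \<omega>) * (B b' \<omega> - B a' \<omega>))" by simp
      have "(\<integral>\<omega>. (c \<omega> * (B b \<omega> - B a \<omega>)) * (c' \<omega> * (B b' \<omega> - B a' \<omega>)) \<partial>M)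
        = (\<integral>\<omega>. c \<omega> * (B q \<omega> - B a \<omega>) * c' \<omega> * (B b' \<omega> - B a' \<omega>)
             + c \<omega> * c' \<omega> * (B b \<omega> - B a' \<omega>) * (B b' \<omega> - B a' \<omega>) \<partial>M)"
        by (intro Bochner_Integration.integral_cong) (auto simp: qa algebra_simps)
      also have "\<dots> = (\<integral>\<omega>. c \<omega> * c' \<omega> * (B b \<omega> - B a' \<omega>) * (B b' \<omega> - B a' \<omega>) \<partial>M)"
        using z i a by simp
      also have "\<dots> = (min b b' - a') * (\<integral>\<omega>. c \<omega> * c' \<omega> \<partial>M)"
        using False a by (intro common_start_product[OF _ _ _ g gb]) auto
      also have "{a<..b} \<inter> {a'<..b'} = {a'<..min b b'}" using a False by auto
      then have "min b b' - a' = measure lborel ({a<..b} \<inter> {a'<..b'})" using False a by simp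
      finally show ?thesis .
    qed
  qed
  show ?thesis
  proof (cases "a \<le> a'")
    case True
    then show ?thesis using *[of a b a' b' c C c' C'] assms by blast
  next
    case False
    then have "a' \<le> a" by simp
    have "(\<integral>\<omega>. (c \<omega> * (B b \<omega> - B a \<omega>)) * (c' \<omega> * (B b' \<omega> - B a' \<omega>)) \<partial>M)
      = (\<integral>\<omega>. (c' \<omega> * (B b' \<omega> - B a' \<omega>)) * (c \<omega> * (B b \<omega> - B a \<omega>)) \<partial>M)"
      by (simp add: mult.commute)
    also have "\<dots> = measure lborel ({a'<..b'} \<inter> {a<..b}) * (\<integral>\<omega>. c' \<omega> * c \<omega> \<partial>M)"
      by (rule *) (use assms \<open>a' \<le> a\<close> in auto)
    finally show ?thesis by (simp add: mult.commute Int_commute)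
  qed
qed

text \<open>The intervals are unrelated and may overlap, since the mixed products already yield the
  lengths of the intersections. The isometry therefore applies directly to the difference of
  integrals over two different partitions, without a common refinement.\<close>

lemma elementary_isometry:
  fixes c :: "'i \<Rightarrow> 'a \<Rightarrow> real"
  assumes a: "\<And>i. i \<in> J \<Longrightarrow> 0 \<le> a i" "\<And>i. i \<in> J \<Longrightarrow> a i \<le> b i"
    and c: "\<And>i. i \<in> J \<Longrightarrow> c i \<in> borel_measurable (F (a i))"
      "\<And>i. i \<in> J \<Longrightarrow> \<exists>C. \<forall>\<omega>\<in>space M. \<bar>c i \<omega>\<bar> \<le> C"
  shows "square_integrable M (\<lambda>\<omega>. \<Sum>i\<in>J. c i \<omega> * (B (b i) \<omega> - B (a i) \<omega>))"
    and "(\<integral>\<omega>. (\<Sum>i\<in>J. c i \<omega> * (B (b i) \<omega> - B (a i) \<omega>))\<^sup>2 \<partial>M) =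
      (\<integral>\<omega>. (\<integral>u. (\<Sum>i\<in>J. c i \<omega> * indicator {a i<..b i} u)\<^sup>2 \<partial>lborel) \<partial>M)"
proof -
  obtain C where C: "\<And>i \<omega>. i \<in> J \<Longrightarrow> \<omega> \<in> space M \<Longrightarrow> \<bar>c i \<omega>\<bar> \<le> C i" using c(2) by metis
  have ci: "square_integrable M (c i)" if "i \<in> J" for i
    using square_integrable_bounded[OF measurable_F[OF c(1)] C] that by blast
  have s: "square_integrable M (\<lambda>\<omega>. c i \<omega> * (B (b i) \<omega> - B (a i) \<omega>))" if "i \<in> J" for i
    using increment_square_integrable(1)[OF a(1)[OF that] a(2)[OF that] c(1)[OF that] ci[OF that]] .
  then show "square_integrable M (\<lambda>\<omega>. \<Sum>i\<in>J. c i \<omega> * (B (b i) \<omega> - B (a i) \<omega>))"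
    by (rule square_integrable_sum)
  have fin: "emeasure lborel ({a i<..b i} \<inter> {a j<..b j}) < \<infinity>" if "i \<in> J" for i j
    by (rule order.strict_trans1[OF emeasure_mono[of _ "{a i<..b i}"]]) (use a(2)[OF that] in auto)
  have "(\<integral>\<omega>. (\<Sum>i\<in>J. c i \<omega> * (B (b i) \<omega> - B (a i) \<omega>))\<^sup>2 \<partial>M)
     = (\<integral>\<omega>. (\<Sum>i\<in>J. \<Sum>j\<in>J. (c i \<omega> * (B (b i) \<omega> - B (a i) \<omega>)) * (c j \<omega> * (B (b j) \<omega> - B (a j) \<omega>))) \<partial>M)"
    by (simp add: power2_eq_square sum_product)
  also have "\<dots> = (\<Sum>i\<in>J. \<Sum>j\<in>J. \<integral>\<omega>. (c i \<omega> * (B (b i) \<omega> - B (a i) \<omega>)) * (c j \<omega> * (B (b j) \<omega> - B (a j) \<omega>)) \<partial>M)"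
    by (intro integral_double_sum square_integrable_mult s)
  also have "\<dots> = (\<Sum>i\<in>J. \<Sum>j\<in>J. measure lborel ({a i<..b i} \<inter> {a j<..b j}) * (\<integral>\<omega>. c i \<omega> * c j \<omega> \<partial>M))"
    using a c(1) C by (intro sum.cong refl elementary_product) blast+
  also have "\<dots> = (\<Sum>i\<in>J. \<Sum>j\<in>J. (\<integral>\<omega>. measure lborel ({a i<..b i} \<inter> {a j<..b j}) * (c i \<omega> * c j \<omega>) \<partial>M))"
    by simp
  also have "\<dots> = (\<integral>\<omega>. (\<Sum>i\<in>J. \<Sum>j\<in>J. measure lborel ({a i<..b i} \<inter> {a j<..b j}) * (c i \<omega> * c j \<omega>)) \<partial>M)"
    by (intro integral_double_sum[symmetric] integrable_mult_right square_integrable_mult ci)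
  also have "\<dots> = (\<integral>\<omega>. (\<integral>u. (\<Sum>i\<in>J. c i \<omega> * indicator {a i<..b i} u)\<^sup>2 \<partial>lborel) \<partial>M)"
  proof (intro Bochner_Integration.integral_cong refl)
    fix \<omega>
    have i: "integrable lborel (\<lambda>u. (c i \<omega> * c j \<omega>) * indicator ({a i<..b i} \<inter> {a j<..b j}) u :: real)"
      if "i \<in> J" for i j
      using fin[OF that] by (intro integrable_mult_right integrable_real_indicator) auto
    have "(\<integral>u. (\<Sum>i\<in>J. c i \<omega> * indicator {a i<..b i} u)\<^sup>2 \<partial>lborel)
      = (\<integral>u. (\<Sum>i\<in>J. \<Sum>j\<in>J. (c i \<omega> * c j \<omega>) * indicator ({a i<..b i} \<inter> {a j<..b j}) u) \<partial>lborel)"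
      by (intro Bochner_Integration.integral_cong refl)
         (simp add: power2_eq_square sum_product indicator_inter_arith mult_ac del: Int_greaterThanAtMost)
    also have "\<dots> = (\<Sum>i\<in>J. \<Sum>j\<in>J. \<integral>u. (c i \<omega> * c j \<omega>) * indicator ({a i<..b i} \<inter> {a j<..b j}) u \<partial>lborel)"
      by (intro integral_double_sum i)
    also have "\<dots> = (\<Sum>i\<in>J. \<Sum>j\<in>J. measure lborel ({a i<..b i} \<inter> {a j<..b j}) * (c i \<omega> * c j \<omega>))"
      by (simp add: mult.commute)
    finally show "(\<Sum>i\<in>J. \<Sum>j\<in>J. measure lborel ({a i<..b i} \<inter> {a j<..b j}) * (c i \<omega> * c j \<omega>)) =
       (\<integral>u. (\<Sum>i\<in>J. c i \<omega> * indicator {a i<..b i} u)\<^sup>2 \<partial>lborel)" by simp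
  qed
  finally show "(\<integral>\<omega>. (\<Sum>i\<in>J. c i \<omega> * (B (b i) \<omega> - B (a i) \<omega>))\<^sup>2 \<partial>M) =
      (\<integral>\<omega>. (\<integral>u. (\<Sum>i\<in>J. c i \<omega> * indicator {a i<..b i} u)\<^sup>2 \<partial>lborel) \<partial>M)" .
qed

end

section \<open>Step approximation of integrands\<close>

text \<open>Equidistant nodes with \<open>Suc n\<close> cells, so that the mesh is defined for every
  \<open>n\<close>.\<close>

definition grid :: "real \<Rightarrow> real \<Rightarrow> nat \<Rightarrow> nat \<Rightarrow> real" where
  "grid s t n i = s + real i * ((t - s) / real (Suc n))"

lemma grid_0 [simp]: "grid s t n 0 = s"
  by (simp add: grid_def)

lemma grid_last [simp]: "grid s t n (Suc n) = t"
  by (simp add: grid_def)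

lemma grid_diff: "grid s t n (Suc i) - grid s t n i = (t - s) / real (Suc n)"
proof -
  have "s + real (Suc i) * d - (s + real i * d) = d" for d :: real
    by (simp add: algebra_simps)
  then show ?thesis unfolding grid_def .
qed

lemma grid_mono: "s \<le> t \<Longrightarrow> i \<le> j \<Longrightarrow> grid s t n i \<le> grid s t n j"
  by (auto simp: grid_def intro!: divide_right_mono mult_right_mono)

lemma grid_ge: "s \<le> t \<Longrightarrow> s \<le> grid s t n i"
  using grid_mono[of s t 0 i n] by simp

lemma grid_le: "s \<le> t \<Longrightarrow> i \<le> Suc n \<Longrightarrow> grid s t n i \<le> t"
  using grid_mono[of s t i "Suc n" n] by simp

text \<open>The value at the left endpoint is spread over a cell that is open on the left and closed
  on the right, so it is known when the cell begins; the cells match those of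
  \<open>simple_process\<close>.\<close>

definition step :: "(real \<Rightarrow> real) \<Rightarrow> real \<Rightarrow> real \<Rightarrow> nat \<Rightarrow> real \<Rightarrow> real" where
  "step h s t n u = (\<Sum>i<Suc n. h (grid s t n i) * indicator {grid s t n i<..grid s t n (Suc i)} u)"

lemma grid_cell:
  assumes "s < u" "u \<le> t"
  obtains i where "i < Suc n" "grid s t n i < u" "u \<le> grid s t n (Suc i)"
proof -
  define P where "P i \<longleftrightarrow> u \<le> grid s t n i" for i
  have "P (Suc n)" using assms by (simp add: P_def)
  then obtain j where j: "P j" "\<And>i. i < j \<Longrightarrow> \<not> P i" "j \<le> Suc n"
    by (metis LeastI Least_le not_less_Least)
  have "\<not> P 0" using assms by (simp add: P_def)
  then have "j \<noteq> 0" using j(1) by (cases j) auto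
  then obtain i where "j = Suc i" by (cases j) auto
  then show ?thesis using j that[of i] by (auto simp: P_def not_le)
qed

lemma step_eq:
  assumes st: "s \<le> t" and i: "i < Suc n" "grid s t n i < u" "u \<le> grid s t n (Suc i)"
  shows "step h s t n u = h (grid s t n i)"
proof -
  have "u \<notin> {grid s t n j<..grid s t n (Suc j)}" if "j \<noteq> i" for j
    using that i grid_mono[OF st, of "Suc j" i n] grid_mono[OF st, of "Suc i" j n]
    by (cases "j < i") (auto simp: not_less)
  then have "step h s t n u = (\<Sum>j<Suc n. if j = i then h (grid s t n i) else 0)"
    unfolding step_def using i by (intro sum.cong refl) (auto simp: indicator_def)
  then show ?thesis using i by simp
qed

lemma step_outside:
  assumes "s \<le> t" "u \<notin> {s<..t}" shows "step h s t n u = 0"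
  unfolding step_def
proof (intro sum.neutral ballI)
  fix i assume "i \<in> {..<Suc n}"
  then have "u \<notin> {grid s t n i<..grid s t n (Suc i)}"
    using assms(2) grid_ge[OF assms(1), of n i] grid_le[OF assms(1), of "Suc i" n] by auto
  then show "h (grid s t n i) * indicator {grid s t n i<..grid s t n (Suc i)} u = 0" by simp
qed

text \<open>The sampling node \<open>v\<close> serves all functions \<open>h\<close> at once; this
  uniformity is what allows several step functions to be combined pointwise.\<close>

lemma step_cases:
  assumes "s \<le> t" "u \<in> {s<..t}"
  obtains v where "s \<le> v" "v \<le> u" "u - v \<le> (t - s) / real (Suc n)" "\<And>h. step h s t n u = h v"
proof -
  obtain i where i: "i < Suc n" "grid s t n i < u" "u \<le> grid s t n (Suc i)"
    using grid_cell[of s u t n] assms by auto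
  show ?thesis
    using that[of "grid s t n i"] step_eq[OF assms(1) i] i grid_ge[OF assms(1)] grid_diff[of s t n i]
    by (smt (verit))
qed

lemma step_tendsto:
  assumes "0 \<le> s" "s \<le> t" "u \<in> {s<..t}" and c: "continuous (at u within {0..}) h"
  shows "(\<lambda>n. step h s t n u) \<longlonglongrightarrow> h u"
proof -
  have "\<exists>v. s \<le> v \<and> v \<le> u \<and> u - v \<le> (t - s) / real (Suc n) \<and> step h s t n u = h v" for n
    using step_cases[OF assms(2,3), of n] by metis
  then obtain v where v: "\<And>n. s \<le> v n" "\<And>n. v n \<le> u" "\<And>n. u - v n \<le> (t - s) / real (Suc n)"
    "\<And>n. step h s t n u = h (v n)" by metis
  have lim: "(\<lambda>n. (t - s) / real (Suc n)) \<longlonglongrightarrow> 0"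
    using tendsto_mult_right[OF LIMSEQ_inverse_real_of_nat, of "t - s"] by (simp add: divide_inverse mult.commute)
  have "(\<lambda>n. u - v n) \<longlonglongrightarrow> 0"
    by (rule real_tendsto_sandwich[OF _ _ tendsto_const lim]) (use v in auto)
  then have "v \<longlonglongrightarrow> u" using tendsto_diff[OF tendsto_const[of u]] by fastforce
  then have "(\<lambda>n. h (v n)) \<longlonglongrightarrow> h u"
    by (intro continuous_within_tendsto_compose'[OF c]) (use v(1) assms in \<open>auto intro: order_trans\<close>)
  then show ?thesis by (simp add: v(4))
qed

lemma step_bound:
  assumes "0 \<le> s" "s \<le> t" "\<And>v. 0 \<le> v \<Longrightarrow> \<bar>h v\<bar> \<le> C" shows "\<bar>step h s t n u\<bar> \<le> C"
proof (cases "u \<in> {s<..t}")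
  case True
  then show ?thesis using step_cases[OF assms(2) True, of n] assms by (metis order_trans)
next
  case False
  have "0 \<le> C" using assms(3)[of 0] by simp
  then show ?thesis using step_outside[OF assms(2) False] by simp
qed

text \<open>Inside \<open>{s<..t}\<close> both step functions sample at the same node; outside they
  vanish, which is where \<open>f 0 0 = 0\<close> enters.\<close>

lemma step_map:
  assumes "s \<le> t" "f 0 0 = 0"
  shows "f (step h s t n u) (step h' s t n u) = step (\<lambda>v. f (h v) (h' v)) s t n u"
proof (cases "u \<in> {s<..t}")
  case True
  then obtain v where "\<And>h. step h s t n u = h v" using step_cases[OF assms(1) True, of n] by metis
  then show ?thesis by simp
qed (use step_outside[OF assms(1), of u] assms(2) in simp)

lemma step_measurable [measurable]: "step h s t n \<in> borel_measurable borel"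
  unfolding step_def by measurable

lemma integral_step:
  assumes "s \<le> t"
  shows "integrable lborel (step h s t n)"
    "(\<integral>u. step h s t n u \<partial>lborel) = (\<Sum>i<Suc n. h (grid s t n i) * ((t - s) / real (Suc n)))"
proof -
  have i: "integrable lborel (\<lambda>u. h (grid s t n i) * indicator {grid s t n i<..grid s t n (Suc i)} u)" for i
    by (intro integrable_mult_right integrable_real_indicator) (auto simp: grid_mono[OF assms])
  then show "integrable lborel (step h s t n)"
    unfolding step_def by (intro Bochner_Integration.integrable_sum)
  show "(\<integral>u. step h s t n u \<partial>lborel) = (\<Sum>i<Suc n. h (grid s t n i) * ((t - s) / real (Suc n)))"
    unfolding step_def
    by (subst Bochner_Integration.integral_sum[OF i], intro sum.cong refl)
       (simp add: grid_mono[OF assms] grid_diff del: of_nat_Suc)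
qed

section \<open>Time integrals of bounded integrands with few discontinuities\<close>

definition time_integral :: "(real \<Rightarrow> 'a \<Rightarrow> real) \<Rightarrow> real \<Rightarrow> real \<Rightarrow> 'a \<Rightarrow> real" where
  "time_integral G s t \<omega> = (\<integral>u. indicator {s<..t} u * G u \<omega> \<partial>lborel)"

context filtered_space
begin

text \<open>A countable set of discontinuities is Lebesgue null, so left endpoint steps converge to
  the path almost everywhere, and the bound \<open>C\<close> gives dominated convergence.
  Countability is preserved when two integrands are combined. Continuity is relative to
  \<open>{0..}\<close> because nothing is known at negative times.\<close>

definition regular_integrand :: "real \<Rightarrow> (real \<Rightarrow> 'a \<Rightarrow> real) \<Rightarrow> bool" where
  "regular_integrand C H \<longleftrightarrow> progressively_measurable F H \<and>
     (\<forall>u\<ge>0. \<forall>\<omega>\<in>space M. \<bar>H u \<omega>\<bar> \<le> C) \<and>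
     (\<forall>\<omega>\<in>space M. countable {u. 0 \<le> u \<and> \<not> continuous (at u within {0..}) (\<lambda>u. H u \<omega>)})"

lemma regular_bound: "regular_integrand C H \<Longrightarrow> 0 \<le> u \<Longrightarrow> \<omega> \<in> space M \<Longrightarrow> \<bar>H u \<omega>\<bar> \<le> C"
  by (simp add: regular_integrand_def)

lemma regular_map:
  assumes H: "regular_integrand C H" and H': "regular_integrand C' H'"
    and f: "continuous_on UNIV (\<lambda>(x::real, y::real). f x y :: real)"
    and D: "\<And>x y. \<bar>x\<bar> \<le> C \<Longrightarrow> \<bar>y\<bar> \<le> C' \<Longrightarrow> \<bar>f x y\<bar> \<le> D"
  shows "regular_integrand D (\<lambda>u \<omega>. f (H u \<omega>) (H' u \<omega>))"
  unfolding regular_integrand_def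
proof (intro conjI allI impI ballI)
  have fm: "(\<lambda>(x, y). f x y) \<in> borel_measurable (borel \<Otimes>\<^sub>M borel)"
    using borel_measurable_continuous_onI[OF f] by (simp add: borel_prod)
  show "progressively_measurable F (\<lambda>u \<omega>. f (H u \<omega>) (H' u \<omega>))"
    unfolding progressively_measurable_def
  proof (intro allI impI)
    fix t :: real assume t: "0 \<le> t"
    have "(\<lambda>z. (case z of (u, \<omega>) \<Rightarrow> H u \<omega>, case z of (u, \<omega>) \<Rightarrow> H' u \<omega>))
       \<in> restrict_space borel {0..t} \<Otimes>\<^sub>M F t \<rightarrow>\<^sub>M borel \<Otimes>\<^sub>M borel"
      using H H' t unfolding regular_integrand_def progressively_measurable_def
      by (intro measurable_Pair) auto
    from measurable_compose[OF this fm]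
    show "(\<lambda>(u, \<omega>). f (H u \<omega>) (H' u \<omega>)) \<in> borel_measurable (restrict_space borel {0..t} \<Otimes>\<^sub>M F t)"
      by (simp add: case_prod_beta')
  qed
  fix \<omega> assume \<omega>: "\<omega> \<in> space M"
  show "\<bar>f (H u \<omega>) (H' u \<omega>)\<bar> \<le> D" if "0 \<le> u" for u
    using H H' that \<omega> by (intro D) (auto simp: regular_integrand_def)
  let ?N = "\<lambda>H. {u. 0 \<le> u \<and> \<not> continuous (at u within {0..}) (\<lambda>u. H u \<omega> :: real)}"
  have "countable (?N H \<union> ?N H')" using H H' \<omega> by (auto simp: regular_integrand_def)
  moreover have "?N (\<lambda>u \<omega>. f (H u \<omega>) (H' u \<omega>)) \<subseteq> ?N H \<union> ?N H'"
  proof -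
    have "continuous (at u within {0..}) (\<lambda>u. f (H u \<omega>) (H' u \<omega>))"
      if "continuous (at u within {0..}) (\<lambda>u. H u \<omega>)" "continuous (at u within {0..}) (\<lambda>u. H' u \<omega>)" for u
    proof -
      have "isCont (\<lambda>(x, y). f x y) (H u \<omega>, H' u \<omega>)"
        using f by (simp add: continuous_on_eq_continuous_at)
      from isCont_tendsto_compose[OF this tendsto_Pair[OF that[unfolded continuous_within]]]
      show ?thesis by (simp add: continuous_within)
    qed
    then show ?thesis by blast
  qed
  ultimately show "countable (?N (\<lambda>u \<omega>. f (H u \<omega>) (H' u \<omega>)))" by (rule countable_subset[rotated])
qed

lemma regular_mult:
  assumes "regular_integrand C H" "regular_integrand C' H'"
  shows "regular_integrand (C * C') (\<lambda>u \<omega>. H u \<omega> * H' u \<omega>)"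
  by (rule regular_map[OF assms])
     (auto simp: case_prod_unfold abs_mult intro!: continuous_intros mult_mono)

lemma regular_diff:
  assumes "regular_integrand C H" "regular_integrand C' H'"
  shows "regular_integrand (C + C') (\<lambda>u \<omega>. H u \<omega> - H' u \<omega>)"
  by (rule regular_map[OF assms]) (auto simp: case_prod_unfold intro!: continuous_intros)

text \<open>Clamping time to \<open>[0, t]\<close> replaces the restricted time space of progressive
  measurability by the full Borel line, on which product measurability is easier to use.\<close>

lemma progressive_clamped:
  assumes H: "progressively_measurable F H" and t: "0 \<le> t"
  shows "(\<lambda>(\<omega>, u). H (max 0 (min t u)) \<omega>) \<in> borel_measurable (F t \<Otimes>\<^sub>M borel)"
proof -
  have "(\<lambda>u. max 0 (min t u)) \<in> borel \<rightarrow>\<^sub>M restrict_space borel {0..t}"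
    using t by (intro measurable_restrict_space2) auto
  then have "(\<lambda>z. (max 0 (min t (snd z)), fst z)) \<in> F t \<Otimes>\<^sub>M borel \<rightarrow>\<^sub>M restrict_space borel {0..t} \<Otimes>\<^sub>M F t"
    by (intro measurable_Pair) (auto intro: measurable_compose[OF measurable_snd])
  moreover have "(\<lambda>(u, \<omega>). H u \<omega>) \<in> borel_measurable (restrict_space borel {0..t} \<Otimes>\<^sub>M F t)"
    using H t by (simp add: progressively_measurable_def)
  ultimately show ?thesis
    by (auto dest: measurable_compose simp: case_prod_beta')
qed

lemma regular_measurable:
  assumes H: "regular_integrand C H" and t: "0 \<le> t"
  shows "H t \<in> borel_measurable (F t)"
proof -
  have "(\<lambda>\<omega>. (\<lambda>(\<omega>, u). H (max 0 (min t u)) \<omega>) (\<omega>, t)) \<in> borel_measurable (F t)"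
    using progressive_clamped[of H t] H t
    by (intro measurable_compose[OF measurable_Pair2'[of t borel "F t"]]) (auto simp: regular_integrand_def)
  then show ?thesis using t by simp
qed

lemma regular_joint:
  assumes H: "regular_integrand C H" and st: "0 \<le> s" "s \<le> t"
  shows "(\<lambda>(\<omega>, u). indicator {s<..t} u * H u \<omega>) \<in> borel_measurable (F t \<Otimes>\<^sub>M borel)"
proof -
  have [measurable]: "(\<lambda>(\<omega>, u). H (max 0 (min t u)) \<omega>) \<in> borel_measurable (F t \<Otimes>\<^sub>M borel)"
    using progressive_clamped[of H t] H st by (auto simp: regular_integrand_def)
  have "(\<lambda>(\<omega>, u). indicator {s<..t} u * H u \<omega>) =
      (\<lambda>z. indicator {s<..t} (snd z) * (\<lambda>(\<omega>, u). H (max 0 (min t u)) \<omega>) z)"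
    using st by (auto simp: fun_eq_iff indicator_def)
  also have "\<dots> \<in> borel_measurable (F t \<Otimes>\<^sub>M borel)" by measurable
  finally show ?thesis .
qed

lemma regular_path_measurable:
  assumes H: "regular_integrand C H" and st: "0 \<le> s" "s \<le> t" and \<omega>: "\<omega> \<in> space M"
  shows "(\<lambda>u. indicator {s<..t} u * H u \<omega>) \<in> borel_measurable borel"
  using measurable_compose[OF measurable_Pair1'[of \<omega> "F t" borel] regular_joint[OF H st]] \<omega>
  by (simp add: space_F)

lemma regular_path_bound:
  assumes H: "regular_integrand C H" and st: "0 \<le> s" "s \<le> t" and \<omega>: "\<omega> \<in> space M"
  shows "\<bar>indicator {s<..t} u * H u \<omega>\<bar> \<le> C * indicator {s<..t} u"
  using regular_bound[OF H _ \<omega>, of u] st by (auto simp: indicator_def)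

lemma regular_path_integrable:
  assumes H: "regular_integrand C H" and st: "0 \<le> s" "s \<le> t" and \<omega>: "\<omega> \<in> space M"
  shows "integrable lborel (\<lambda>u. indicator {s<..t} u * H u \<omega>)"
proof (rule Bochner_Integration.integrable_bound[of _ "\<lambda>u. C * indicator {s<..t} u"])
  show "integrable lborel (\<lambda>u. C * indicator {s<..t} u :: real)"
    using st by (intro integrable_mult_right integrable_real_indicator) auto
  show "AE u in lborel. norm (indicator {s<..t} u * H u \<omega>) \<le> norm (C * indicator {s<..t} u)"
    using regular_path_bound[OF assms] by (intro AE_I2) (auto intro: order_trans[OF _ abs_ge_self])
qed (use regular_path_measurable[OF assms] in simp)

lemma time_integral_measurable:
  assumes H: "regular_integrand C H" and st: "0 \<le> s" "s \<le> t"
  shows "time_integral H s t \<in> borel_measurable (F t)"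
proof -
  have "(\<lambda>(\<omega>, u). indicator {s<..t} u * H u \<omega>) \<in> borel_measurable (F t \<Otimes>\<^sub>M lborel)"
    using regular_joint[OF assms] by (simp cong: measurable_cong_sets)
  then show ?thesis
    unfolding time_integral_def[abs_def] by (rule sigma_finite_measure.borel_measurable_lebesgue_integral[OF sigma_finite_lborel])
qed

lemma time_integral_bound:
  assumes H: "regular_integrand C H" and st: "0 \<le> s" "s \<le> t" and \<omega>: "\<omega> \<in> space M"
  shows "\<bar>time_integral H s t \<omega>\<bar> \<le> C * (t - s)"
proof -
  have "\<bar>time_integral H s t \<omega>\<bar> \<le> (\<integral>u. \<bar>indicator {s<..t} u * H u \<omega>\<bar> \<partial>lborel)"
    unfolding time_integral_def by (rule integral_abs_bound)
  also have "\<dots> \<le> (\<integral>u. C * indicator {s<..t} u \<partial>lborel)"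
    using regular_path_integrable[OF assms] regular_path_bound[OF assms] st
    by (intro integral_mono) auto
  also have "\<dots> = C * (t - s)" using st by simp
  finally show ?thesis .
qed

lemma time_integral_add:
  assumes H: "regular_integrand C H" and st: "0 \<le> s" "s \<le> t" "t \<le> r" and \<omega>: "\<omega> \<in> space M"
  shows "time_integral H s r \<omega> = time_integral H s t \<omega> + time_integral H t r \<omega>"
proof -
  have "time_integral H s r \<omega> = (\<integral>u. indicator {s<..t} u * H u \<omega> + indicator {t<..r} u * H u \<omega> \<partial>lborel)"
    unfolding time_integral_def using st
    by (intro Bochner_Integration.integral_cong) (auto simp: indicator_def)
  also have "\<dots> = time_integral H s t \<omega> + time_integral H t r \<omega>"
    unfolding time_integral_def
    using regular_path_integrable[OF H _ _ \<omega>, of s t] regular_path_integrable[OF H _ _ \<omega>, of t r] st by simp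
  finally show ?thesis .
qed

lemma regular_step_tendsto:
  assumes H: "regular_integrand C H" and st: "0 \<le> s" "s \<le> t" and \<omega>: "\<omega> \<in> space M"
  shows "AE u in lborel. (\<lambda>n. step (\<lambda>u. H u \<omega>) s t n u) \<longlonglongrightarrow> indicator {s<..t} u * H u \<omega>"
proof -
  have "countable {u. 0 \<le> u \<and> \<not> continuous (at u within {0..}) (\<lambda>u. H u \<omega>)}"
    using H \<omega> by (simp add: regular_integrand_def)
  then have "AE u in lborel. u \<notin> {u. 0 \<le> u \<and> \<not> continuous (at u within {0..}) (\<lambda>u. H u \<omega>)}"
    by (intro AE_not_in countable_imp_null_set_lborel)
  then show ?thesis
  proof eventually_elim
    case (elim u)
    show ?case
    proof (cases "u \<in> {s<..t}")
      case True
      then have "(\<lambda>n. step (\<lambda>u. H u \<omega>) s t n u) \<longlonglongrightarrow> H u \<omega>"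
        using elim st by (intro step_tendsto) auto
      then show ?thesis using True by simp
    qed (use step_outside[OF st(2)] in simp)
  qed
qed

lemma step_path_bound:
  assumes H: "regular_integrand C H" and st: "0 \<le> s" "s \<le> t" and \<omega>: "\<omega> \<in> space M"
  shows "\<bar>step (\<lambda>u. H u \<omega>) s t n u\<bar> \<le> C * indicator {s<..t} u"
  using step_bound[OF st, of "\<lambda>u. H u \<omega>" C n u] regular_bound[OF H _ \<omega>] step_outside[OF st(2), of u]
  by (auto simp: indicator_def)

lemma step_sum_tendsto:
  assumes H: "regular_integrand C H" and st: "0 \<le> s" "s \<le> t" and \<omega>: "\<omega> \<in> space M"
  shows "(\<lambda>n. \<Sum>i<Suc n. H (grid s t n i) \<omega> * ((t - s) / real (Suc n))) \<longlonglongrightarrow> time_integral H s t \<omega>"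
  unfolding integral_step(2)[OF st(2), of "\<lambda>u. H u \<omega>", symmetric] time_integral_def
proof (rule integral_dominated_convergence[where w="\<lambda>u. C * indicator {s<..t} u"])
  show "integrable lborel (\<lambda>u. C * indicator {s<..t} u :: real)"
    using st by (intro integrable_mult_right integrable_real_indicator) auto
qed (use regular_path_measurable[OF assms] regular_step_tendsto[OF assms] step_path_bound[OF assms] in auto)

lemma step_sum_bound:
  assumes H: "regular_integrand C H" and st: "0 \<le> s" "s \<le> t" and \<omega>: "\<omega> \<in> space M"
  shows "\<bar>\<Sum>i<Suc n. H (grid s t n i) \<omega> * ((t - s) / real (Suc n))\<bar> \<le> C * (t - s)"
proof -
  have "\<bar>\<Sum>i<Suc n. H (grid s t n i) \<omega> * ((t - s) / real (Suc n))\<bar>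
      \<le> (\<Sum>i<Suc n. C * ((t - s) / real (Suc n)))"
    using regular_bound[OF H _ \<omega>] grid_ge[OF st(2), of n] st
    by (intro order_trans[OF sum_abs] sum_mono)
       (auto simp: abs_mult intro!: mult_right_mono divide_right_mono intro: order_trans)
  then show ?thesis by simp
qed

lemma step_sum_measurable:
  assumes H: "regular_integrand C H" and st: "0 \<le> s" "s \<le> t"
  shows "(\<lambda>\<omega>. \<Sum>i<Suc n. H (grid s t n i) \<omega> * ((t - s) / real (Suc n))) \<in> borel_measurable (F t)"
proof (intro borel_measurable_sum borel_measurable_times borel_measurable_const)
  fix i assume "i \<in> {..<Suc n}"
  then show "H (grid s t n i) \<in> borel_measurable (F t)"
    using grid_ge[OF st(2), of n i] grid_le[OF st(2), of i n] st
    by (intro measurable_F_mono[OF regular_measurable[OF H]]) auto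
qed

end

section \<open>Ito integrals as limits of Riemann sums\<close>

definition riemann_sum ::
  "(real \<Rightarrow> 'a \<Rightarrow> real) \<Rightarrow> (real \<Rightarrow> 'a \<Rightarrow> real) \<Rightarrow> real \<Rightarrow> real \<Rightarrow> nat \<Rightarrow> 'a \<Rightarrow> real" where
  "riemann_sum B H s t n \<omega> =
     (\<Sum>i<Suc n. H (grid s t n i) \<omega> * (B (grid s t n (Suc i)) \<omega> - B (grid s t n i) \<omega>))"

text \<open>If \<open>f\<close> is not integrable, the left side is the default value
  \<open>0\<close>; hence the inequality is available before any integrability has been
  shown.\<close>

lemma ennreal_integral_le:
  assumes "\<And>x. 0 \<le> f x" shows "ennreal (\<integral>x. f x \<partial>M) \<le> (\<integral>\<^sup>+x. ennreal (f x) \<partial>M)"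
proof (cases "integrable M f")
  case True
  then show ?thesis using nn_integral_eq_integral[OF True] assms by simp
qed (simp add: not_integrable_integral_eq)

lemma simple_integrand_nonneg:
  assumes "simple_integrand M F k \<tau> c" shows "i \<le> k \<Longrightarrow> 0 \<le> \<tau> i"
proof (induction i)
  case (Suc i)
  then show ?case using assms unfolding simple_integrand_def
    by (meson Suc_le_eq less_imp_le_nat order_trans)
qed (use assms in \<open>simp add: simple_integrand_def\<close>)

text \<open>Clamping the partition points to \<open>[s, t]\<close> gives an elementary integral
  again. If \<open>\<tau> i\<close> exceeds \<open>t\<close>, the clamped interval collapses to the
  point \<open>t\<close>, at which \<open>c i\<close> need not be measurable; replacing the
  coefficient by \<open>0\<close> costs nothing and keeps it known at the left endpoint.\<close>

lemma simple_integral_increment: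
  assumes "s \<le> t" "\<And>i. i < k \<Longrightarrow> \<tau> i \<le> \<tau> (Suc i)"
  shows "simple_integral B k \<tau> c t \<omega> - simple_integral B k \<tau> c s \<omega> =
    (\<Sum>i<k. (if \<tau> i \<le> t then c i \<omega> else 0) *
       (B (max s (min t (\<tau> (Suc i)))) \<omega> - B (max s (min t (\<tau> i))) \<omega>))"
  unfolding simple_integral_def sum_subtractf[symmetric]
proof (intro sum.cong refl)
  fix i assume "i \<in> {..<k}"
  then have \<tau>: "\<tau> i \<le> \<tau> (Suc i)" using assms by simp
  have *: "B (min t x) \<omega> - B (min s x) \<omega> = B (max s (min t x)) \<omega> - B s \<omega>" for x
    using assms(1) by (auto simp: min_def max_def)
  have "B (min t (\<tau> (Suc i))) \<omega> - B (min t (\<tau> i)) \<omega> - (B (min s (\<tau> (Suc i))) \<omega> - B (min s (\<tau> i)) \<omega>)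
     = B (max s (min t (\<tau> (Suc i)))) \<omega> - B (max s (min t (\<tau> i))) \<omega>"
    using *[of "\<tau> i"] *[of "\<tau> (Suc i)"] by linarith
  moreover have "B (max s (min t (\<tau> (Suc i)))) \<omega> - B (max s (min t (\<tau> i))) \<omega> = 0" if "\<not> \<tau> i \<le> t"
    using that \<tau> by (simp add: min_def)
  ultimately show "c i \<omega> * (B (min t (\<tau> (Suc i))) \<omega> - B (min t (\<tau> i)) \<omega>) -
       c i \<omega> * (B (min s (\<tau> (Suc i))) \<omega> - B (min s (\<tau> i)) \<omega>) =
       (if \<tau> i \<le> t then c i \<omega> else 0) * (B (max s (min t (\<tau> (Suc i)))) \<omega> - B (max s (min t (\<tau> i))) \<omega>)"
    by (auto simp: right_diff_distrib[symmetric])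
qed

lemma simple_process_restrict:
  assumes "s \<le> t"
  shows "(\<Sum>i<k. (if \<tau> i \<le> t then c i \<omega> else 0) *
       indicator {max s (min t (\<tau> i))<..max s (min t (\<tau> (Suc i)))} u) =
     indicator {s<..t} u * simple_process k \<tau> c u \<omega>"
  unfolding simple_process_def sum_distrib_left
  by (intro sum.cong refl) (use assms in \<open>auto simp: indicator_def\<close>)

context brownian_space
begin

lemma riemann_sum_square_integrable:
  assumes H: "regular_integrand C H" and st: "0 \<le> s" "s \<le> t"
  shows "square_integrable M (riemann_sum B H s t n)"
  unfolding riemann_sum_def[abs_def]
proof (rule elementary_isometry(1))
  fix i assume i: "i \<in> {..<Suc n}"
  show g: "0 \<le> grid s t n i" using grid_ge[OF st(2)] st order_trans by blast
  show "grid s t n i \<le> grid s t n (Suc i)" using grid_mono[OF st(2)] by simp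
  show "H (grid s t n i) \<in> borel_measurable (F (grid s t n i))" by (rule regular_measurable[OF H g])
  show "\<exists>C. \<forall>\<omega>\<in>space M. \<bar>H (grid s t n i) \<omega>\<bar> \<le> C" using regular_bound[OF H g] by blast
qed

text \<open>Simple integrals serve as intermediaries: the isometry bounds their distance to the
  Riemann sum by the distance of the two integrands, and this splits into the distance of the simple
  process to \<open>H\<close> and that of \<open>H\<close> to its step function. Letting the simple
  processes converge first removes the former; refining the grid removes the latter.\<close>

lemma ito_increment_riemann:
  assumes X: "is_ito_integral M F B H X" and H: "regular_integrand C H" and st: "0 \<le> s" "s \<le> t"
  shows "L2_lim M (riemann_sum B H s t) (\<lambda>\<omega>. X t \<omega> - X s \<omega>)"
proof -
  have t: "0 \<le> t" using st by simp
  obtain k \<tau> c where simple: "\<And>m. simple_integrand M F (k m) (\<tau> m) (c m)"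
    and lim1: "\<And>T. 0 \<le> T \<Longrightarrow> (\<lambda>m. \<integral>\<^sup>+\<omega>. (\<integral>\<^sup>+u\<in>{0..T}.
             ennreal ((simple_process (k m) (\<tau> m) (c m) u \<omega> - H u \<omega>)\<^sup>2) \<partial>lborel) \<partial>M) \<longlonglongrightarrow> 0"
    and lim2: "\<And>t. 0 \<le> t \<Longrightarrow>
       (\<lambda>m. \<integral>\<^sup>+\<omega>. ennreal ((simple_integral B (k m) (\<tau> m) (c m) t \<omega> - X t \<omega>)\<^sup>2) \<partial>M) \<longlonglongrightarrow> 0"
    using X unfolding is_ito_integral_def by blast
  have Xm[measurable]: "X t \<in> borel_measurable M" "X s \<in> borel_measurable M"
    using X st t measurable_F unfolding is_ito_integral_def adapted_def by blast+
  have \<tau>_mono: "\<tau> m i \<le> \<tau> m (Suc i)" if "i < k m" for m i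
    using simple that by (simp add: simple_integrand_def)
  have \<tau>_pos: "i \<le> k m \<Longrightarrow> 0 \<le> \<tau> m i" for m i
    by (rule simple_integrand_nonneg[OF simple])
  have cF: "c m i \<in> borel_measurable (F (\<tau> m i))" "\<exists>C. \<forall>\<omega>\<in>space M. \<bar>c m i \<omega>\<bar> \<le> C" if "i < k m" for m i
    using simple that by (auto simp: simple_integrand_def)
  have c_meas: "c m i \<in> borel_measurable M" if "i < k m" for m i
    using cF(1)[OF that] measurable_F by blast
  have S_meas: "simple_integral B (k m) (\<tau> m) (c m) r \<in> borel_measurable M" if "0 \<le> r" for m r
    unfolding simple_integral_def[abs_def]
    by (intro borel_measurable_sum borel_measurable_times borel_measurable_diff B_measurable c_meas)
       (use \<tau>_pos that in auto)
  let ?c = "\<lambda>m i \<omega>. if \<tau> m i \<le> t then c m i \<omega> else 0"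
  let ?a = "\<lambda>m i. max s (min t (\<tau> m i))"
  let ?R = "riemann_sum B H s t"
  let ?S = "\<lambda>m \<omega>. simple_integral B (k m) (\<tau> m) (c m) t \<omega> - simple_integral B (k m) (\<tau> m) (c m) s \<omega>"
  \<comment> \<open>\<open>e1 m\<close> is the pathwise squared distance of the simple process to
    \<open>H\<close>, and \<open>e2 n\<close> that of \<open>H\<close> to its step function; the
    second integral may run over the whole line, as both integrands vanish outside
    \<open>{s<..t}\<close>.\<close>
  define e1 where "e1 m \<omega> = (\<integral>\<^sup>+u\<in>{0..t}. ennreal ((simple_process (k m) (\<tau> m) (c m) u \<omega> - H u \<omega>)\<^sup>2) \<partial>lborel)" for m \<omega>
  define e2 where "e2 n \<omega> = (\<integral>\<^sup>+u. ennreal ((indicator {s<..t} u * H u \<omega> - step (\<lambda>u. H u \<omega>) s t n u)\<^sup>2) \<partial>lborel)" for n \<omega>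
  have D: "square_integrable M (\<lambda>\<omega>. ?S m \<omega> - ?R n \<omega>)"
    "(\<integral>\<omega>. (?S m \<omega> - ?R n \<omega>)\<^sup>2 \<partial>M) = (\<integral>\<omega>. (\<integral>u. (indicator {s<..t} u * simple_process (k m) (\<tau> m) (c m) u \<omega>
         - step (\<lambda>u. H u \<omega>) s t n u)\<^sup>2 \<partial>lborel) \<partial>M)" for m n
  proof -
    \<comment> \<open>Both partitions are indexed together by a sum type, with negative coefficients
      for the Riemann sum, so that the difference of the two integrals is a single elementary
      integral.\<close>
    define A where "A = case_sum (?a m) (grid s t n)"
    define A' where "A' = case_sum (\<lambda>i. ?a m (Suc i)) (\<lambda>i. grid s t n (Suc i))"
    define K where "K = case_sum (?c m) (\<lambda>i \<omega>. - H (grid s t n i) \<omega>)"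
    have S: "(\<Sum>i\<in>{..<k m} <+> {..<Suc n}. f i) = (\<Sum>i<k m. f (Inl i)) + (\<Sum>i<Suc n. f (Inr i))"
      for f :: "nat + nat \<Rightarrow> real"
      by (subst sum.Plus) auto
    have SI: "?S m \<omega> = (\<Sum>i<k m. ?c m i \<omega> * (B (?a m (Suc i)) \<omega> - B (?a m i) \<omega>))" for \<omega>
      by (rule simple_integral_increment[OF st(2)]) (rule \<tau>_mono)
    have 1: "?S m \<omega> - ?R n \<omega> = (\<Sum>i\<in>{..<k m} <+> {..<Suc n}. K i \<omega> * (B (A' i) \<omega> - B (A i) \<omega>))" for \<omega>
      unfolding S SI riemann_sum_def K_def A_def A'_def
      by (simp add: sum_negf del: sum.lessThan_Suc)
    have 2: "indicator {s<..t} u * simple_process (k m) (\<tau> m) (c m) u \<omega> - step (\<lambda>u. H u \<omega>) s t n u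
       = (\<Sum>i\<in>{..<k m} <+> {..<Suc n}. K i \<omega> * indicator {A i<..A' i} u)" for \<omega> u
      unfolding S simple_process_restrict[OF st(2), symmetric] step_def K_def A_def A'_def
      by (simp add: sum_negf del: sum.lessThan_Suc)
    have 3: "0 \<le> A i \<and> A i \<le> A' i \<and> K i \<in> borel_measurable (F (A i)) \<and> (\<exists>C. \<forall>\<omega>\<in>space M. \<bar>K i \<omega>\<bar> \<le> C)"
      if "i \<in> {..<k m} <+> {..<Suc n}" for i
    proof (cases i)
      case (Inl j)
      then have j: "j < k m" using that by auto
      have "?c m j \<in> borel_measurable (F (?a m j))"
        using measurable_F_mono[OF cF(1)[OF j], of "?a m j"] by (cases "\<tau> m j \<le> t") (auto simp: max_def min_def)
      moreover have "\<exists>C. \<forall>\<omega>\<in>space M. \<bar>?c m j \<omega>\<bar> \<le> C" using cF(2)[OF j] by auto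
      ultimately show ?thesis using Inl st \<tau>_mono[OF j] by (auto simp: A_def A'_def K_def)
    next
      case (Inr j)
      have g: "0 \<le> grid s t n j" using grid_ge[OF st(2)] st order_trans by blast
      have "\<exists>C. \<forall>\<omega>\<in>space M. \<bar>H (grid s t n j) \<omega>\<bar> \<le> C" using regular_bound[OF H g] by blast
      then show ?thesis using Inr g grid_mono[OF st(2), of j "Suc j" n] regular_measurable[OF H g]
        by (auto simp: A_def A'_def K_def)
    qed
    show "square_integrable M (\<lambda>\<omega>. ?S m \<omega> - ?R n \<omega>)"
      unfolding 1 by (rule elementary_isometry(1)) (use 3 in auto)
    show "(\<integral>\<omega>. (?S m \<omega> - ?R n \<omega>)\<^sup>2 \<partial>M) = (\<integral>\<omega>. (\<integral>u. (indicator {s<..t} u * simple_process (k m) (\<tau> m) (c m) u \<omega>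
         - step (\<lambda>u. H u \<omega>) s t n u)\<^sup>2 \<partial>lborel) \<partial>M)"
      unfolding 1 2 by (rule elementary_isometry(2)) (use 3 in auto)
  qed
  have step_joint: "(\<lambda>(\<omega>, u). step (\<lambda>u. H u \<omega>) s t n u) \<in> borel_measurable (M \<Otimes>\<^sub>M lborel)" for n
  proof -
    have [measurable]: "H (grid s t n i) \<in> borel_measurable M" for i
      using regular_measurable[OF H, of "grid s t n i"] grid_ge[OF st(2), of n i] st measurable_F
      by (meson order_trans)
    show ?thesis unfolding step_def by measurable
  qed
  have sub: "f \<in> borel_measurable (F t \<Otimes>\<^sub>M borel) \<Longrightarrow> f \<in> borel_measurable (M \<Otimes>\<^sub>M lborel)" for f :: "'a \<times> real \<Rightarrow> real"
  proof -
    assume f: "f \<in> borel_measurable (F t \<Otimes>\<^sub>M borel)"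
    have "(\<lambda>z. (fst z, snd z)) \<in> M \<Otimes>\<^sub>M lborel \<rightarrow>\<^sub>M F t \<Otimes>\<^sub>M borel"
      by (intro measurable_Pair measurable_compose[OF measurable_fst measurable_F[of "\<lambda>x. x" t]])
         (auto cong: measurable_cong_sets)
    from measurable_compose[OF this f] show "f \<in> borel_measurable (M \<Otimes>\<^sub>M lborel)" by simp
  qed
  have e1_meas[measurable]: "e1 m \<in> borel_measurable M" for m
  proof -
    have [measurable]: "(\<lambda>z. simple_process (k m) (\<tau> m) (c m) (snd z) (fst z)) \<in> borel_measurable (M \<Otimes>\<^sub>M lborel)"
      unfolding simple_process_def
      by (intro borel_measurable_sum borel_measurable_times measurable_compose[OF measurable_fst c_meas]) auto
    have [measurable]: "(\<lambda>(\<omega>, u). H (max 0 (min t u)) \<omega>) \<in> borel_measurable (M \<Otimes>\<^sub>M lborel)"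
      using progressive_clamped[of H t] H st by (intro sub) (auto simp: regular_integrand_def)
    have "(\<lambda>z. indicator {0..t} (snd z) * ennreal ((simple_process (k m) (\<tau> m) (c m) (snd z) (fst z)
         - (\<lambda>(\<omega>, u). H (max 0 (min t u)) \<omega>) z)\<^sup>2)) \<in> borel_measurable (M \<Otimes>\<^sub>M lborel)"
      by measurable
    then have "(\<lambda>\<omega>. \<integral>\<^sup>+u. indicator {0..t} u * ennreal ((simple_process (k m) (\<tau> m) (c m) u \<omega>
         - H (max 0 (min t u)) \<omega>)\<^sup>2) \<partial>lborel) \<in> borel_measurable M"
      by (intro lborel.borel_measurable_nn_integral) (simp add: case_prod_beta')
    also have "(\<lambda>\<omega>. \<integral>\<^sup>+u. indicator {0..t} u * ennreal ((simple_process (k m) (\<tau> m) (c m) u \<omega>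
         - H (max 0 (min t u)) \<omega>)\<^sup>2) \<partial>lborel) = e1 m"
      unfolding e1_def by (intro ext nn_integral_cong) (auto simp: indicator_def)
    finally show ?thesis .
  qed
  have diff_joint: "(\<lambda>z. ennreal ((indicator {s<..t} (snd z) * H (snd z) (fst z)
        - step (\<lambda>u. H u (fst z)) s t n (snd z))\<^sup>2)) \<in> borel_measurable (M \<Otimes>\<^sub>M lborel)" for n
    using sub[OF regular_joint[OF H st]] step_joint[of n] by (simp add: case_prod_beta')
  have e2_meas[measurable]: "e2 n \<in> borel_measurable M" for n
    unfolding e2_def using diff_joint[of n]
    by (intro lborel.borel_measurable_nn_integral) (simp add: case_prod_beta')
  have e2_bound: "(indicator {s<..t} u * H u \<omega> - step (\<lambda>u. H u \<omega>) s t n u)\<^sup>2 \<le> (2 * C)\<^sup>2 * indicator {s<..t} u"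
    if "\<omega> \<in> space M" for n u \<omega>
  proof (cases "u \<in> {s<..t}")
    case True
    have "\<bar>H u \<omega> - step (\<lambda>u. H u \<omega>) s t n u\<bar> \<le> \<bar>2 * C\<bar>"
      using regular_path_bound[OF H st that, of u] step_path_bound[OF H st that, of n u] True by simp
    then show ?thesis using True by (simp add: abs_le_square_iff)
  qed (use step_outside[OF st(2)] in simp)
  have e2_le: "e2 n \<omega> \<le> ennreal ((2 * C)\<^sup>2 * (t - s))" if "\<omega> \<in> space M" for n \<omega>
  proof -
    have "e2 n \<omega> \<le> (\<integral>\<^sup>+u. ennreal ((2 * C)\<^sup>2 * indicator {s<..t} u) \<partial>lborel)"
      unfolding e2_def using e2_bound[OF that] by (intro nn_integral_mono ennreal_leI) auto
    also have "\<dots> = (\<integral>\<^sup>+u. ennreal ((2 * C)\<^sup>2) * indicator {s<..t} u \<partial>lborel)"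
      by (intro nn_integral_cong) (auto simp: indicator_def)
    also have "\<dots> = ennreal ((2 * C)\<^sup>2 * (t - s))"
      using st by (subst nn_integral_cmult_indicator) (auto simp: ennreal_mult)
    finally show ?thesis .
  qed
  have e2_lim: "(\<lambda>n. e2 n \<omega>) \<longlonglongrightarrow> 0" if \<omega>: "\<omega> \<in> space M" for \<omega>
  proof -
    have "(\<lambda>n. e2 n \<omega>) \<longlonglongrightarrow> (\<integral>\<^sup>+u. 0 \<partial>(lborel :: real measure))"
      unfolding e2_def
    proof (rule nn_integral_dominated_convergence[where w="\<lambda>u. ennreal ((2 * C)\<^sup>2) * indicator {s<..t} u"])
      show "(\<lambda>u. ennreal ((indicator {s<..t} u * H u \<omega> - step (\<lambda>u. H u \<omega>) s t n u)\<^sup>2)) \<in> borel_measurable lborel" for n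
        using regular_path_measurable[OF H st \<omega>] by simp
      show "AE u in lborel. ennreal ((indicator {s<..t} u * H u \<omega> - step (\<lambda>u. H u \<omega>) s t n u)\<^sup>2)
          \<le> ennreal ((2 * C)\<^sup>2) * indicator {s<..t} u" for n
        using ennreal_leI[OF e2_bound[OF \<omega>]] by (intro AE_I2) (metis ennreal_indicator ennreal_mult' zero_le_power2)
      show "(\<integral>\<^sup>+u. ennreal ((2 * C)\<^sup>2) * indicator {s<..t} u \<partial>lborel) < \<infinity>"
        using st by (subst nn_integral_cmult_indicator) (auto simp: ennreal_mult[symmetric])
      show "AE u in lborel. (\<lambda>n. ennreal ((indicator {s<..t} u * H u \<omega> - step (\<lambda>u. H u \<omega>) s t n u)\<^sup>2)) \<longlonglongrightarrow> 0"
        using regular_step_tendsto[OF H st \<omega>]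
      proof eventually_elim
        case (elim u)
        have "(\<lambda>n. (indicator {s<..t} u * H u \<omega> - step (\<lambda>u. H u \<omega>) s t n u)\<^sup>2) \<longlonglongrightarrow>
            (indicator {s<..t} u * H u \<omega> - indicator {s<..t} u * H u \<omega>)\<^sup>2"
          by (intro tendsto_power tendsto_diff tendsto_const elim)
        then show ?case by (intro tendsto_ennrealI[of _ 0, simplified]) simp
      qed
    qed auto
    then show ?thesis by simp
  qed
  have q_lim: "(\<lambda>n. \<integral>\<^sup>+\<omega>. e2 n \<omega> \<partial>M) \<longlonglongrightarrow> (\<integral>\<^sup>+\<omega>. 0 \<partial>M)"
  proof (rule nn_integral_dominated_convergence[where w="\<lambda>_. ennreal ((2 * C)\<^sup>2 * (t - s))"])
    show "(\<integral>\<^sup>+\<omega>. ennreal ((2 * C)\<^sup>2 * (t - s)) \<partial>M) < \<infinity>"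
      by (simp add: emeasure_space_1)
  qed (use e2_le e2_lim in auto)
  define x where "x n \<omega> = X t \<omega> - X s \<omega> - ?R n \<omega>" for n \<omega>
  have R: "square_integrable M (?R n)" for n by (rule riemann_sum_square_integrable[OF H st])
  have x_meas[measurable]: "x n \<in> borel_measurable M" for n
    unfolding x_def[abs_def]
    by (intro borel_measurable_diff Xm square_integrable_measurable[OF R])
  have DD: "(\<integral>\<^sup>+\<omega>. ennreal ((?S m \<omega> - ?R n \<omega>)\<^sup>2) \<partial>M) \<le> 2 * (\<integral>\<^sup>+\<omega>. e1 m \<omega> \<partial>M) + 2 * (\<integral>\<^sup>+\<omega>. e2 n \<omega> \<partial>M)" for m n
  proof -
    let ?f = "\<lambda>\<omega> u. (indicator {s<..t} u * simple_process (k m) (\<tau> m) (c m) u \<omega> - step (\<lambda>u. H u \<omega>) s t n u)\<^sup>2"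
    have "(\<integral>\<^sup>+\<omega>. ennreal ((?S m \<omega> - ?R n \<omega>)\<^sup>2) \<partial>M) = ennreal (\<integral>\<omega>. (?S m \<omega> - ?R n \<omega>)\<^sup>2 \<partial>M)"
      using D(1)[of m n] by (intro nn_integral_eq_integral) (auto simp: square_integrable_def)
    also have "\<dots> \<le> (\<integral>\<^sup>+\<omega>. ennreal (\<integral>u. ?f \<omega> u \<partial>lborel) \<partial>M)"
      unfolding D(2) by (intro ennreal_integral_le) simp
    also have "\<dots> \<le> (\<integral>\<^sup>+\<omega>. (\<integral>\<^sup>+u. ennreal (?f \<omega> u) \<partial>lborel) \<partial>M)"
      by (intro nn_integral_mono ennreal_integral_le) simp
    also have "\<dots> \<le> (\<integral>\<^sup>+\<omega>. 2 * e1 m \<omega> + 2 * e2 n \<omega> \<partial>M)"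
    proof (intro nn_integral_mono)
      fix \<omega> assume \<omega>: "\<omega> \<in> space M"
      let ?p = "\<lambda>u. ennreal ((simple_process (k m) (\<tau> m) (c m) u \<omega> - H u \<omega>)\<^sup>2) * indicator {0..t} u"
      let ?q = "\<lambda>u. ennreal ((indicator {s<..t} u * H u \<omega> - step (\<lambda>u. H u \<omega>) s t n u)\<^sup>2)"
      have pm: "?p \<in> borel_measurable lborel"
      proof -
        have [measurable]: "(\<lambda>u. H (max 0 (min t u)) \<omega>) \<in> borel_measurable borel"
          using measurable_compose[OF measurable_Pair1'[of \<omega> "F t" borel] progressive_clamped[of H t]] \<omega> H st
          by (auto simp: space_F regular_integrand_def)
        have [measurable]: "(\<lambda>u. simple_process (k m) (\<tau> m) (c m) u \<omega>) \<in> borel_measurable borel"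
          unfolding simple_process_def by measurable
        have "(\<lambda>u. ennreal ((simple_process (k m) (\<tau> m) (c m) u \<omega> - H (max 0 (min t u)) \<omega>)\<^sup>2) * indicator {0..t} u)
           \<in> borel_measurable lborel" by measurable
        also have "(\<lambda>u. ennreal ((simple_process (k m) (\<tau> m) (c m) u \<omega> - H (max 0 (min t u)) \<omega>)\<^sup>2) * indicator {0..t} u) = ?p"
          by (auto simp: fun_eq_iff indicator_def)
        finally show ?thesis .
      qed
      have qm: "?q \<in> borel_measurable lborel" using regular_path_measurable[OF H st \<omega>] by simp
      have le: "ennreal (?f \<omega> u) \<le> 2 * ?p u + 2 * ?q u" for u
      proof (cases "u \<in> {s<..t}")
        case True
        have "?f \<omega> u \<le> 2 * (simple_process (k m) (\<tau> m) (c m) u \<omega> - H u \<omega>)\<^sup>2 + 2 * (H u \<omega> - step (\<lambda>u. H u \<omega>) s t n u)\<^sup>2"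
          using square_diff_le[of "simple_process (k m) (\<tau> m) (c m) u \<omega> - H u \<omega>" "step (\<lambda>u. H u \<omega>) s t n u - H u \<omega>"] True
          by (simp add: power2_commute)
        then have "ennreal (?f \<omega> u) \<le> ennreal (2 * (simple_process (k m) (\<tau> m) (c m) u \<omega> - H u \<omega>)\<^sup>2 + 2 * (H u \<omega> - step (\<lambda>u. H u \<omega>) s t n u)\<^sup>2)"
          by (rule ennreal_leI)
        also have "\<dots> = 2 * ?p u + 2 * ?q u"
          using True st by (simp add: ennreal_plus ennreal_mult)
        finally show ?thesis .
      qed (use step_outside[OF st(2)] in simp)
      have "(\<integral>\<^sup>+u. ennreal (?f \<omega> u) \<partial>lborel) \<le> (\<integral>\<^sup>+u. 2 * ?p u + 2 * ?q u \<partial>lborel)"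
        using le by (intro nn_integral_mono)
      also have "\<dots> = 2 * e1 m \<omega> + 2 * e2 n \<omega>"
        unfolding e1_def e2_def using pm qm
        by (subst nn_integral_add, measurable, measurable) (simp add: nn_integral_cmult)
      finally show "(\<integral>\<^sup>+u. ennreal (?f \<omega> u) \<partial>lborel) \<le> 2 * e1 m \<omega> + 2 * e2 n \<omega>" .
    qed
    also have "\<dots> = 2 * (\<integral>\<^sup>+\<omega>. e1 m \<omega> \<partial>M) + 2 * (\<integral>\<^sup>+\<omega>. e2 n \<omega> \<partial>M)"
      by (subst nn_integral_add) (auto simp: nn_integral_cmult)
    finally show ?thesis .
  qed
  define g where "g r m = (\<integral>\<^sup>+\<omega>. ennreal ((simple_integral B (k m) (\<tau> m) (c m) r \<omega> - X r \<omega>)\<^sup>2) \<partial>M)" for r m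
  have le: "(\<integral>\<^sup>+\<omega>. ennreal ((x n \<omega>)\<^sup>2) \<partial>M) \<le>
     4 * g t m + 4 * g s m + 2 * (2 * (\<integral>\<^sup>+\<omega>. e1 m \<omega> \<partial>M) + 2 * (\<integral>\<^sup>+\<omega>. e2 n \<omega> \<partial>M))" for n m
  proof -
    note S_meas[OF t, measurable] S_meas[OF st(1), measurable]
    have R_meas[measurable]: "?R n \<in> borel_measurable M" using R[of n] by (simp add: square_integrable_def)
    let ?U = "\<lambda>\<omega>. (simple_integral B (k m) (\<tau> m) (c m) t \<omega> - X t \<omega>)\<^sup>2"
    let ?V = "\<lambda>\<omega>. (simple_integral B (k m) (\<tau> m) (c m) s \<omega> - X s \<omega>)\<^sup>2"
    let ?W = "\<lambda>\<omega>. (?S m \<omega> - ?R n \<omega>)\<^sup>2"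
    have "(x n \<omega>)\<^sup>2 \<le> 4 * ?U \<omega> + 4 * ?V \<omega> + 2 * ?W \<omega>" for \<omega>
    proof -
      \<comment> \<open>With \<open>W\<close> the square of \<open>S - R\<close>, two uses of
        \<open>square_diff_le\<close> on \<open>(S - R) - (u - v)\<close> produce the weights
        \<open>2\<close> for \<open>W\<close> and \<open>4\<close> for the squares of
        \<open>u\<close> and \<open>v\<close>.\<close>
      define u v where "u = simple_integral B (k m) (\<tau> m) (c m) t \<omega> - X t \<omega>"
        and "v = simple_integral B (k m) (\<tau> m) (c m) s \<omega> - X s \<omega>"
      have "(x n \<omega>)\<^sup>2 = ((?S m \<omega> - ?R n \<omega>) - (u - v))\<^sup>2"
        unfolding x_def u_def v_def by (simp add: algebra_simps)
      then show ?thesis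
        using square_diff_le[of "?S m \<omega> - ?R n \<omega>" "u - v"] square_diff_le[of u v] unfolding u_def v_def by linarith
    qed
    then have "(\<integral>\<^sup>+\<omega>. ennreal ((x n \<omega>)\<^sup>2) \<partial>M) \<le> (\<integral>\<^sup>+\<omega>. ennreal (4 * ?U \<omega> + 4 * ?V \<omega> + 2 * ?W \<omega>) \<partial>M)"
      by (intro nn_integral_mono ennreal_leI)
    also have "\<dots> = (\<integral>\<^sup>+\<omega>. 4 * ennreal (?U \<omega>) + 4 * ennreal (?V \<omega>) + 2 * ennreal (?W \<omega>) \<partial>M)"
      by (intro nn_integral_cong) (simp add: ennreal_mult)
    also have "\<dots> = 4 * g t m + 4 * g s m + 2 * (\<integral>\<^sup>+\<omega>. ennreal (?W \<omega>) \<partial>M)"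
      unfolding g_def by (subst nn_integral_add, measurable, measurable, subst nn_integral_add, measurable, measurable)
        (simp add: nn_integral_cmult)
    also have "\<dots> \<le> 4 * g t m + 4 * g s m + 2 * (2 * (\<integral>\<^sup>+\<omega>. e1 m \<omega> \<partial>M) + 2 * (\<integral>\<^sup>+\<omega>. e2 n \<omega> \<partial>M))"
      by (intro add_left_mono mult_left_mono DD) auto
    finally show ?thesis .
  qed
  \<comment> \<open>For fixed \<open>n\<close>, the limit in \<open>m\<close> eliminates all errors
    of the simple approximation and leaves only the grid error.\<close>
  have le': "(\<integral>\<^sup>+\<omega>. ennreal ((x n \<omega>)\<^sup>2) \<partial>M) \<le> 4 * (\<integral>\<^sup>+\<omega>. e2 n \<omega> \<partial>M)" for n
  proof (rule LIMSEQ_le_const)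
    have l: "(\<lambda>m. \<integral>\<^sup>+\<omega>. e1 m \<omega> \<partial>M) \<longlonglongrightarrow> 0" "g t \<longlonglongrightarrow> 0" "g s \<longlonglongrightarrow> 0"
      using lim1[OF t] lim2[OF t] lim2[OF st(1)] unfolding e1_def g_def by auto
    have "(\<lambda>m. 4 * g t m + 4 * g s m + 2 * (2 * (\<integral>\<^sup>+\<omega>. e1 m \<omega> \<partial>M) + 2 * (\<integral>\<^sup>+\<omega>. e2 n \<omega> \<partial>M)))
        \<longlonglongrightarrow> 4 * 0 + 4 * 0 + 2 * (2 * 0 + 2 * (\<integral>\<^sup>+\<omega>. e2 n \<omega> \<partial>M))"
      by (intro tendsto_add tendsto_const ennreal_tendsto_cmult l) auto
    also have "4 * 0 + 4 * 0 + 2 * (2 * 0 + 2 * (\<integral>\<^sup>+\<omega>. e2 n \<omega> \<partial>M)) = 4 * (\<integral>\<^sup>+\<omega>. e2 n \<omega> \<partial>M)"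
      by (simp add: mult.assoc[symmetric])
    finally show "(\<lambda>m. 4 * g t m + 4 * g s m + 2 * (2 * (\<integral>\<^sup>+\<omega>. e1 m \<omega> \<partial>M) + 2 * (\<integral>\<^sup>+\<omega>. e2 n \<omega> \<partial>M)))
        \<longlonglongrightarrow> 4 * (\<integral>\<^sup>+\<omega>. e2 n \<omega> \<partial>M)" .
  qed (use le in auto)
  have fin: "(\<integral>\<^sup>+\<omega>. ennreal ((x n \<omega>)\<^sup>2) \<partial>M) < \<infinity>" for n
  proof -
    have "(\<integral>\<^sup>+\<omega>. e2 n \<omega> \<partial>M) \<le> (\<integral>\<^sup>+\<omega>. ennreal ((2 * C)\<^sup>2 * (t - s)) \<partial>M)"
      using e2_le by (intro nn_integral_mono) auto
    also have "\<dots> < \<infinity>" by (simp add: emeasure_space_1)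
    finally have "4 * (\<integral>\<^sup>+\<omega>. e2 n \<omega> \<partial>M) < \<infinity>" by (simp add: ennreal_mult_less_top)
    then show ?thesis using le'[of n] by (rule order.strict_trans1[rotated])
  qed
  have xs: "square_integrable M (x n)" for n
    unfolding square_integrable_def
    using fin[of n] by (auto intro!: integrableI_bounded)
  \<comment> \<open>The increment of \<open>X\<close> is recovered as one error term plus one
    Riemann sum, both square integrable.\<close>
  have "square_integrable M (\<lambda>\<omega>. x 0 \<omega> + ?R 0 \<omega>)" by (rule square_integrable_add[OF xs R])
  then have Xs: "square_integrable M (\<lambda>\<omega>. X t \<omega> - X s \<omega>)" by (simp add: x_def)
  have "(\<lambda>n. \<integral>\<^sup>+\<omega>. ennreal ((x n \<omega>)\<^sup>2) \<partial>M) \<longlonglongrightarrow> 0"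
  proof (rule tendsto_sandwich[OF _ _ tendsto_const])
    show "(\<lambda>n. 4 * (\<integral>\<^sup>+\<omega>. e2 n \<omega> \<partial>M)) \<longlonglongrightarrow> 0"
      using ennreal_tendsto_cmult[OF _ q_lim, of 4] by simp
  qed (use le' in auto)
  moreover have "(\<integral>\<^sup>+\<omega>. ennreal ((x n \<omega>)\<^sup>2) \<partial>M) = ennreal (\<integral>\<omega>. (x n \<omega>)\<^sup>2 \<partial>M)" for n
    using xs[of n] by (intro nn_integral_eq_integral) (auto simp: square_integrable_def)
  ultimately have "(\<lambda>n. ennreal (\<integral>\<omega>. (x n \<omega>)\<^sup>2 \<partial>M)) \<longlonglongrightarrow> ennreal 0" by simp
  then have "(\<lambda>n. \<integral>\<omega>. (x n \<omega>)\<^sup>2 \<partial>M) \<longlonglongrightarrow> 0" by (rule tendsto_ennrealD) auto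
  then show ?thesis
    using Xs R unfolding L2_lim_def x_def by (simp add: power2_commute)
qed

end

section \<open>Isometry, maximal inequality and stopping\<close>

text \<open>The weights keep exactly the cells that begin before \<open>\<sigma>\<close>, so the sum
  telescopes up to the first node \<open>v\<close> at or after \<open>\<sigma>\<close>. For
  \<open>\<sigma> = 0\<close> no cell is kept and \<open>v = 0\<close>. The node does not depend on
  \<open>f\<close>.\<close>

lemma telescope_until:
  assumes t: "0 \<le> \<sigma>" "\<sigma> \<le> t"
  obtains v where "\<sigma> \<le> v" "v - \<sigma> \<le> t / real (Suc n)"
    "\<And>f :: real \<Rightarrow> real. (\<Sum>i<Suc n. of_bool (grid 0 t n i < \<sigma>) * (f (grid 0 t n (Suc i)) - f (grid 0 t n i))) = f v - f 0"
proof (cases "\<sigma> = 0")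
  case True
  have "\<not> grid 0 t n i < \<sigma>" for i using grid_ge[of 0 t n i] t True by simp
  then show ?thesis using t True by (intro that[of 0]) auto
next
  case False
  then obtain j where j: "j < Suc n" "grid 0 t n j < \<sigma>" "\<sigma> \<le> grid 0 t n (Suc j)"
    using grid_cell[of 0 \<sigma> t n] t by auto
  have lt: "grid 0 t n i < \<sigma> \<longleftrightarrow> i < Suc j" for i
  proof
    assume "grid 0 t n i < \<sigma>"
    then show "i < Suc j" using grid_mono[of 0 t "Suc j" i n] t j by (meson not_less order.strict_trans2 order_trans)
  next
    assume "i < Suc j"
    then show "grid 0 t n i < \<sigma>" using grid_mono[of 0 t i j n] t j by auto
  qed
  have "(\<Sum>i<Suc n. of_bool (grid 0 t n i < \<sigma>) * (f (grid 0 t n (Suc i)) - f (grid 0 t n i))) = f (grid 0 t n (Suc j)) - f 0"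
    for f :: "real \<Rightarrow> real"
  proof -
    have "(\<Sum>i<Suc n. of_bool (grid 0 t n i < \<sigma>) * (f (grid 0 t n (Suc i)) - f (grid 0 t n i)))
      = (\<Sum>i<Suc j. f (grid 0 t n (Suc i)) - f (grid 0 t n i))"
      using j by (intro sum.mono_neutral_cong_right) (auto simp: lt)
    also have "\<dots> = f (grid 0 t n (Suc j)) - f (grid 0 t n 0)"
      by (rule sum_lessThan_telescope)
    finally show ?thesis by simp
  qed
  then show ?thesis using j grid_diff[of 0 t n j] by (intro that[of "grid 0 t n (Suc j)"]) auto
qed

lemma telescope_until_tendsto:
  fixes f :: "real \<Rightarrow> real"
  assumes t: "0 \<le> \<sigma>" "\<sigma> \<le> t" and f: "continuous_on {0..} f"
  shows "(\<lambda>n. \<Sum>i<Suc n. of_bool (grid 0 t n i < \<sigma>) * (f (grid 0 t n (Suc i)) - f (grid 0 t n i)))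
     \<longlonglongrightarrow> f \<sigma> - f 0"
proof -
  have "\<exists>v. \<sigma> \<le> v \<and> v - \<sigma> \<le> t / real (Suc n) \<and>
    (\<Sum>i<Suc n. of_bool (grid 0 t n i < \<sigma>) * (f (grid 0 t n (Suc i)) - f (grid 0 t n i))) = f v - f 0" for n
    using telescope_until[OF t, of n] by metis
  then obtain v where v: "\<And>n. \<sigma> \<le> v n" "\<And>n. v n - \<sigma> \<le> t / real (Suc n)"
    "\<And>n. (\<Sum>i<Suc n. of_bool (grid 0 t n i < \<sigma>) * (f (grid 0 t n (Suc i)) - f (grid 0 t n i))) = f (v n) - f 0"
    by metis
  have lim: "(\<lambda>n. t / real (Suc n)) \<longlonglongrightarrow> 0"
    using tendsto_mult_right[OF LIMSEQ_inverse_real_of_nat, of t] by (simp add: divide_inverse mult.commute)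
  have "(\<lambda>n. v n - \<sigma>) \<longlonglongrightarrow> 0"
    by (rule real_tendsto_sandwich[OF _ _ tendsto_const lim]) (use v in auto)
  then have "v \<longlonglongrightarrow> \<sigma>" by (rule LIM_zero_cancel)
  moreover have "0 \<le> v n" for n using v(1)[of n] t by linarith
  ultimately have "(\<lambda>n. f (v n)) \<longlonglongrightarrow> f \<sigma>"
    using t by (intro continuous_on_tendsto_compose[OF f]) auto
  then show ?thesis unfolding v(3) by (rule tendsto_diff[OF _ tendsto_const])
qed

lemma indicator_mult_self: "indicator A x * (indicator A x * y) = (indicator A x * y :: real)"
  by (simp add: indicator_def)

context brownian_space
begin

text \<open>The properties of Ito integrals that later arguments rest on. Convergence of the Riemann
  sums on fixed grids is visibly linear in the integrand, so the notion passes to differences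
  without merging two sequences of simple processes.\<close>

definition regular_ito :: "real \<Rightarrow> (real \<Rightarrow> 'a \<Rightarrow> real) \<Rightarrow> (real \<Rightarrow> 'a \<Rightarrow> real) \<Rightarrow> bool" where
  "regular_ito C H X \<longleftrightarrow> regular_integrand C H \<and> adapted F X \<and> continuous_paths M X \<and>
     (\<forall>s t. 0 \<le> s \<and> s \<le> t \<longrightarrow> L2_lim M (riemann_sum B H s t) (\<lambda>\<omega>. X t \<omega> - X s \<omega>)) \<and>
     (AE \<omega> in M. X 0 \<omega> = 0)"

lemma regular_itoI:
  assumes X: "is_ito_integral M F B H X" and H: "regular_integrand C H"
  shows "regular_ito C H X"
proof -
  obtain k \<tau> c where simple: "\<And>m. simple_integrand M F (k m) (\<tau> m) (c m)"
    and lim: "(\<lambda>m. \<integral>\<^sup>+\<omega>. ennreal ((simple_integral B (k m) (\<tau> m) (c m) 0 \<omega> - X 0 \<omega>)\<^sup>2) \<partial>M) \<longlonglongrightarrow> 0"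
    using X unfolding is_ito_integral_def by blast
  \<comment> \<open>All partition points are nonnegative, so every increment of a simple integral at
    time \<open>0\<close> is trivial; hence the limit starts at \<open>0\<close> almost
    surely.\<close>
  have "simple_integral B (k m) (\<tau> m) (c m) 0 \<omega> = 0" for m \<omega>
    using simple_integrand_nonneg[OF simple, of _ m]
    by (auto simp: simple_integral_def min_def intro!: sum.neutral)
  then have "(\<integral>\<^sup>+\<omega>. ennreal ((X 0 \<omega>)\<^sup>2) \<partial>M) = 0"
    using lim LIMSEQ_unique[OF tendsto_const] by simp
  moreover have "X 0 \<in> borel_measurable M"
    using X measurable_F unfolding is_ito_integral_def adapted_def by blast
  ultimately have "AE \<omega> in M. X 0 \<omega> = 0"
    by (subst (asm) nn_integral_0_iff_AE) auto
  then show ?thesis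
    using X H ito_increment_riemann[OF X H] unfolding regular_ito_def is_ito_integral_def by auto
qed

lemma regular_ito_integrand: "regular_ito C H X \<Longrightarrow> regular_integrand C H"
  by (simp add: regular_ito_def)

lemma regular_ito_measurable: "regular_ito C H X \<Longrightarrow> 0 \<le> t \<Longrightarrow> X t \<in> borel_measurable (F t)"
  by (simp add: regular_ito_def adapted_def)

lemma regular_ito_lim:
  "regular_ito C H X \<Longrightarrow> 0 \<le> s \<Longrightarrow> s \<le> t \<Longrightarrow> L2_lim M (riemann_sum B H s t) (\<lambda>\<omega>. X t \<omega> - X s \<omega>)"
  by (simp add: regular_ito_def)

lemma regular_ito_square_integrable:
  "regular_ito C H X \<Longrightarrow> 0 \<le> s \<Longrightarrow> s \<le> t \<Longrightarrow> square_integrable M (\<lambda>\<omega>. X t \<omega> - X s \<omega>)"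
  using regular_ito_lim by (auto simp: L2_lim_def)

lemma regular_ito_square_integrable_0:
  assumes X: "regular_ito C H X" and t: "0 \<le> t"
  shows "square_integrable M (X t)" "AE \<omega> in M. X t \<omega> = X t \<omega> - X 0 \<omega>"
proof -
  have m: "X t \<in> borel_measurable M" using regular_ito_measurable[OF X t] measurable_F by blast
  have s: "square_integrable M (\<lambda>\<omega>. X t \<omega> - X 0 \<omega>)" using regular_ito_square_integrable[OF X _ t] by simp
  have 0: "AE \<omega> in M. X 0 \<omega> = 0" using X by (simp add: regular_ito_def)
  then show "AE \<omega> in M. X t \<omega> = X t \<omega> - X 0 \<omega>" by eventually_elim simp
  have "integrable M (\<lambda>\<omega>. (X t \<omega> - X 0 \<omega>)\<^sup>2) \<longleftrightarrow> integrable M (\<lambda>\<omega>. (X t \<omega>)\<^sup>2)"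
    using 0 m s by (intro integrable_cong_AE) (auto simp: square_integrable_def)
  then show "square_integrable M (X t)" using s m by (simp add: square_integrable_def)
qed

lemma regular_ito_diff:
  assumes X: "regular_ito C H X" and X': "regular_ito C' H' X'"
  shows "regular_ito (C + C') (\<lambda>u \<omega>. H u \<omega> - H' u \<omega>) (\<lambda>u \<omega>. X u \<omega> - X' u \<omega>)"
  unfolding regular_ito_def
proof (intro conjI allI impI)
  show "regular_integrand (C + C') (\<lambda>u \<omega>. H u \<omega> - H' u \<omega>)"
    using X X' by (intro regular_diff) (auto simp: regular_ito_def)
  show "adapted F (\<lambda>u \<omega>. X u \<omega> - X' u \<omega>)"
    using X X' by (auto simp: regular_ito_def adapted_def intro!: borel_measurable_diff)
  show "continuous_paths M (\<lambda>u \<omega>. X u \<omega> - X' u \<omega>)"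
    using X X' by (auto simp: regular_ito_def continuous_paths_def intro!: continuous_intros)
  show "AE \<omega> in M. X 0 \<omega> - X' 0 \<omega> = 0"
    using X X' by (auto simp: regular_ito_def)
  fix s t :: real assume st: "0 \<le> s \<and> s \<le> t"
  have "riemann_sum B (\<lambda>u \<omega>. H u \<omega> - H' u \<omega>) s t = (\<lambda>n \<omega>. riemann_sum B H s t n \<omega> - riemann_sum B H' s t n \<omega>)"
    by (auto simp: fun_eq_iff riemann_sum_def sum_subtractf[symmetric] algebra_simps simp del: sum.lessThan_Suc)
  moreover have "L2_lim M (\<lambda>n \<omega>. riemann_sum B H s t n \<omega> - riemann_sum B H' s t n \<omega>)
      (\<lambda>\<omega>. (X t \<omega> - X s \<omega>) - (X' t \<omega> - X' s \<omega>))"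
    using X X' st by (intro L2_lim_diff) (auto simp: regular_ito_def)
  moreover have "(\<lambda>\<omega>. (X t \<omega> - X s \<omega>) - (X' t \<omega> - X' s \<omega>)) = (\<lambda>\<omega>. X t \<omega> - X' t \<omega> - (X s \<omega> - X' s \<omega>))"
    by auto
  ultimately show "L2_lim M (riemann_sum B (\<lambda>u \<omega>. H u \<omega> - H' u \<omega>) s t) (\<lambda>\<omega>. X t \<omega> - X' t \<omega> - (X s \<omega> - X' s \<omega>))"
    by simp
qed

text \<open>In each Riemann term the factor \<open>g * H\<close> is known at the beginning of its
  cell, so the Brownian increment centres it; the inner product carries this to the limit. This is
  the martingale property in tested form.\<close>

lemma regular_ito_orthogonal:
  assumes X: "regular_ito C H X" and st: "0 \<le> s" "s \<le> t"
    and g: "g \<in> borel_measurable (F s)" "square_integrable M g"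
  shows "(\<integral>\<omega>. g \<omega> * (X t \<omega> - X s \<omega>) \<partial>M) = 0"
proof -
  note H = regular_ito_integrand[OF X]
  have "(\<integral>\<omega>. g \<omega> * riemann_sum B H s t n \<omega> \<partial>M) = 0" for n
  proof -
    have *: "integrable M (\<lambda>\<omega>. g \<omega> * H (grid s t n i) \<omega> * (B (grid s t n (Suc i)) \<omega> - B (grid s t n i) \<omega>))"
      "(\<integral>\<omega>. g \<omega> * H (grid s t n i) \<omega> * (B (grid s t n (Suc i)) \<omega> - B (grid s t n i) \<omega>) \<partial>M) = 0" for i
    proof -
      have gr: "0 \<le> grid s t n i" "s \<le> grid s t n i" "grid s t n i \<le> grid s t n (Suc i)"
        using grid_ge[OF st(2), of n i] st grid_mono[OF st(2), of i "Suc i" n] by auto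
      have Hm: "H (grid s t n i) \<in> borel_measurable (F (grid s t n i))" by (rule regular_measurable[OF H gr(1)])
      have "square_integrable M (\<lambda>\<omega>. H (grid s t n i) \<omega> * g \<omega>)"
        by (rule square_integrable_mult_bounded[OF g(2) measurable_F[OF Hm] regular_bound[OF H gr(1)]])
      then have i: "integrable M (\<lambda>\<omega>. g \<omega> * H (grid s t n i) \<omega>)"
        using square_integrable_integrable by (simp add: mult.commute)
      have m: "(\<lambda>\<omega>. g \<omega> * H (grid s t n i) \<omega>) \<in> borel_measurable (F (grid s t n i))"
        using measurable_F_mono[OF g(1) gr(2)] Hm by simp
      show "integrable M (\<lambda>\<omega>. g \<omega> * H (grid s t n i) \<omega> * (B (grid s t n (Suc i)) \<omega> - B (grid s t n i) \<omega>))"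
        "(\<integral>\<omega>. g \<omega> * H (grid s t n i) \<omega> * (B (grid s t n (Suc i)) \<omega> - B (grid s t n i) \<omega>) \<partial>M) = 0"
        using increment_mean[OF gr(1,3) m i] by auto
    qed
    show ?thesis
      unfolding riemann_sum_def sum_distrib_left mult.assoc[symmetric]
      by (subst Bochner_Integration.integral_sum) (auto simp: * simp del: sum.lessThan_Suc)
  qed
  moreover have "(\<lambda>n. \<integral>\<omega>. g \<omega> * riemann_sum B H s t n \<omega> \<partial>M) \<longlonglongrightarrow> (\<integral>\<omega>. g \<omega> * (X t \<omega> - X s \<omega>) \<partial>M)"
    by (rule L2_lim_inner[OF L2_lim_const[OF g(2)] regular_ito_lim[OF X st]])
  ultimately show ?thesis using LIMSEQ_unique[OF tendsto_const] by fastforce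
qed

text \<open>The event \<open>A\<close> is known at time \<open>s\<close> and can be absorbed into
  the coefficients of the Riemann sums, so the elementary isometry holds on \<open>A\<close>; the
  squared step function is the step function of the square, whose sums converge boundedly.\<close>

lemma regular_ito_isometry:
  assumes X: "regular_ito C H X" and st: "0 \<le> s" "s \<le> t" and A: "A \<in> sets (F s)"
  shows "(\<integral>\<omega>. indicator A \<omega> * (X t \<omega> - X s \<omega>)\<^sup>2 \<partial>M) =
    (\<integral>\<omega>. indicator A \<omega> * time_integral (\<lambda>u \<omega>. H u \<omega> * H u \<omega>) s t \<omega> \<partial>M)"
proof -
  note H = regular_ito_integrand[OF X]
  note H2 = regular_mult[OF H H]
  let ?I = "\<lambda>\<omega>. indicator A \<omega> :: real"
  have AM: "?I \<in> borel_measurable M" using sets_F[OF A] by simp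
  have L: "L2_lim M (\<lambda>n \<omega>. ?I \<omega> * riemann_sum B H s t n \<omega>) (\<lambda>\<omega>. ?I \<omega> * (X t \<omega> - X s \<omega>))"
    by (rule L2_lim_mult_bounded[OF regular_ito_lim[OF X st] AM, of 1]) (simp add: indicator_def)
  have "(\<integral>\<omega>. (?I \<omega> * riemann_sum B H s t n \<omega>) * (?I \<omega> * riemann_sum B H s t n \<omega>) \<partial>M) =
     (\<integral>\<omega>. ?I \<omega> * (\<Sum>i<Suc n. (H (grid s t n i) \<omega> * H (grid s t n i) \<omega>) * ((t - s) / real (Suc n))) \<partial>M)" for n
  proof -
    let ?c = "\<lambda>i \<omega>. ?I \<omega> * H (grid s t n i) \<omega>"
    have "(\<integral>\<omega>. (?I \<omega> * riemann_sum B H s t n \<omega>) * (?I \<omega> * riemann_sum B H s t n \<omega>) \<partial>M) =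
      (\<integral>\<omega>. (\<Sum>i<Suc n. ?c i \<omega> * (B (grid s t n (Suc i)) \<omega> - B (grid s t n i) \<omega>))\<^sup>2 \<partial>M)"
      unfolding power2_eq_square riemann_sum_def sum_distrib_left mult.assoc ..
    also have "\<dots> = (\<integral>\<omega>. (\<integral>u. (\<Sum>i<Suc n. ?c i \<omega> * indicator {grid s t n i<..grid s t n (Suc i)} u)\<^sup>2 \<partial>lborel) \<partial>M)"
    proof (rule elementary_isometry(2))
      fix i
      show g: "0 \<le> grid s t n i" "grid s t n i \<le> grid s t n (Suc i)"
        using grid_ge[OF st(2), of n i] st grid_mono[OF st(2), of i "Suc i" n] by auto
      have "?I \<in> borel_measurable (F (grid s t n i))"
        by (rule measurable_F_mono[of _ s]) (use A grid_ge[OF st(2)] in auto)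
      then show "?c i \<in> borel_measurable (F (grid s t n i))" using regular_measurable[OF H g(1)] by simp
      show "\<exists>C. \<forall>\<omega>\<in>space M. \<bar>?c i \<omega>\<bar> \<le> C"
        using regular_bound[OF H g(1)] by (intro exI[of _ "\<bar>C\<bar>"]) (force simp: indicator_def)
    qed
    also have "\<dots> = (\<integral>\<omega>. ?I \<omega> * (\<Sum>i<Suc n. (H (grid s t n i) \<omega> * H (grid s t n i) \<omega>) * ((t - s) / real (Suc n))) \<partial>M)"
    proof (intro Bochner_Integration.integral_cong refl)
      fix \<omega>
      have "(\<Sum>i<Suc n. ?c i \<omega> * indicator {grid s t n i<..grid s t n (Suc i)} u)\<^sup>2
         = ?I \<omega> * step (\<lambda>u. H u \<omega> * H u \<omega>) s t n u" for u
      proof -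
        have "(\<Sum>i<Suc n. ?c i \<omega> * indicator {grid s t n i<..grid s t n (Suc i)} u) = ?I \<omega> * step (\<lambda>u. H u \<omega>) s t n u"
          unfolding step_def sum_distrib_left mult.assoc ..
        moreover have "step (\<lambda>u. H u \<omega> * H u \<omega>) s t n u = (step (\<lambda>u. H u \<omega>) s t n u)\<^sup>2"
          using step_map[OF st(2), of "(*)" "\<lambda>u. H u \<omega>" n u "\<lambda>u. H u \<omega>"] by (simp add: power2_eq_square)
        ultimately show ?thesis by (simp add: indicator_def)
      qed
      then have "(\<integral>u. (\<Sum>i<Suc n. ?c i \<omega> * indicator {grid s t n i<..grid s t n (Suc i)} u)\<^sup>2 \<partial>lborel)
         = (\<integral>u. ?I \<omega> * step (\<lambda>u. H u \<omega> * H u \<omega>) s t n u \<partial>lborel)" by simp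
      then show "(\<integral>u. (\<Sum>i<Suc n. ?c i \<omega> * indicator {grid s t n i<..grid s t n (Suc i)} u)\<^sup>2 \<partial>lborel)
         = ?I \<omega> * (\<Sum>i<Suc n. (H (grid s t n i) \<omega> * H (grid s t n i) \<omega>) * ((t - s) / real (Suc n)))"
        by (simp add: integral_step(2)[OF st(2)] del: sum.lessThan_Suc)
    qed
    finally show ?thesis .
  qed
  moreover have "(\<lambda>n. \<integral>\<omega>. ?I \<omega> * (\<Sum>i<Suc n. (H (grid s t n i) \<omega> * H (grid s t n i) \<omega>) * ((t - s) / real (Suc n))) \<partial>M)
     \<longlonglongrightarrow> (\<integral>\<omega>. ?I \<omega> * time_integral (\<lambda>u \<omega>. H u \<omega> * H u \<omega>) s t \<omega> \<partial>M)"
  proof (rule integral_dominated_convergence[where w="\<lambda>_. C * C * (t - s)"])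
    show "(\<lambda>\<omega>. ?I \<omega> * time_integral (\<lambda>u \<omega>. H u \<omega> * H u \<omega>) s t \<omega>) \<in> borel_measurable M"
      using AM measurable_F[OF time_integral_measurable[OF H2 st]] by simp
    show "(\<lambda>\<omega>. ?I \<omega> * (\<Sum>i<Suc n. (H (grid s t n i) \<omega> * H (grid s t n i) \<omega>) * ((t - s) / real (Suc n)))) \<in> borel_measurable M" for n
      using AM measurable_F[OF step_sum_measurable[OF H2 st, of n]] by (intro borel_measurable_times)
    show "AE \<omega> in M. (\<lambda>n. ?I \<omega> * (\<Sum>i<Suc n. (H (grid s t n i) \<omega> * H (grid s t n i) \<omega>) * ((t - s) / real (Suc n))))
        \<longlonglongrightarrow> ?I \<omega> * time_integral (\<lambda>u \<omega>. H u \<omega> * H u \<omega>) s t \<omega>"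
      using step_sum_tendsto[OF H2 st] by (intro AE_I2 tendsto_mult_left)
    show "AE \<omega> in M. norm (?I \<omega> * (\<Sum>i<Suc n. (H (grid s t n i) \<omega> * H (grid s t n i) \<omega>) * ((t - s) / real (Suc n))))
        \<le> C * C * (t - s)" for n
    proof (intro AE_I2)
      fix \<omega> assume \<omega>: "\<omega> \<in> space M"
      show "norm (?I \<omega> * (\<Sum>i<Suc n. (H (grid s t n i) \<omega> * H (grid s t n i) \<omega>) * ((t - s) / real (Suc n)))) \<le> C * C * (t - s)"
        using step_sum_bound[OF H2 st \<omega>, of n] st by (simp add: indicator_def abs_mult del: sum.lessThan_Suc)
    qed
  qed simp
  ultimately have "(\<lambda>n. \<integral>\<omega>. (?I \<omega> * riemann_sum B H s t n \<omega>) * (?I \<omega> * riemann_sum B H s t n \<omega>) \<partial>M)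
     \<longlonglongrightarrow> (\<integral>\<omega>. ?I \<omega> * time_integral (\<lambda>u \<omega>. H u \<omega> * H u \<omega>) s t \<omega> \<partial>M)" by simp
  from LIMSEQ_unique[OF L2_lim_inner[OF L L] this] show ?thesis
    by (simp add: power2_eq_square indicator_mult_self mult_ac)
qed

text \<open>A martingale transform by events known at the left endpoints: products over different
  cells vanish by orthogonality and the diagonal is the isometry on \<open>A i\<close>. With
  \<open>A i\<close> the event that a stopping time lies beyond the node, or its complement, the sum
  approximates an increment up to or after that time.\<close>

lemma regular_ito_transform_isometry:
  assumes X: "regular_ito C H X" and t: "0 \<le> t" and A: "\<And>i. i < Suc n \<Longrightarrow> A i \<in> sets (F (grid 0 t n i))"
  shows "square_integrable M (\<lambda>\<omega>. \<Sum>i<Suc n. indicator (A i) \<omega> * (X (grid 0 t n (Suc i)) \<omega> - X (grid 0 t n i) \<omega>))"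
    and "(\<integral>\<omega>. (\<Sum>i<Suc n. indicator (A i) \<omega> * (X (grid 0 t n (Suc i)) \<omega> - X (grid 0 t n i) \<omega>))\<^sup>2 \<partial>M) =
     (\<Sum>i<Suc n. \<integral>\<omega>. indicator (A i) \<omega> *
        time_integral (\<lambda>u \<omega>. H u \<omega> * H u \<omega>) (grid 0 t n i) (grid 0 t n (Suc i)) \<omega> \<partial>M)"
proof -
  let ?g = "grid 0 t n"
  define f where "f i \<omega> = indicator (A i) \<omega> * (X (?g (Suc i)) \<omega> - X (?g i) \<omega>)" for i \<omega>
  have g: "0 \<le> ?g i" "?g i \<le> ?g (Suc i)" for i
    using grid_ge[OF t, of n i] grid_mono[OF t, of i "Suc i" n] by auto
  have ind: "(\<lambda>\<omega>. indicator (A i) \<omega> :: real) \<in> borel_measurable (F (?g j))" if "i \<le> j" "i < Suc n" for i j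
    by (rule measurable_F_mono[of _ "?g i"]) (use that A grid_mono[OF t] in auto)
  have f: "square_integrable M (f i)" if "i < Suc n" for i
    unfolding f_def
    by (rule square_integrable_mult_bounded[OF regular_ito_square_integrable[OF X g] measurable_F[OF ind[OF order_refl that]], of 1])
       (simp add: indicator_def)
  then show "square_integrable M (\<lambda>\<omega>. \<Sum>i<Suc n. indicator (A i) \<omega> * (X (?g (Suc i)) \<omega> - X (?g i) \<omega>))"
    unfolding f_def[symmetric] by (intro square_integrable_sum) auto
  have cross: "(\<integral>\<omega>. f i \<omega> * f j \<omega> \<partial>M) = 0" if "i < j" "j < Suc n" for i j
  proof -
    have le: "?g (Suc i) \<le> ?g j" "?g i \<le> ?g j" using grid_mono[OF t] that by auto
    have s: "square_integrable M (\<lambda>\<omega>. indicator (A j) \<omega> * f i \<omega>)"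
      using that by (intro square_integrable_mult_bounded[OF f measurable_F[OF ind[OF order_refl]], of _ _ 1])
        (auto simp: indicator_def)
    have m: "(\<lambda>\<omega>. indicator (A j) \<omega> * f i \<omega>) \<in> borel_measurable (F (?g j))"
      unfolding f_def using that ind[of j j] ind[of i j]
        measurable_F_mono[OF regular_ito_measurable[OF X g(1)] le(1)]
        measurable_F_mono[OF regular_ito_measurable[OF X g(1)] le(2)] by auto
    have "(\<integral>\<omega>. f i \<omega> * f j \<omega> \<partial>M) = (\<integral>\<omega>. (indicator (A j) \<omega> * f i \<omega>) * (X (?g (Suc j)) \<omega> - X (?g j) \<omega>) \<partial>M)"
      by (intro Bochner_Integration.integral_cong refl) (simp add: f_def[of j])
    then show ?thesis using regular_ito_orthogonal[OF X g m s] by simp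
  qed
  have "(\<integral>\<omega>. (\<Sum>i<Suc n. f i \<omega>)\<^sup>2 \<partial>M) = (\<integral>\<omega>. (\<Sum>i<Suc n. \<Sum>j<Suc n. f i \<omega> * f j \<omega>) \<partial>M)"
    unfolding power2_eq_square sum_product ..
  also have "\<dots> = (\<Sum>i<Suc n. \<Sum>j<Suc n. \<integral>\<omega>. f i \<omega> * f j \<omega> \<partial>M)"
    by (intro integral_double_sum square_integrable_mult f) auto
  also have "\<dots> = (\<Sum>i<Suc n. \<Sum>j<Suc n. if j = i then \<integral>\<omega>. f i \<omega> * f i \<omega> \<partial>M else 0)"
  proof (intro sum.cong refl)
    fix i j assume "i \<in> {..<Suc n}" "j \<in> {..<Suc n}"
    then show "(\<integral>\<omega>. f i \<omega> * f j \<omega> \<partial>M) = (if j = i then \<integral>\<omega>. f i \<omega> * f i \<omega> \<partial>M else 0)"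
      using cross[of i j] cross[of j i] by (cases i j rule: linorder_cases) (auto simp: mult.commute)
  qed
  also have "\<dots> = (\<Sum>i<Suc n. \<integral>\<omega>. f i \<omega> * f i \<omega> \<partial>M)" by simp
  also have "\<dots> = (\<Sum>i<Suc n. \<integral>\<omega>. indicator (A i) \<omega> *
        time_integral (\<lambda>u \<omega>. H u \<omega> * H u \<omega>) (?g i) (?g (Suc i)) \<omega> \<partial>M)"
  proof (intro sum.cong refl)
    fix i assume "i \<in> {..<Suc n}"
    then have "(\<integral>\<omega>. indicator (A i) \<omega> * (X (?g (Suc i)) \<omega> - X (?g i) \<omega>)\<^sup>2 \<partial>M) =
       (\<integral>\<omega>. indicator (A i) \<omega> * time_integral (\<lambda>u \<omega>. H u \<omega> * H u \<omega>) (?g i) (?g (Suc i)) \<omega> \<partial>M)"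
      by (intro regular_ito_isometry[OF X g A]) simp
    moreover have "(\<lambda>\<omega>. f i \<omega> * f i \<omega>) = (\<lambda>\<omega>. indicator (A i) \<omega> * (X (?g (Suc i)) \<omega> - X (?g i) \<omega>)\<^sup>2)"
      by (auto simp: f_def power2_eq_square indicator_def fun_eq_iff)
    ultimately show "(\<integral>\<omega>. f i \<omega> * f i \<omega> \<partial>M) = (\<integral>\<omega>. indicator (A i) \<omega> *
        time_integral (\<lambda>u \<omega>. H u \<omega> * H u \<omega>) (?g i) (?g (Suc i)) \<omega> \<partial>M)" by simp
  qed
  finally show "(\<integral>\<omega>. (\<Sum>i<Suc n. indicator (A i) \<omega> * (X (?g (Suc i)) \<omega> - X (?g i) \<omega>))\<^sup>2 \<partial>M) =
     (\<Sum>i<Suc n. \<integral>\<omega>. indicator (A i) \<omega> * time_integral (\<lambda>u \<omega>. H u \<omega> * H u \<omega>) (?g i) (?g (Suc i)) \<omega> \<partial>M)"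
    unfolding f_def .
qed

section \<open>Maximal inequality for Ito integrals\<close>

lemma regular_ito_grid_maximal:
  fixes n :: nat
  assumes X: "regular_ito C H X" and t: "0 \<le> t" and e: "0 < \<epsilon>"
  defines "E \<equiv> {\<omega>\<in>space M. \<exists>i\<le>Suc n. \<epsilon> < \<bar>X (grid 0 t n i) \<omega> - X 0 \<omega>\<bar>}"
  shows "E \<in> sets M" "\<epsilon>\<^sup>2 * prob E \<le> (\<integral>\<omega>. (X t \<omega> - X 0 \<omega>)\<^sup>2 \<partial>M)"
proof -
  let ?g = "grid 0 t n"
  define Y where "Y i \<omega> = X (?g i) \<omega> - X 0 \<omega>" for i \<omega>
  \<comment> \<open>The first node at which the level is exceeded is \<open>i\<close>: these events
    are disjoint, and each is decided at its own node.\<close>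
  define A where "A i = {\<omega>\<in>space M. \<epsilon> < \<bar>Y i \<omega>\<bar> \<and> (\<forall>j<i. \<bar>Y j \<omega>\<bar> \<le> \<epsilon>)}" for i
  have g: "0 \<le> ?g i" for i using grid_ge[OF t, of n i] by simp
  have Ym: "Y i \<in> borel_measurable (F (?g j))" if "i \<le> j" for i j
    unfolding Y_def using measurable_F_mono[OF regular_ito_measurable[OF X g] grid_mono[OF t that]]
      measurable_F_mono[OF regular_ito_measurable[OF X order_refl] g] by simp
  have Ysq: "square_integrable M (Y i)" for i
    unfolding Y_def using regular_ito_square_integrable[OF X _ g[of i]] by simp
  have [measurable]: "Y i \<in> borel_measurable M" for i using Ysq by (simp add: square_integrable_def)
  have AF: "A i \<in> sets (F (?g i))" for i
  proof -
    have "A i = {\<omega>\<in>space (F (?g i)). \<epsilon> < \<bar>Y i \<omega>\<bar>} \<inter> (space (F (?g i)) \<inter> (\<Inter>j\<in>{..<i}. {\<omega>\<in>space (F (?g i)). \<bar>Y j \<omega>\<bar> \<le> \<epsilon>}))"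
      by (auto simp: A_def space_F)
    also have "\<dots> \<in> sets (F (?g i))"
    proof -
      have 1: "{\<omega>\<in>space (F (?g i)). \<epsilon> < \<bar>Y i \<omega>\<bar>} \<in> sets (F (?g i))" using Ym[of i i] by measurable
      have 2: "{\<omega>\<in>space (F (?g i)). \<bar>Y j \<omega>\<bar> \<le> \<epsilon>} \<in> sets (F (?g i))" if "j < i" for j
      proof -
        have [measurable]: "Y j \<in> borel_measurable (F (?g i))" using Ym that by simp
        show ?thesis by measurable
      qed
      have 3: "space (F (?g i)) \<inter> (\<Inter>j\<in>{..<i}. {\<omega>\<in>space (F (?g i)). \<bar>Y j \<omega>\<bar> \<le> \<epsilon>}) \<in> sets (F (?g i))"
        using 2 by (cases "i = 0") (auto intro!: sets.Int sets.finite_INT)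
      show ?thesis using 1 3 by blast
    qed
    finally show ?thesis .
  qed
  have AM[measurable]: "A i \<in> sets M" for i by (rule sets_F[OF AF])
  have E: "E = (\<Union>i\<in>{..Suc n}. A i)"
  proof (intro set_eqI iffI)
    fix \<omega> assume "\<omega> \<in> E"
    then obtain i where i: "i \<le> Suc n" "\<epsilon> < \<bar>Y i \<omega>\<bar>" and \<omega>: "\<omega> \<in> space M" by (auto simp: E_def Y_def)
    define j where "j = (LEAST j. \<epsilon> < \<bar>Y j \<omega>\<bar>)"
    have "\<epsilon> < \<bar>Y j \<omega>\<bar>" "j \<le> i" unfolding j_def using i(2) by (rule LeastI) (rule Least_le[of "\<lambda>j. \<epsilon> < \<bar>Y j \<omega>\<bar>", OF i(2)])
    moreover have "\<bar>Y l \<omega>\<bar> \<le> \<epsilon>" if "l < j" for l using not_less_Least[of l] that unfolding j_def by force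
    ultimately show "\<omega> \<in> (\<Union>i\<in>{..Suc n}. A i)" using i \<omega> by (auto simp: A_def intro!: bexI[of _ j])
  qed (auto simp: A_def E_def Y_def)
  then show "E \<in> sets M" by auto
  have disj: "disjoint_family_on A {..Suc n}"
    unfolding disjoint_family_on_def A_def by (force simp: not_less elim!: linorder_neqE_nat)
  have Yn: "Y (Suc n) = (\<lambda>\<omega>. X t \<omega> - X 0 \<omega>)" by (auto simp: Y_def)
  have step: "\<epsilon>\<^sup>2 * prob (A i) \<le> (\<integral>\<omega>. indicator (A i) \<omega> * (Y (Suc n) \<omega>)\<^sup>2 \<partial>M)" if "i \<le> Suc n" for i
  proof -
    let ?I = "\<lambda>\<omega>. indicator (A i) \<omega> :: real"
    define D where "D \<omega> = X t \<omega> - X (?g i) \<omega>" for \<omega>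
    have git: "?g i \<le> t" using grid_le[OF t that] .
    have Dsq: "square_integrable M D" unfolding D_def by (rule regular_ito_square_integrable[OF X g git])
    have IY: "square_integrable M (\<lambda>\<omega>. ?I \<omega> * Y i \<omega>)"
      by (rule square_integrable_mult_bounded[OF Ysq, where C=1]) (auto simp: indicator_def)
    have "(\<integral>\<omega>. (?I \<omega> * Y i \<omega>) * D \<omega> \<partial>M) = 0"
      unfolding D_def using Ym[of i i] AF[of i] by (intro regular_ito_orthogonal[OF X g git _ IY]) auto
    moreover have "integrable M (\<lambda>\<omega>. (?I \<omega> * Y i \<omega>) * D \<omega>)" by (rule square_integrable_mult[OF IY Dsq])
    moreover have iY: "integrable M (\<lambda>\<omega>. ?I \<omega> * (Y j \<omega>)\<^sup>2)" for j
      using square_integrable_imp[OF Ysq] by (intro integrable_real_mult_indicator[of _ M, simplified mult.commute[of _ "indicator _ _"]]) auto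
    moreover have "\<epsilon>\<^sup>2 * prob (A i) = (\<integral>\<omega>. ?I \<omega> * \<epsilon>\<^sup>2 \<partial>M)" by simp
    \<comment> \<open>Subtracting the centred cross term turns the terminal square into
      \<open>(Y i)\<^sup>2 + D\<^sup>2\<close> on \<open>A i\<close>, which is at least
      \<open>\<epsilon>\<^sup>2\<close> there.\<close>
    moreover have "(\<integral>\<omega>. ?I \<omega> * \<epsilon>\<^sup>2 \<partial>M) \<le> (\<integral>\<omega>. ?I \<omega> * (Y (Suc n) \<omega>)\<^sup>2 - 2 * ((?I \<omega> * Y i \<omega>) * D \<omega>) \<partial>M)"
    proof (intro integral_mono)
      show "integrable M (\<lambda>\<omega>. ?I \<omega> * \<epsilon>\<^sup>2)" by (intro integrable_mult_left integrable_real_indicator) (auto simp: emeasure_eq_measure)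
      show "integrable M (\<lambda>\<omega>. ?I \<omega> * (Y (Suc n) \<omega>)\<^sup>2 - 2 * ((?I \<omega> * Y i \<omega>) * D \<omega>))"
        using iY \<open>integrable M (\<lambda>\<omega>. (?I \<omega> * Y i \<omega>) * D \<omega>)\<close> by simp
      fix \<omega> assume "\<omega> \<in> space M"
      show "?I \<omega> * \<epsilon>\<^sup>2 \<le> ?I \<omega> * (Y (Suc n) \<omega>)\<^sup>2 - 2 * ((?I \<omega> * Y i \<omega>) * D \<omega>)"
      proof (cases "\<omega> \<in> A i")
        case True
        then have "\<epsilon> \<le> \<bar>Y i \<omega>\<bar>" by (auto simp: A_def)
        then have "\<epsilon>\<^sup>2 \<le> (Y i \<omega>)\<^sup>2" using e by (simp add: abs_le_square_iff[symmetric])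
        also have "\<dots> \<le> (Y i \<omega>)\<^sup>2 + (D \<omega>)\<^sup>2" by simp
        also have "\<dots> = (Y (Suc n) \<omega>)\<^sup>2 - 2 * (Y i \<omega> * D \<omega>)"
          by (simp add: Y_def D_def power2_eq_square algebra_simps)
        finally show ?thesis using True by simp
      qed simp
    qed
    ultimately show ?thesis by (simp add: mult.commute)
  qed
  have "\<epsilon>\<^sup>2 * prob E = (\<Sum>i\<le>Suc n. \<epsilon>\<^sup>2 * prob (A i))"
    unfolding E sum_distrib_left[symmetric] using disj by (subst finite_measure_finite_Union) auto
  also have "\<dots> \<le> (\<Sum>i\<le>Suc n. \<integral>\<omega>. indicator (A i) \<omega> * (Y (Suc n) \<omega>)\<^sup>2 \<partial>M)"
    using step by (intro sum_mono) auto
  also have "\<dots> = (\<integral>\<omega>. (\<Sum>i\<le>Suc n. indicator (A i) \<omega> * (Y (Suc n) \<omega>)\<^sup>2) \<partial>M)"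
    using square_integrable_imp[OF Ysq]
    by (intro Bochner_Integration.integral_sum[symmetric] integrable_real_mult_indicator[of _ M, simplified mult.commute[of _ "indicator _ _"]]) auto
  also have "\<dots> \<le> (\<integral>\<omega>. (Y (Suc n) \<omega>)\<^sup>2 \<partial>M)"
  proof (intro integral_mono)
    show "integrable M (\<lambda>\<omega>. \<Sum>i\<le>Suc n. indicator (A i) \<omega> * (Y (Suc n) \<omega>)\<^sup>2)"
      using square_integrable_imp[OF Ysq]
      by (intro Bochner_Integration.integrable_sum integrable_real_mult_indicator[of _ M, simplified mult.commute[of _ "indicator _ _"]]) auto
    show "integrable M (\<lambda>\<omega>. (Y (Suc n) \<omega>)\<^sup>2)" by (rule square_integrable_imp[OF Ysq])
    fix \<omega>
    have "(\<Sum>i\<le>Suc n. indicator (A i) \<omega>) = (indicator (\<Union>i\<in>{..Suc n}. A i) \<omega> :: real)"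
      using disj by (intro indicator_UN_disjoint[symmetric]) auto
    also have "\<dots> \<le> 1" by (simp add: indicator_def)
    finally show "(\<Sum>i\<le>Suc n. indicator (A i) \<omega> * (Y (Suc n) \<omega>)\<^sup>2) \<le> (Y (Suc n) \<omega>)\<^sup>2"
      unfolding sum_distrib_right[symmetric] by (intro mult_left_le_one_le sum_nonneg) (auto simp del: sum.atMost_Suc)
  qed
  finally show "\<epsilon>\<^sup>2 * prob E \<le> (\<integral>\<omega>. (X t \<omega> - X 0 \<omega>)\<^sup>2 \<partial>M)" unfolding Yn .
qed

text \<open>Along nested grids the exceedance events increase, so the bound on one grid passes to
  their union; continuity of the paths places every exceedance time inside this union. Covering by a
  measurable set \<open>E\<close> avoids speaking of the supremum over uncountably many
  times.\<close>

lemma regular_ito_maximal: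
  assumes X: "regular_ito C H X" and t: "0 \<le> t" and e: "0 < \<epsilon>"
  obtains E where "E \<in> sets M" "\<epsilon>\<^sup>2 * prob E \<le> (\<integral>\<omega>. (X t \<omega> - X 0 \<omega>)\<^sup>2 \<partial>M)"
    "\<And>\<omega> u. \<omega> \<in> space M \<Longrightarrow> u \<in> {0..t} \<Longrightarrow> \<epsilon> < \<bar>X u \<omega> - X 0 \<omega>\<bar> \<Longrightarrow> \<omega> \<in> E"
proof -
  \<comment> \<open>\<open>N k\<close> counts from \<open>2 ^ k - 1\<close> because a grid with
    index \<open>n\<close> has \<open>Suc n\<close> cells; the number of cells is then
    \<open>2 ^ k\<close> and the grids are nested.\<close>
  define N :: "nat \<Rightarrow> nat" where "N k = 2 ^ k - 1" for k
  have N: "Suc (N k) = 2 ^ k" for k by (simp add: N_def)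
  define E where "E k = {\<omega>\<in>space M. \<exists>i\<le>Suc (N k). \<epsilon> < \<bar>X (grid 0 t (N k) i) \<omega> - X 0 \<omega>\<bar>}" for k
  note E = regular_ito_grid_maximal[OF X t e, of "N _", folded E_def]
  have refine: "grid 0 t (N k) i = grid 0 t (N (Suc k)) (2 * i)" for k i
    unfolding grid_def N by simp
  have inc: "incseq E"
  proof (rule incseq_SucI)
    fix k
    show "E k \<le> E (Suc k)"
    proof
      fix \<omega> assume "\<omega> \<in> E k"
      then obtain i where i: "i \<le> Suc (N k)" "\<epsilon> < \<bar>X (grid 0 t (N k) i) \<omega> - X 0 \<omega>\<bar>" and \<omega>: "\<omega> \<in> space M"
        by (auto simp: E_def)
      have "2 * i \<le> Suc (N (Suc k))" using i(1) unfolding N by simp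
      then show "\<omega> \<in> E (Suc k)" using i(2) \<omega> unfolding refine[of k i] E_def by blast
    qed
  qed
  show ?thesis
  proof (rule that[of "\<Union>k. E k"])
    show "(\<Union>k. E k) \<in> sets M" using E(1) by auto
    have "(\<lambda>k. prob (E k)) \<longlonglongrightarrow> prob (\<Union>k. E k)"
      using E(1) inc by (intro finite_Lim_measure_incseq) auto
    then have "(\<lambda>k. \<epsilon>\<^sup>2 * prob (E k)) \<longlonglongrightarrow> \<epsilon>\<^sup>2 * prob (\<Union>k. E k)"
      by (rule tendsto_mult_left)
    then show "\<epsilon>\<^sup>2 * prob (\<Union>k. E k) \<le> (\<integral>\<omega>. (X t \<omega> - X 0 \<omega>)\<^sup>2 \<partial>M)"
      by (rule LIMSEQ_le_const2) (use E(2) in auto)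
    fix \<omega> u assume \<omega>: "\<omega> \<in> space M" and u: "u \<in> {0..t}" "\<epsilon> < \<bar>X u \<omega> - X 0 \<omega>\<bar>"
    have "u \<noteq> 0" using u e by auto
    then have u0: "0 < u" "u \<le> t" using u by auto
    have "\<exists>i. i \<le> Suc (N k) \<and> u \<le> grid 0 t (N k) i \<and> grid 0 t (N k) i - u \<le> t / 2 ^ k" for k
    proof -
      obtain i where "i < Suc (N k)" "grid 0 t (N k) i < u" "u \<le> grid 0 t (N k) (Suc i)"
        using grid_cell[OF u0] by metis
      then show ?thesis using grid_diff[of 0 t "N k" i] unfolding N
        by (intro exI[of _ "Suc i"]) auto
    qed
    then obtain i where i: "\<And>k. i k \<le> Suc (N k)" "\<And>k. u \<le> grid 0 t (N k) (i k)"
      "\<And>k. grid 0 t (N k) (i k) - u \<le> t / 2 ^ k" by metis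
    have lim: "(\<lambda>k. t / 2 ^ k) \<longlonglongrightarrow> 0"
      by (rule LIMSEQ_divide_realpow_zero) simp
    have "(\<lambda>k. grid 0 t (N k) (i k) - u) \<longlonglongrightarrow> 0"
      by (rule real_tendsto_sandwich[OF _ _ tendsto_const lim]) (use i in auto)
    then have "(\<lambda>k. grid 0 t (N k) (i k)) \<longlonglongrightarrow> u" by (rule LIM_zero_cancel)
    moreover have "continuous_on {0..} (\<lambda>u. X u \<omega>)"
      using X \<omega> by (simp add: regular_ito_def continuous_paths_def)
    moreover have "0 \<le> grid 0 t (N k) (i k)" for k using i(2)[of k] u0 by linarith
    ultimately have "(\<lambda>k. X (grid 0 t (N k) (i k)) \<omega>) \<longlonglongrightarrow> X u \<omega>"
      using u0 by (intro continuous_on_tendsto_compose[where s="{0..}" and f="\<lambda>u. X u \<omega>"]) auto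
    then have "(\<lambda>k. \<bar>X (grid 0 t (N k) (i k)) \<omega> - X 0 \<omega>\<bar>) \<longlonglongrightarrow> \<bar>X u \<omega> - X 0 \<omega>\<bar>"
      by (rule tendsto_rabs[OF tendsto_diff[OF _ tendsto_const]])
    \<comment> \<open>The strict inequality at \<open>u\<close> is an open condition and so persists
      at nodes close to \<open>u\<close>.\<close>
    then have "\<forall>\<^sub>F k in sequentially. \<epsilon> < \<bar>X (grid 0 t (N k) (i k)) \<omega> - X 0 \<omega>\<bar>"
      using u(2) by (rule order_tendstoD)
    then obtain k where "\<epsilon> < \<bar>X (grid 0 t (N k) (i k)) \<omega> - X 0 \<omega>\<bar>"
      by (auto simp: eventually_sequentially)
    then show "\<omega> \<in> (\<Union>k. E k)" using \<omega> i(1)[of k] by (auto simp: E_def)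
  qed
qed

section \<open>Ito integrals at bounded stopping times\<close>

lemma AE_limit_zero_of_L2:
  assumes s: "\<And>n. square_integrable M (f n)" and l: "(\<lambda>n. \<integral>\<omega>. (f n \<omega>)\<^sup>2 \<partial>M) \<longlonglongrightarrow> 0"
    and c: "\<And>\<omega>. \<omega> \<in> space M \<Longrightarrow> (\<lambda>n. f n \<omega>) \<longlonglongrightarrow> g \<omega>"
  shows "AE \<omega> in M. g \<omega> = 0"
proof -
  have "L2_lim M f (\<lambda>_. 0)" using s l by (simp add: L2_lim_def square_integrable_def)
  then obtain r :: "nat \<Rightarrow> nat" where r: "strict_mono r" "AE \<omega> in M. (\<lambda>n. f (r n) \<omega>) \<longlonglongrightarrow> 0"
    by (rule L2_lim_AE_subseq)
  show ?thesis
    using r(2) AE_space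
  proof eventually_elim
    case (elim \<omega>)
    show ?case
      using LIMSEQ_unique[OF elim(1)] LIMSEQ_subseq_LIMSEQ[OF c[OF elim(2)] r(1)] by (simp add: o_def)
  qed
qed

text \<open>Summing the increments over the cells that begin before \<open>\<sigma>\<close> gives,
  by continuity, \<open>X \<sigma> - X 0\<close> in the limit. Cells lying entirely before
  \<open>\<sigma>\<close> carry a vanishing integrand, so only the cell containing
  \<open>\<sigma>\<close> adds to the second moment, which is therefore at most the squared bound
  times the mesh.\<close>

lemma regular_ito_stopped_zero:
  assumes X: "regular_ito C H X" and t: "0 \<le> t"
    and \<sigma>: "\<And>\<omega>. \<omega> \<in> space M \<Longrightarrow> 0 \<le> \<sigma> \<omega> \<and> \<sigma> \<omega> \<le> t"
      "\<And>u. 0 \<le> u \<Longrightarrow> u < t \<Longrightarrow> {\<omega>\<in>space M. u < \<sigma> \<omega>} \<in> sets (F u)"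
    and H0: "\<And>u \<omega>. \<omega> \<in> space M \<Longrightarrow> 0 \<le> u \<Longrightarrow> u < \<sigma> \<omega> \<Longrightarrow> H u \<omega> = 0"
  shows "AE \<omega> in M. X (\<sigma> \<omega>) \<omega> = 0"
proof -
  let ?g = "grid 0 t"
  note H = regular_ito_integrand[OF X]
  note H2 = regular_mult[OF H H]
  define A where "A n i = {\<omega>\<in>space M. ?g n i < \<sigma> \<omega>}" for n i
  define f where "f n \<omega> = (\<Sum>i<Suc n. indicator (A n i) \<omega> * (X (?g n (Suc i)) \<omega> - X (?g n i) \<omega>))" for n \<omega>
  have g: "0 \<le> ?g n i" "?g n i \<le> ?g n (Suc i)" for n i
    using grid_ge[OF t, of n i] grid_mono[OF t, of i "Suc i" n] by auto
  have A: "A n i \<in> sets (F (?g n i))" for n i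
  proof (cases "?g n i < t")
    case False
    then have "A n i = {}" using \<sigma>(1) by (force simp: A_def)
    then show ?thesis by simp
  qed (use \<sigma>(2) g in \<open>auto simp: A_def\<close>)
  note iso = regular_ito_transform_isometry[OF X t, of n "A n" for n, OF A, folded f_def]
  have "AE \<omega> in M. X (\<sigma> \<omega>) \<omega> - X 0 \<omega> = 0"
  proof (rule AE_limit_zero_of_L2[of f])
    show "square_integrable M (f n)" for n by (rule iso(1))
    show "(\<lambda>n. f n \<omega>) \<longlonglongrightarrow> X (\<sigma> \<omega>) \<omega> - X 0 \<omega>" if \<omega>: "\<omega> \<in> space M" for \<omega>
    proof -
      have "continuous_on {0..} (\<lambda>u. X u \<omega>)"
        using X \<omega> by (simp add: regular_ito_def continuous_paths_def)
      from telescope_until_tendsto[OF _ _ this, of "\<sigma> \<omega>" t]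
      show ?thesis unfolding f_def A_def using \<sigma>(1)[OF \<omega>] \<omega> by (simp add: indicator_def of_bool_def)
    qed
    have le: "(\<integral>\<omega>. (f n \<omega>)\<^sup>2 \<partial>M) \<le> C * C * t / real (Suc n)" for n
    proof -
      define K where "K = C * C * (t / real (Suc n))"
      \<comment> \<open>The event that cell \<open>i\<close> contains \<open>\<sigma>\<close>. These
        events are disjoint, so their probabilities add up to at most \<open>1\<close> and the
        number of cells disappears from the bound.\<close>
      define D where "D i = {\<omega>\<in>space M. ?g n i < \<sigma> \<omega> \<and> \<sigma> \<omega> \<le> ?g n (Suc i)}" for i
      have AM: "{\<omega>\<in>space M. u < \<sigma> \<omega>} \<in> sets M" if "0 \<le> u" for u
      proof (cases "u < t")
        case False
        then have "{\<omega>\<in>space M. u < \<sigma> \<omega>} = {}" using \<sigma>(1) by force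
        then show ?thesis by (metis sets.empty_sets)
      next
        case True
        show ?thesis by (rule sets_F[OF \<sigma>(2)[OF that True]])
      qed
      have DM[measurable]: "D i \<in> sets M" for i
      proof -
        have "D i = {\<omega>\<in>space M. ?g n i < \<sigma> \<omega>} - {\<omega>\<in>space M. ?g n (Suc i) < \<sigma> \<omega>}" by (auto simp: D_def)
        then show ?thesis using AM[OF g(1), of n i] AM[OF g(1), of n "Suc i"] by (simp only: sets.Diff)
      qed
      have disj: "disjoint_family_on D {..<Suc n}"
        unfolding disjoint_family_on_def
      proof (intro ballI impI)
        fix i j :: nat assume "i \<noteq> j"
        then show "D i \<inter> D j = {}"
          using grid_mono[OF t, of "Suc i" j n] grid_mono[OF t, of "Suc j" i n]
          by (cases i j rule: linorder_cases) (force simp: D_def)+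
      qed
      have "(\<integral>\<omega>. (f n \<omega>)\<^sup>2 \<partial>M) = (\<Sum>i<Suc n. \<integral>\<omega>. indicator (A n i) \<omega> *
        time_integral (\<lambda>u \<omega>. H u \<omega> * H u \<omega>) (?g n i) (?g n (Suc i)) \<omega> \<partial>M)" by (rule iso(2))
      also have "\<dots> \<le> (\<Sum>i<Suc n. \<integral>\<omega>. indicator (D i) \<omega> * K \<partial>M)"
      proof (intro sum_mono integral_mono_AE' AE_I2)
        fix i \<omega> assume \<omega>: "\<omega> \<in> space M"
        let ?T = "time_integral (\<lambda>u \<omega>. H u \<omega> * H u \<omega>) (?g n i) (?g n (Suc i)) \<omega>"
        have T: "?T \<le> K"
          using time_integral_bound[OF H2 g[of n i] \<omega>] grid_diff[of 0 t n i] by (simp add: K_def)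
        have CC: "0 \<le> K" using t by (simp add: K_def)
        show "0 \<le> indicator (D i) \<omega> * K" using CC by simp
        show "indicator (A n i) \<omega> * ?T \<le> indicator (D i) \<omega> * K"
        proof (cases "\<omega> \<in> A n i \<and> \<omega> \<notin> D i")
          case True
          then have "?g n (Suc i) < \<sigma> \<omega>" by (auto simp: A_def D_def)
          then have "?T = (\<integral>u. 0 \<partial>(lborel :: real measure))"
            unfolding time_integral_def using H0[OF \<omega>] g[of n i]
            by (intro Bochner_Integration.integral_cong refl) (auto simp: indicator_def)
          then show ?thesis using CC by simp
        next
          case False
          then show ?thesis using T CC by (auto simp: indicator_def A_def D_def)
        qed
      next
        fix i
        show "integrable M (\<lambda>\<omega>. indicator (D i) \<omega> * K)"
          by (intro integrable_mult_left integrable_real_indicator) (auto simp: emeasure_eq_measure)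
      qed
      also have "\<dots> = (\<Sum>i<Suc n. prob (D i)) * K"
        by (simp add: sum_distrib_right del: sum.lessThan_Suc)
      also have "\<dots> \<le> 1 * K"
      proof (rule mult_right_mono)
        have "(\<Sum>i<Suc n. prob (D i)) = prob (\<Union>i\<in>{..<Suc n}. D i)"
          using disj DM by (intro finite_measure_finite_Union[symmetric]) auto
        then show "(\<Sum>i<Suc n. prob (D i)) \<le> 1" using prob_le_1 by (simp only:)
        show "0 \<le> K" using t by (simp add: K_def)
      qed
      finally show ?thesis by (simp add: K_def)
    qed
    have lim: "(\<lambda>n. C * C * t / real (Suc n)) \<longlonglongrightarrow> 0"
      using tendsto_mult_right[OF LIMSEQ_inverse_real_of_nat, of "C * C * t"] by (simp add: divide_inverse mult.commute)
    show "(\<lambda>n. \<integral>\<omega>. (f n \<omega>)\<^sup>2 \<partial>M) \<longlonglongrightarrow> 0"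
      by (rule real_tendsto_sandwich[OF _ _ tendsto_const lim]) (use le in auto)
  qed
  moreover have "AE \<omega> in M. X 0 \<omega> = 0" using X by (simp add: regular_ito_def)
  ultimately show ?thesis by eventually_elim simp
qed

text \<open>The complementary transform keeps the cells that begin at or after
  \<open>\<sigma>\<close>; on them the integrand vanishes up to \<open>t\<close>, so every
  approximating sum has second moment \<open>0\<close>, while pathwise they converge to
  \<open>X t - X \<sigma>\<close>.\<close>

lemma regular_ito_stopped_const:
  assumes X: "regular_ito C H X" and t: "0 \<le> t"
    and \<sigma>: "\<And>\<omega>. \<omega> \<in> space M \<Longrightarrow> 0 \<le> \<sigma> \<omega> \<and> \<sigma> \<omega> \<le> t"
      "\<And>u. 0 \<le> u \<Longrightarrow> u < t \<Longrightarrow> {\<omega>\<in>space M. u < \<sigma> \<omega>} \<in> sets (F u)"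
    and H0: "\<And>u \<omega>. \<omega> \<in> space M \<Longrightarrow> \<sigma> \<omega> < u \<Longrightarrow> u \<le> t \<Longrightarrow> H u \<omega> = 0"
  shows "AE \<omega> in M. X (\<sigma> \<omega>) \<omega> = X t \<omega>"
proof -
  let ?g = "grid 0 t"
  define A where "A n i = space M - {\<omega>\<in>space M. ?g n i < \<sigma> \<omega>}" for n i
  define f where "f n \<omega> = (\<Sum>i<Suc n. indicator (A n i) \<omega> * (X (?g n (Suc i)) \<omega> - X (?g n i) \<omega>))" for n \<omega>
  have g: "0 \<le> ?g n i" for n i using grid_ge[OF t, of n i] by auto
  have A: "A n i \<in> sets (F (?g n i))" for n i
  proof -
    have "{\<omega>\<in>space M. ?g n i < \<sigma> \<omega>} \<in> sets (F (?g n i))"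
    proof (cases "?g n i < t")
      case False
      then have "{\<omega>\<in>space M. ?g n i < \<sigma> \<omega>} = {}" using \<sigma>(1) by force
      then show ?thesis by (metis sets.empty_sets)
    qed (use \<sigma>(2) g in auto)
    then show ?thesis unfolding A_def space_F[of "?g n i", symmetric] by auto
  qed
  note iso = regular_ito_transform_isometry[OF X t, of n "A n" for n, OF A, folded f_def]
  have "AE \<omega> in M. X t \<omega> - X (\<sigma> \<omega>) \<omega> = 0"
  proof (rule AE_limit_zero_of_L2[of f])
    show "square_integrable M (f n)" for n by (rule iso(1))
    show "(\<lambda>n. f n \<omega>) \<longlonglongrightarrow> X t \<omega> - X (\<sigma> \<omega>) \<omega>" if \<omega>: "\<omega> \<in> space M" for \<omega>
    proof -
      let ?h = "\<lambda>n. \<Sum>i<Suc n. of_bool (?g n i < \<sigma> \<omega>) * (X (?g n (Suc i)) \<omega> - X (?g n i) \<omega>)"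
      have "continuous_on {0..} (\<lambda>u. X u \<omega>)"
        using X \<omega> by (simp add: regular_ito_def continuous_paths_def)
      from telescope_until_tendsto[OF _ _ this, of "\<sigma> \<omega>" t]
      have "?h \<longlonglongrightarrow> X (\<sigma> \<omega>) \<omega> - X 0 \<omega>" using \<sigma>(1)[OF \<omega>] by simp
      then have "(\<lambda>n. (X t \<omega> - X 0 \<omega>) - ?h n) \<longlonglongrightarrow> (X t \<omega> - X 0 \<omega>) - (X (\<sigma> \<omega>) \<omega> - X 0 \<omega>)"
        by (intro tendsto_diff tendsto_const)
      moreover have "f n \<omega> = (X t \<omega> - X 0 \<omega>) - ?h n" for n
      proof -
        have eq: "X t \<omega> - X 0 \<omega> = (\<Sum>i<Suc n. X (?g n (Suc i)) \<omega> - X (?g n i) \<omega>)"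
          using sum_lessThan_telescope[of "\<lambda>i. X (?g n i) \<omega>" "Suc n"] by simp
        then show ?thesis
          unfolding f_def A_def eq sum_subtractf[symmetric] using \<omega>
          by (intro sum.cong refl) (auto simp: indicator_def)
      qed
      ultimately show ?thesis by simp
    qed
    have "(\<integral>\<omega>. (f n \<omega>)\<^sup>2 \<partial>M) = 0" for n
    proof -
      have z: "indicator (A n i) \<omega> * time_integral (\<lambda>u \<omega>. H u \<omega> * H u \<omega>) (?g n i) (?g n (Suc i)) \<omega> = 0"
        if \<omega>: "\<omega> \<in> space M" and i: "i < Suc n" for \<omega> i
      proof (cases "\<omega> \<in> A n i")
        case True
        then have "\<sigma> \<omega> \<le> ?g n i" by (auto simp: A_def)
        then have "time_integral (\<lambda>u \<omega>. H u \<omega> * H u \<omega>) (?g n i) (?g n (Suc i)) \<omega> = (\<integral>u. 0 \<partial>(lborel :: real measure))"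
          unfolding time_integral_def using H0[OF \<omega>] grid_le[OF t, of "Suc i" n] i
          by (intro Bochner_Integration.integral_cong refl) (auto simp: indicator_def)
        then show ?thesis by simp
      qed simp
      have "(\<integral>\<omega>. (f n \<omega>)\<^sup>2 \<partial>M) = (\<Sum>i<Suc n. \<integral>\<omega>. indicator (A n i) \<omega> *
        time_integral (\<lambda>u \<omega>. H u \<omega> * H u \<omega>) (?g n i) (?g n (Suc i)) \<omega> \<partial>M)" by (rule iso(2))
      also have "\<dots> = (\<Sum>i<Suc n. \<integral>\<omega>. 0 \<partial>M)"
        using z by (intro sum.cong refl Bochner_Integration.integral_cong) auto
      finally show ?thesis by simp
    qed
    then show "(\<lambda>n. \<integral>\<omega>. (f n \<omega>)\<^sup>2 \<partial>M) \<longlonglongrightarrow> 0" by simp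
  qed
  then show ?thesis by eventually_elim simp
qed

end

section \<open>Exponential martingales and the change of measure\<close>

text \<open>Completing the square: the exponential weight shifts the mean by \<open>c * d\<close>.
  This is the change of measure for a single increment.\<close>

lemma normal_density_tilt:
  assumes "0 < d"
  shows "normal_density 0 (sqrt d) x * exp (c * x - c\<^sup>2 * d / 2) = normal_density (c * d) (sqrt d) x"
proof -
  have "- x\<^sup>2 / (2 * d) + (c * x - c\<^sup>2 * d / 2) = - (x - c * d)\<^sup>2 / (2 * d)"
    using assms by (simp add: field_simps power2_eq_square)
  then show ?thesis
    using assms by (simp add: normal_density_def exp_add[symmetric])
qed

text \<open>Expanding the square leaves only Gaussian moments: the exponential factor shifts the
  mean to \<open>c * d\<close>, and its square shifts it to \<open>2 * c * d\<close> at the price of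
  a factor \<open>exp (c\<^sup>2 * d)\<close>. The terms below second order in \<open>c\<close>
  cancel.\<close>

lemma normal_density_exp_remainder:
  assumes d: "0 < d"
  shows "(\<integral>\<^sup>+x. ennreal (normal_density 0 (sqrt d) x) * ennreal ((exp (c * x - c\<^sup>2 * d / 2) - 1 - c * x)\<^sup>2) \<partial>lborel)
    = ennreal (exp (c\<^sup>2 * d) - 1 - c\<^sup>2 * d)"
proof -
  let ?n = "\<lambda>\<mu>. normal_density \<mu> (sqrt d)"
  have s: "0 < sqrt d" using d by simp
  have i1: "has_bochner_integral lborel (?n \<mu>) 1" for \<mu>
    using integrable_normal_density[OF s] integral_normal_density[OF s] by (simp add: has_bochner_integral_iff)
  have i2: "has_bochner_integral lborel (\<lambda>x. ?n \<mu> x * x) \<mu>" for \<mu>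
    by (rule normal_moment_nz_1[OF s])
  have i3: "has_bochner_integral lborel (\<lambda>x. ?n 0 x * x\<^sup>2) d"
    using integrable_normal_moment[OF s, of 0 2] integral_normal_moment_even[OF s, of 0 1] d
    by (simp add: has_bochner_integral_iff fact_numeral)
  have "has_bochner_integral lborel
     (\<lambda>x. exp (c\<^sup>2 * d) * ?n (2 * c * d) x + ?n 0 x + c\<^sup>2 * (?n 0 x * x\<^sup>2) - 2 * ?n (c * d) x
        - 2 * c * (?n (c * d) x * x) + 2 * c * (?n 0 x * x))
     (exp (c\<^sup>2 * d) * 1 + 1 + c\<^sup>2 * d - 2 * 1 - 2 * c * (c * d) + 2 * c * 0)"
    by (intro has_bochner_integral_add has_bochner_integral_diff has_bochner_integral_mult_right i1 i2 i3)
  also have "(\<lambda>x. exp (c\<^sup>2 * d) * ?n (2 * c * d) x + ?n 0 x + c\<^sup>2 * (?n 0 x * x\<^sup>2) - 2 * ?n (c * d) x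
        - 2 * c * (?n (c * d) x * x) + 2 * c * (?n 0 x * x)) =
     (\<lambda>x. ?n 0 x * (exp (c * x - c\<^sup>2 * d / 2) - 1 - c * x)\<^sup>2)"
  proof
    fix x
    define e where "e = exp (c * x - c\<^sup>2 * d / 2)"
    have a: "?n (c * d) x = ?n 0 x * e" using normal_density_tilt[OF d, of x c] by (simp add: e_def)
    have "exp (2 * c * x - (2 * c)\<^sup>2 * d / 2) * exp (c\<^sup>2 * d) = e\<^sup>2"
      by (simp add: e_def power2_eq_square mult_exp_exp algebra_simps)
    then have b: "exp (c\<^sup>2 * d) * ?n (2 * c * d) x = ?n 0 x * e\<^sup>2"
      unfolding normal_density_tilt[OF d, of x "2 * c", symmetric] by (metis mult.commute mult.left_commute)
    show "exp (c\<^sup>2 * d) * ?n (2 * c * d) x + ?n 0 x + c\<^sup>2 * (?n 0 x * x\<^sup>2) - 2 * ?n (c * d) x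
        - 2 * c * (?n (c * d) x * x) + 2 * c * (?n 0 x * x) = ?n 0 x * (exp (c * x - c\<^sup>2 * d / 2) - 1 - c * x)\<^sup>2"
      unfolding a b e_def[symmetric] by (simp add: power2_eq_square algebra_simps)
  qed
  finally have h: "has_bochner_integral lborel (\<lambda>x. ?n 0 x * (exp (c * x - c\<^sup>2 * d / 2) - 1 - c * x)\<^sup>2)
      (exp (c\<^sup>2 * d) - 1 - c\<^sup>2 * d)" by (simp add: power2_eq_square algebra_simps)
  have "(\<integral>\<^sup>+x. ennreal (?n 0 x) * ennreal ((exp (c * x - c\<^sup>2 * d / 2) - 1 - c * x)\<^sup>2) \<partial>lborel)
     = (\<integral>\<^sup>+x. ennreal (?n 0 x * (exp (c * x - c\<^sup>2 * d / 2) - 1 - c * x)\<^sup>2) \<partial>lborel)"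
    by (simp add: ennreal_mult)
  also have "\<dots> = ennreal (exp (c\<^sup>2 * d) - 1 - c\<^sup>2 * d)"
    using h by (subst nn_integral_eq_integral) (auto simp: has_bochner_integral_iff)
  finally show ?thesis .
qed

lemma (in finite_measure) bounded_L2_lim:
  assumes f: "\<And>n. f n \<in> borel_measurable M" "\<And>n x. x \<in> space M \<Longrightarrow> \<bar>f n x\<bar> \<le> K"
    and g: "g \<in> borel_measurable M" and lim: "\<And>x. x \<in> space M \<Longrightarrow> (\<lambda>n. f n x) \<longlonglongrightarrow> g x"
  shows "L2_lim M f g"
proof -
  have gb: "\<bar>g x\<bar> \<le> K" if "x \<in> space M" for x
    using tendsto_rabs[OF lim[OF that]] by (rule LIMSEQ_le_const2) (use f(2)[OF that] in auto)
  have "(\<lambda>n. \<integral>x. (f n x - g x)\<^sup>2 \<partial>M) \<longlonglongrightarrow> (\<integral>x. 0 \<partial>M)"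
  proof (rule integral_dominated_convergence[where w="\<lambda>_. (2 * K)\<^sup>2"])
    show "AE x in M. (\<lambda>n. (f n x - g x)\<^sup>2) \<longlonglongrightarrow> 0"
    proof (rule AE_I2)
      fix x assume "x \<in> space M"
      from tendsto_power[OF tendsto_diff[OF lim[OF this] tendsto_const[of "g x"]], of 2]
      show "(\<lambda>n. (f n x - g x)\<^sup>2) \<longlonglongrightarrow> 0" by simp
    qed
    show "AE x in M. norm ((f n x - g x)\<^sup>2) \<le> (2 * K)\<^sup>2" for n
    proof (rule AE_I2)
      fix x assume x: "x \<in> space M"
      then have "\<bar>f n x - g x\<bar> \<le> \<bar>2 * K\<bar>" using f(2)[OF x, of n] gb[OF x] by linarith
      then show "norm ((f n x - g x)\<^sup>2) \<le> (2 * K)\<^sup>2" by (simp add: abs_le_square_iff)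
    qed
  qed (use f g in auto)
  then show ?thesis
    using square_integrable_bounded[OF f] square_integrable_bounded[OF g gb] by (simp add: L2_lim_def)
qed

context filtered_space
begin

text \<open>Conditional covariance of simultaneous increments given \<open>F s\<close>, in a form
  tested against \<open>g\<close>, so that coefficients known at the beginning of a cell can be
  carried along.\<close>

definition correlated :: "real \<Rightarrow> (real \<Rightarrow> 'a \<Rightarrow> real) \<Rightarrow> (real \<Rightarrow> 'a \<Rightarrow> real) \<Rightarrow> bool" where
  "correlated r B B' \<longleftrightarrow> (\<forall>s t g. 0 \<le> s \<and> s \<le> t \<and> g \<in> borel_measurable (F s) \<and> square_integrable M g \<longrightarrow>
     (\<integral>\<omega>. g \<omega> * (B t \<omega> - B s \<omega>) * (B' t \<omega> - B' s \<omega>) \<partial>M) = r * (t - s) * (\<integral>\<omega>. g \<omega> \<partial>M))"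

end

context brownian_space
begin

lemma correlated_self: "correlated 1 B B"
  unfolding correlated_def
proof (intro allI impI)
  fix s t g assume "0 \<le> s \<and> s \<le> t \<and> g \<in> borel_measurable (F s) \<and> square_integrable M g"
  then show "(\<integral>\<omega>. g \<omega> * (B t \<omega> - B s \<omega>) * (B t \<omega> - B s \<omega>) \<partial>M) = 1 * (t - s) * (\<integral>\<omega>. g \<omega> \<partial>M)"
    using increment_square(2)[of s t g] square_integrable_integrable[of g]
    by (simp add: power2_eq_square mult.assoc)
qed

text \<open>After freezing \<open>c\<close> and \<open>G\<close>, the weight turns one Gaussian
  density into another, which has total mass \<open>1\<close>. Working with nonnegative integrals
  permits an unbounded coefficient \<open>c\<close>.\<close>

lemma increment_exp_nn:
  assumes st: "0 \<le> s" "s \<le> t" and c: "c \<in> borel_measurable (F s)" and G: "G \<in> borel_measurable (F s)"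
  shows "(\<integral>\<^sup>+\<omega>. G \<omega> * ennreal (exp (c \<omega> * (B t \<omega> - B s \<omega>) - (c \<omega>)\<^sup>2 * (t - s) / 2)) \<partial>M) = (\<integral>\<^sup>+\<omega>. G \<omega> \<partial>M)"
proof (cases "s = t")
  case False
  then have st': "s < t" using st by simp
  note [measurable] = c G
  have "(\<integral>\<^sup>+\<omega>. G \<omega> * ennreal (exp (c \<omega> * (B t \<omega> - B s \<omega>) - (c \<omega>)\<^sup>2 * (t - s) / 2)) \<partial>M)
    = (\<integral>\<^sup>+\<omega>. (\<integral>\<^sup>+x. ennreal (normal_density 0 (sqrt (t - s)) x) *
        (G \<omega> * ennreal (exp (c \<omega> * x - (c \<omega>)\<^sup>2 * (t - s) / 2))) \<partial>lborel) \<partial>M)"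
    using increment_nn_integral[OF st(1) st', of "\<lambda>z. G (fst z) * ennreal (exp (c (fst z) * snd z - (c (fst z))\<^sup>2 * (t - s) / 2))"]
    by simp
  also have "\<dots> = (\<integral>\<^sup>+\<omega>. G \<omega> \<partial>M)"
  proof (intro nn_integral_cong)
    fix \<omega>
    have "(\<integral>\<^sup>+x. ennreal (normal_density 0 (sqrt (t - s)) x) * (G \<omega> * ennreal (exp (c \<omega> * x - (c \<omega>)\<^sup>2 * (t - s) / 2))) \<partial>lborel)
      = (\<integral>\<^sup>+x. G \<omega> * ennreal (normal_density (c \<omega> * (t - s)) (sqrt (t - s)) x) \<partial>lborel)"
      using st' by (intro nn_integral_cong)
        (simp add: normal_density_tilt[symmetric] ennreal_mult mult_ac)
    also have "\<dots> = G \<omega> * ennreal 1"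
      using st' by (subst nn_integral_cmult, simp, subst nn_integral_eq_integral) auto
    finally show "(\<integral>\<^sup>+x. ennreal (normal_density 0 (sqrt (t - s)) x) * (G \<omega> * ennreal (exp (c \<omega> * x - (c \<omega>)\<^sup>2 * (t - s) / 2))) \<partial>lborel)
      = G \<omega>" by simp
  qed
  finally show ?thesis .
qed simp

text \<open>The nonnegative version is applied to the positive and the negative part of
  \<open>g\<close> separately.\<close>

lemma increment_exp:
  assumes st: "0 \<le> s" "s \<le> t" and c: "c \<in> borel_measurable (F s)"
    and g: "g \<in> borel_measurable (F s)" "integrable M g"
  shows "integrable M (\<lambda>\<omega>. g \<omega> * exp (c \<omega> * (B t \<omega> - B s \<omega>) - (c \<omega>)\<^sup>2 * (t - s) / 2))"
    and "(\<integral>\<omega>. g \<omega> * exp (c \<omega> * (B t \<omega> - B s \<omega>) - (c \<omega>)\<^sup>2 * (t - s) / 2) \<partial>M) = (\<integral>\<omega>. g \<omega> \<partial>M)"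
proof -
  let ?e = "\<lambda>\<omega>. exp (c \<omega> * (B t \<omega> - B s \<omega>) - (c \<omega>)\<^sup>2 * (t - s) / 2)"
  note [measurable] = measurable_F[OF c] measurable_F[OF g(1)] B_measurable[OF st(1)]
    B_measurable[OF order_trans[OF st]]
  have nn: "(\<integral>\<^sup>+\<omega>. ennreal (h \<omega> * ?e \<omega>) \<partial>M) = (\<integral>\<^sup>+\<omega>. ennreal (h \<omega>) \<partial>M)"
    if "h \<in> borel_measurable (F s)" "\<And>\<omega>. 0 \<le> h \<omega>" for h
    using increment_exp_nn[OF st c, of "\<lambda>\<omega>. ennreal (h \<omega>)"] that by (simp add: ennreal_mult)
  have pos: "integrable M (\<lambda>\<omega>. h \<omega> * ?e \<omega>) \<and> (\<integral>\<omega>. h \<omega> * ?e \<omega> \<partial>M) = (\<integral>\<omega>. h \<omega> \<partial>M)"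
    if h: "h \<in> borel_measurable (F s)" "\<And>\<omega>. 0 \<le> h \<omega>" "integrable M h" for h
  proof -
    have hM: "h \<in> borel_measurable M" using h(1) by (rule measurable_F)
    have "(\<integral>\<^sup>+\<omega>. ennreal (h \<omega>) \<partial>M) < \<infinity>" using h(2,3) by (simp add: nn_integral_eq_integral)
    then have 1: "integrable M (\<lambda>\<omega>. h \<omega> * ?e \<omega>)"
      using nn[OF h(1,2)] hM h(2) by (intro integrableI_bounded) (auto simp: abs_mult)
    then show ?thesis
      using nn[OF h(1,2)] h(2,3) hM by (auto simp: integral_eq_nn_integral)
  qed
  have p: "integrable M (\<lambda>\<omega>. max 0 (g \<omega>))" "integrable M (\<lambda>\<omega>. max 0 (- g \<omega>))"
    using g(2) by auto
  have split: "g \<omega> = max 0 (g \<omega>) - max 0 (- g \<omega>)" for \<omega> by (simp add: max_def)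
  have 1: "(\<lambda>\<omega>. g \<omega> * ?e \<omega>) = (\<lambda>\<omega>. max 0 (g \<omega>) * ?e \<omega> - max 0 (- g \<omega>) * ?e \<omega>)"
    using split by (auto simp: left_diff_distrib[symmetric])
  note P = pos[of "\<lambda>\<omega>. max 0 (g \<omega>)"] pos[of "\<lambda>\<omega>. max 0 (- g \<omega>)"]
  show "integrable M (\<lambda>\<omega>. g \<omega> * ?e \<omega>)" unfolding 1 using P p g(1) by auto
  have "(\<integral>\<omega>. g \<omega> * ?e \<omega> \<partial>M) = (\<integral>\<omega>. max 0 (g \<omega>) \<partial>M) - (\<integral>\<omega>. max 0 (- g \<omega>) \<partial>M)"
    unfolding 1 using P p g(1) by auto
  also have "\<dots> = (\<integral>\<omega>. max 0 (g \<omega>) - max 0 (- g \<omega>) \<partial>M)" using p by simp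
  finally show "(\<integral>\<omega>. g \<omega> * ?e \<omega> \<partial>M) = (\<integral>\<omega>. g \<omega> \<partial>M)" unfolding split[symmetric] .
qed

text \<open>\<open>R\<close> is the exponential weight without its expansion of first order in the
  increment. Given \<open>F s\<close>, its second moment is \<open>exp x - 1 - x\<close> with
  \<open>x = c\<^sup>2 * (t - s)\<close>, which is at most \<open>x\<^sup>2\<close> for
  \<open>0 \<le> x \<le> 1\<close>; so \<open>R\<close> is of the order of the cell length in
  L2.\<close>

lemma increment_exp_remainder:
  assumes st: "0 \<le> s" "s < t" and c: "c \<in> borel_measurable (F s)" "\<And>\<omega>. \<omega> \<in> space M \<Longrightarrow> \<bar>c \<omega>\<bar> \<le> C"
    and G: "G \<in> borel_measurable (F s)" "square_integrable M G" and small: "C\<^sup>2 * (t - s) \<le> 1"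
  defines "R \<equiv> \<lambda>\<omega>. exp (c \<omega> * (B t \<omega> - B s \<omega>) - (c \<omega>)\<^sup>2 * (t - s) / 2) - 1 - c \<omega> * (B t \<omega> - B s \<omega>)"
  shows "square_integrable M (\<lambda>\<omega>. G \<omega> * R \<omega>)"
    and "(\<integral>\<omega>. (G \<omega> * R \<omega>)\<^sup>2 \<partial>M) \<le> (C\<^sup>2 * (t - s))\<^sup>2 * (\<integral>\<omega>. (G \<omega>)\<^sup>2 \<partial>M)"
proof -
  note [measurable] = c(1) G(1)
  have "(\<integral>\<^sup>+\<omega>. ennreal ((G \<omega>)\<^sup>2) * ennreal ((R \<omega>)\<^sup>2) \<partial>M) =
     (\<integral>\<^sup>+\<omega>. (\<integral>\<^sup>+x. ennreal (normal_density 0 (sqrt (t - s)) x) *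
        (ennreal ((G \<omega>)\<^sup>2) * ennreal ((exp (c \<omega> * x - (c \<omega>)\<^sup>2 * (t - s) / 2) - 1 - c \<omega> * x)\<^sup>2)) \<partial>lborel) \<partial>M)"
    unfolding R_def
    using increment_nn_integral[OF st, of "\<lambda>z. ennreal ((G (fst z))\<^sup>2) *
       ennreal ((exp (c (fst z) * snd z - (c (fst z))\<^sup>2 * (t - s) / 2) - 1 - c (fst z) * snd z)\<^sup>2)"]
    by simp
  also have "\<dots> = (\<integral>\<^sup>+\<omega>. ennreal ((G \<omega>)\<^sup>2) * ennreal (exp ((c \<omega>)\<^sup>2 * (t - s)) - 1 - (c \<omega>)\<^sup>2 * (t - s)) \<partial>M)"
  proof (intro nn_integral_cong)
    fix \<omega>
    have "(\<integral>\<^sup>+x. ennreal (normal_density 0 (sqrt (t - s)) x) *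
        (ennreal ((G \<omega>)\<^sup>2) * ennreal ((exp (c \<omega> * x - (c \<omega>)\<^sup>2 * (t - s) / 2) - 1 - c \<omega> * x)\<^sup>2)) \<partial>lborel)
      = (\<integral>\<^sup>+x. ennreal ((G \<omega>)\<^sup>2) * (ennreal (normal_density 0 (sqrt (t - s)) x) *
        ennreal ((exp (c \<omega> * x - (c \<omega>)\<^sup>2 * (t - s) / 2) - 1 - c \<omega> * x)\<^sup>2)) \<partial>lborel)"
      by (intro nn_integral_cong) (simp add: mult_ac)
    also have "\<dots> = ennreal ((G \<omega>)\<^sup>2) * ennreal (exp ((c \<omega>)\<^sup>2 * (t - s)) - 1 - (c \<omega>)\<^sup>2 * (t - s))"
      using st by (subst nn_integral_cmult) (auto simp: normal_density_exp_remainder)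
    finally show "(\<integral>\<^sup>+x. ennreal (normal_density 0 (sqrt (t - s)) x) *
        (ennreal ((G \<omega>)\<^sup>2) * ennreal ((exp (c \<omega> * x - (c \<omega>)\<^sup>2 * (t - s) / 2) - 1 - c \<omega> * x)\<^sup>2)) \<partial>lborel)
      = ennreal ((G \<omega>)\<^sup>2) * ennreal (exp ((c \<omega>)\<^sup>2 * (t - s)) - 1 - (c \<omega>)\<^sup>2 * (t - s))" .
  qed
  also have "\<dots> \<le> (\<integral>\<^sup>+\<omega>. ennreal ((C\<^sup>2 * (t - s))\<^sup>2 * (G \<omega>)\<^sup>2) \<partial>M)"
  proof (intro nn_integral_mono)
    fix \<omega> assume \<omega>: "\<omega> \<in> space M"
    define x where "x = (c \<omega>)\<^sup>2 * (t - s)"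
    have "(c \<omega>)\<^sup>2 \<le> C\<^sup>2" using c(2)[OF \<omega>] by (simp add: abs_le_square_iff[symmetric])
    then have x: "0 \<le> x" "x \<le> C\<^sup>2 * (t - s)" using st unfolding x_def by (auto intro: mult_right_mono)
    have "exp x - 1 - x \<le> x\<^sup>2" using exp_bound[of x] x small by simp
    also have "\<dots> \<le> (C\<^sup>2 * (t - s))\<^sup>2" using x by (intro power_mono)
    finally have "(G \<omega>)\<^sup>2 * (exp x - 1 - x) \<le> (G \<omega>)\<^sup>2 * (C\<^sup>2 * (t - s))\<^sup>2" by (intro mult_left_mono) auto
    moreover have "0 \<le> exp x - 1 - x" using exp_ge_add_one_self[of x] by linarith
    ultimately show "ennreal ((G \<omega>)\<^sup>2) * ennreal (exp ((c \<omega>)\<^sup>2 * (t - s)) - 1 - (c \<omega>)\<^sup>2 * (t - s))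
       \<le> ennreal ((C\<^sup>2 * (t - s))\<^sup>2 * (G \<omega>)\<^sup>2)"
      unfolding x_def[symmetric] by (subst ennreal_mult[symmetric]) (auto intro!: ennreal_leI simp: mult.commute)
  qed
  also have "\<dots> = ennreal ((C\<^sup>2 * (t - s))\<^sup>2 * (\<integral>\<omega>. (G \<omega>)\<^sup>2 \<partial>M))"
    using square_integrable_imp[OF G(2)] by (subst nn_integral_eq_integral) auto
  finally have le: "(\<integral>\<^sup>+\<omega>. ennreal ((G \<omega> * R \<omega>)\<^sup>2) \<partial>M) \<le> ennreal ((C\<^sup>2 * (t - s))\<^sup>2 * (\<integral>\<omega>. (G \<omega>)\<^sup>2 \<partial>M))"
    by (simp add: power_mult_distrib ennreal_mult)
  note [measurable] = measurable_F[OF c(1)] measurable_F[OF G(1)] B_measurable[OF st(1)]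
    B_measurable[OF order_trans[OF st(1) less_imp_le[OF st(2)]]]
  have m: "(\<lambda>\<omega>. G \<omega> * R \<omega>) \<in> borel_measurable M" unfolding R_def by measurable
  have i: "integrable M (\<lambda>\<omega>. (G \<omega> * R \<omega>)\<^sup>2)"
    using m le by (intro integrableI_bounded) (auto simp: order.strict_trans1)
  show "square_integrable M (\<lambda>\<omega>. G \<omega> * R \<omega>)" using m i by (simp add: square_integrable_def)
  show "(\<integral>\<omega>. (G \<omega> * R \<omega>)\<^sup>2 \<partial>M) \<le> (C\<^sup>2 * (t - s))\<^sup>2 * (\<integral>\<omega>. (G \<omega>)\<^sup>2 \<partial>M)"
    using le i by (subst (asm) nn_integral_eq_integral) (auto simp: ennreal_le_iff)
qed

section \<open>Stochastic exponentials on grids and their limit\<close>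

definition exp_sum :: "(real \<Rightarrow> 'a \<Rightarrow> real) \<Rightarrow> real \<Rightarrow> real \<Rightarrow> nat \<Rightarrow> nat \<Rightarrow> 'a \<Rightarrow> real" where
  "exp_sum H s t n m \<omega> = exp (\<Sum>i<m. H (grid s t n i) \<omega> * (B (grid s t n (Suc i)) \<omega> - B (grid s t n i) \<omega>) -
     (H (grid s t n i) \<omega>)\<^sup>2 * (grid s t n (Suc i) - grid s t n i) / 2)"

text \<open>The stochastic exponential of \<open>X\<close> between \<open>s\<close> and
  \<open>t\<close>, written with the quadratic variation of the integral of \<open>H\<close>; the
  limit of \<open>exp_sum\<close> over all cells of the grid.\<close>

definition exp_density :: "(real \<Rightarrow> 'a \<Rightarrow> real) \<Rightarrow> (real \<Rightarrow> 'a \<Rightarrow> real) \<Rightarrow> real \<Rightarrow> real \<Rightarrow> 'a \<Rightarrow> real" where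
  "exp_density H X s t \<omega> = exp (X t \<omega> - X s \<omega> - time_integral (\<lambda>u \<omega>. H u \<omega> * H u \<omega>) s t \<omega> / 2)"

lemma exp_sum_Suc:
  "exp_sum H s t n (Suc m) \<omega> = exp_sum H s t n m \<omega> *
     exp (H (grid s t n m) \<omega> * (B (grid s t n (Suc m)) \<omega> - B (grid s t n m) \<omega>) -
       (H (grid s t n m) \<omega>)\<^sup>2 * (grid s t n (Suc m) - grid s t n m) / 2)"
  by (simp add: exp_sum_def exp_add[symmetric])

lemma exp_sum_measurable:
  assumes H: "\<And>u. 0 \<le> u \<Longrightarrow> H u \<in> borel_measurable (F u)" and st: "0 \<le> s" "s \<le> t"
  shows "exp_sum H s t n m \<in> borel_measurable (F (grid s t n m))"
proof -
  have "(\<lambda>\<omega>. \<Sum>i<m. H (grid s t n i) \<omega> * (B (grid s t n (Suc i)) \<omega> - B (grid s t n i) \<omega>) -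
     (H (grid s t n i) \<omega>)\<^sup>2 * (grid s t n (Suc i) - grid s t n i) / 2) \<in> borel_measurable (F (grid s t n m))"
  proof (rule borel_measurable_sum)
    fix i assume "i \<in> {..<m}"
    then have g: "0 \<le> grid s t n i" "0 \<le> grid s t n (Suc i)" "grid s t n i \<le> grid s t n m" "grid s t n (Suc i) \<le> grid s t n m"
      using grid_ge[OF st(2), of n] st grid_mono[OF st(2), of _ m n] by (auto intro: order_trans)
    have "H (grid s t n i) \<in> borel_measurable (F (grid s t n m))"
      using measurable_F_mono[OF H[OF g(1)] g(3)] .
    then show "(\<lambda>\<omega>. H (grid s t n i) \<omega> * (B (grid s t n (Suc i)) \<omega> - B (grid s t n i) \<omega>) -
     (H (grid s t n i) \<omega>)\<^sup>2 * (grid s t n (Suc i) - grid s t n i) / 2) \<in> borel_measurable (F (grid s t n m))"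
      using B_measurable_F'[OF g(1,3)] B_measurable_F'[OF g(2,4)] by measurable
  qed
  then show ?thesis unfolding exp_sum_def[abs_def] by measurable
qed

text \<open>The cells are peeled off from the last one: given the past of that cell, its exponential
  factor has mean \<open>1\<close>.\<close>

lemma exp_sum_mean:
  assumes H: "\<And>u. 0 \<le> u \<Longrightarrow> H u \<in> borel_measurable (F u)" and st: "0 \<le> s" "s \<le> t"
    and g: "g \<in> borel_measurable (F s)" "integrable M g"
  shows "integrable M (\<lambda>\<omega>. g \<omega> * exp_sum H s t n m \<omega>) \<and> (\<integral>\<omega>. g \<omega> * exp_sum H s t n m \<omega> \<partial>M) = (\<integral>\<omega>. g \<omega> \<partial>M)"
proof (induction m)
  case 0
  then show ?case using g by (simp add: exp_sum_def)
next
  case (Suc m)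
  have gr: "0 \<le> grid s t n m" "s \<le> grid s t n m" "grid s t n m \<le> grid s t n (Suc m)"
    using grid_ge[OF st(2), of n m] st grid_mono[OF st(2), of m "Suc m" n] by auto
  have m: "(\<lambda>\<omega>. g \<omega> * exp_sum H s t n m \<omega>) \<in> borel_measurable (F (grid s t n m))"
    using measurable_F_mono[OF g(1) gr(2)] exp_sum_measurable[OF H st] by simp
  show ?case
    unfolding exp_sum_Suc mult.assoc[symmetric]
    using increment_exp[OF gr(1,3) H[OF gr(1)] m] Suc.IH by simp
qed

text \<open>The \<open>p\<close>-th power of the exponential for \<open>H\<close> is the exponential
  for \<open>p * H\<close>, which has mean \<open>1\<close>, times \<open>exp\<close> of
  \<open>(p\<^sup>2 - p) / 2\<close> times the quadratic variation. The boundedness of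
  \<open>H\<close> controls the latter uniformly in the grid.\<close>

lemma exp_sum_power:
  assumes H: "regular_integrand C H" and st: "0 \<le> s" "s \<le> t" and m: "m \<le> Suc n"
  shows "integrable M (\<lambda>\<omega>. (exp_sum H s t n m \<omega>) ^ p)"
    and "(\<integral>\<omega>. (exp_sum H s t n m \<omega>) ^ p \<partial>M) \<le> exp (C\<^sup>2 * (t - s) * (real p)\<^sup>2 / 2)"
proof -
  let ?K = "exp (C\<^sup>2 * (t - s) * (real p)\<^sup>2 / 2)"
  let ?pH = "\<lambda>u \<omega>. real p * H u \<omega>"
  have HF: "H u \<in> borel_measurable (F u)" if "0 \<le> u" for u by (rule regular_measurable[OF H that])
  have pHF: "?pH u \<in> borel_measurable (F u)" if "0 \<le> u" for u using HF[OF that] by simp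
  have mean: "integrable M (exp_sum ?pH s t n m)" "(\<integral>\<omega>. exp_sum ?pH s t n m \<omega> \<partial>M) = 1"
  proof -
    have "integrable M (\<lambda>\<omega>. 1 * exp_sum ?pH s t n m \<omega>) \<and> (\<integral>\<omega>. 1 * exp_sum ?pH s t n m \<omega> \<partial>M) = (\<integral>\<omega>. 1 \<partial>M)"
      by (rule exp_sum_mean[OF pHF st]) auto
    then show "integrable M (exp_sum ?pH s t n m)" "(\<integral>\<omega>. exp_sum ?pH s t n m \<omega> \<partial>M) = 1"
      by (simp_all only: mult_1_left lebesgue_integral_const prob_space scaleR_one)
  qed
  have le: "(exp_sum H s t n m \<omega>) ^ p \<le> ?K * exp_sum ?pH s t n m \<omega>" if \<omega>: "\<omega> \<in> space M" for \<omega>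
  proof -
    define h where "h i = H (grid s t n i) \<omega>" for i
    define b where "b i = B (grid s t n (Suc i)) \<omega> - B (grid s t n i) \<omega>" for i
    define d where "d = (t - s) / real (Suc n)"
    have d: "0 \<le> d" using st by (simp add: d_def)
    have "(\<Sum>i<m. (h i)\<^sup>2 * d) \<le> (\<Sum>i<m. C\<^sup>2 * d)"
    proof (intro sum_mono mult_right_mono d)
      fix i
      have "0 \<le> grid s t n i" using grid_ge[OF st(2), of n i] st by simp
      from regular_bound[OF H this \<omega>] show "(h i)\<^sup>2 \<le> C\<^sup>2" by (simp add: h_def abs_le_square_iff[symmetric])
    qed
    also have "\<dots> = real m * (C\<^sup>2 * d)" by simp
    also have "\<dots> \<le> real (Suc n) * (C\<^sup>2 * d)" using m d by (intro mult_right_mono) auto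
    also have "\<dots> = C\<^sup>2 * (t - s)" by (simp add: d_def)
    finally have q: "(\<Sum>i<m. (h i)\<^sup>2 * d) \<le> C\<^sup>2 * (t - s)" .
    have "(exp_sum H s t n m \<omega>) ^ p = exp (real p * (\<Sum>i<m. h i * b i - (h i)\<^sup>2 * d / 2))"
      unfolding exp_sum_def grid_diff exp_of_nat_mult[symmetric] h_def b_def d_def ..
    also have "real p * (\<Sum>i<m. h i * b i - (h i)\<^sup>2 * d / 2)
       = (\<Sum>i<m. (real p * h i) * b i - (real p * h i)\<^sup>2 * d / 2) + ((real p)\<^sup>2 - real p) / 2 * (\<Sum>i<m. (h i)\<^sup>2 * d)"
      unfolding sum_distrib_left sum.distrib[symmetric]
      by (intro sum.cong refl) (simp add: power2_eq_square field_simps)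
    also have "((real p)\<^sup>2 - real p) / 2 * (\<Sum>i<m. (h i)\<^sup>2 * d) \<le> (real p)\<^sup>2 / 2 * (C\<^sup>2 * (t - s))"
      using q d by (intro mult_mono sum_nonneg) auto
    finally have "(exp_sum H s t n m \<omega>) ^ p \<le> exp ((\<Sum>i<m. (real p * h i) * b i - (real p * h i)\<^sup>2 * d / 2) + (real p)\<^sup>2 / 2 * (C\<^sup>2 * (t - s)))"
      by simp
    also have "\<dots> = ?K * exp_sum ?pH s t n m \<omega>"
      unfolding exp_sum_def grid_diff h_def b_def d_def by (simp add: exp_add[symmetric] mult_ac add.commute)
    finally show ?thesis .
  qed
  have mm: "(\<lambda>\<omega>. (exp_sum H s t n m \<omega>) ^ p) \<in> borel_measurable M"
    using measurable_F[OF exp_sum_measurable[OF HF st]] by simp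
  show i: "integrable M (\<lambda>\<omega>. (exp_sum H s t n m \<omega>) ^ p)"
  proof (rule Bochner_Integration.integrable_bound[OF _ mm])
    show "integrable M (\<lambda>\<omega>. ?K * exp_sum ?pH s t n m \<omega>)" using mean by simp
    show "AE \<omega> in M. norm ((exp_sum H s t n m \<omega>) ^ p) \<le> norm (?K * exp_sum ?pH s t n m \<omega>)"
      using le by (intro AE_I2) (auto simp: exp_sum_def abs_mult)
  qed
  have "(\<integral>\<omega>. (exp_sum H s t n m \<omega>) ^ p \<partial>M) \<le> (\<integral>\<omega>. ?K * exp_sum ?pH s t n m \<omega> \<partial>M)"
    using i mean le by (intro integral_mono) auto
  then show "(\<integral>\<omega>. (exp_sum H s t n m \<omega>) ^ p \<partial>M) \<le> ?K" using mean by simp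
qed

lemma exp_sum_full:
  "exp_sum H s t n (Suc n) \<omega> = exp (riemann_sum B H s t n \<omega>
     - (\<Sum>i<Suc n. (H (grid s t n i) \<omega> * H (grid s t n i) \<omega>) * ((t - s) / real (Suc n))) / 2)"
  unfolding exp_sum_def riemann_sum_def grid_diff sum_subtractf sum_divide_distrib power2_eq_square ..

text \<open>The Riemann sums converge almost everywhere only along a subsequence, so the
  exponentials do too. Their fourth moments are bounded uniformly, the limit inherits the bound by
  Fatou, and bounded fourth moments upgrade almost sure convergence to L2.\<close>

lemma exp_density_L2_subseq:
  assumes X: "regular_ito C H X" and st: "0 \<le> s" "s \<le> t"
  obtains r :: "nat \<Rightarrow> nat" where "strict_mono r"
    "L2_lim M (\<lambda>n. exp_sum H s t (r n) (Suc (r n))) (exp_density H X s t)"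
proof -
  note H = regular_ito_integrand[OF X]
  note H2 = regular_mult[OF H H]
  obtain r :: "nat \<Rightarrow> nat" where r: "strict_mono r"
    "AE \<omega> in M. (\<lambda>n. riemann_sum B H s t (r n) \<omega>) \<longlonglongrightarrow> X t \<omega> - X s \<omega>"
    using L2_lim_AE_subseq[OF regular_ito_lim[OF X st]] by blast
  define E where "E n = exp_sum H s t (r n) (Suc (r n))" for n
  define D where "D = exp_density H X s t"
  have lim: "AE \<omega> in M. (\<lambda>n. E n \<omega>) \<longlonglongrightarrow> D \<omega>"
    using r(2) AE_space
  proof eventually_elim
    case (elim \<omega>)
    have "(\<lambda>n. \<Sum>i<Suc (r n). (H (grid s t (r n) i) \<omega> * H (grid s t (r n) i) \<omega>) * ((t - s) / real (Suc (r n))))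
       \<longlonglongrightarrow> time_integral (\<lambda>u \<omega>. H u \<omega> * H u \<omega>) s t \<omega>"
      using LIMSEQ_subseq_LIMSEQ[OF step_sum_tendsto[OF H2 st elim(2)] r(1)] unfolding o_def .
    then show ?case unfolding E_def D_def exp_sum_full exp_density_def
      using elim(1) by (intro tendsto_exp tendsto_diff tendsto_divide tendsto_const) auto
  qed
  have "0 \<le> t" using st by simp
  have Xm: "X t \<in> borel_measurable M" "X s \<in> borel_measurable M"
    using regular_ito_measurable[OF X] st \<open>0 \<le> t\<close> measurable_F by blast+
  have Dm[measurable]: "D \<in> borel_measurable M"
    unfolding D_def exp_density_def[abs_def] using Xm measurable_F[OF time_integral_measurable[OF H2 st]] by measurable
  have Em[measurable]: "E n \<in> borel_measurable M" for n
    unfolding E_def using measurable_F[OF exp_sum_measurable[OF regular_measurable[OF H] st]] by simp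
  let ?K = "exp (C\<^sup>2 * (t - s) * (real 4)\<^sup>2 / 2)"
  have E4: "integrable M (\<lambda>\<omega>. (E n \<omega>) ^ 4)" "(\<integral>\<omega>. (E n \<omega>) ^ 4 \<partial>M) \<le> ?K" for n
    unfolding E_def using exp_sum_power[OF H st, of _ _ 4] by auto
  have E2: "square_integrable M (E n)" for n
    unfolding E_def square_integrable_def using exp_sum_power(1)[OF H st, of _ _ 2] Em[of n, unfolded E_def] by auto
  have "(\<integral>\<^sup>+\<omega>. ennreal ((D \<omega>) ^ 4) \<partial>M) = (\<integral>\<^sup>+\<omega>. liminf (\<lambda>n. ennreal ((E n \<omega>) ^ 4)) \<partial>M)"
  proof (rule nn_integral_cong_AE)
    show "AE \<omega> in M. ennreal ((D \<omega>) ^ 4) = liminf (\<lambda>n. ennreal ((E n \<omega>) ^ 4))"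
      using lim
    proof eventually_elim
      case (elim \<omega>)
      have "(\<lambda>n. ennreal ((E n \<omega>) ^ 4)) \<longlonglongrightarrow> ennreal ((D \<omega>) ^ 4)"
        by (intro tendsto_ennrealI tendsto_power elim)
      then show ?case using lim_imp_Liminf by (metis trivial_limit_sequentially)
    qed
  qed
  also have "\<dots> \<le> liminf (\<lambda>n. \<integral>\<^sup>+\<omega>. ennreal ((E n \<omega>) ^ 4) \<partial>M)"
    by (rule nn_integral_liminf) simp
  also have "\<dots> \<le> liminf (\<lambda>n::nat. ennreal ?K)"
  proof (intro Liminf_mono always_eventually allI)
    fix n
    have "(\<integral>\<^sup>+\<omega>. ennreal ((E n \<omega>) ^ 4) \<partial>M) = ennreal (\<integral>\<omega>. (E n \<omega>) ^ 4 \<partial>M)"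
      using E4(1) by (intro nn_integral_eq_integral) auto
    then show "(\<integral>\<^sup>+\<omega>. ennreal ((E n \<omega>) ^ 4) \<partial>M) \<le> ennreal ?K" using E4(2)[of n] by (simp add: ennreal_leI)
  qed
  also have "\<dots> = ennreal ?K" by (simp add: Liminf_const)
  finally have D4n: "(\<integral>\<^sup>+\<omega>. ennreal ((D \<omega>) ^ 4) \<partial>M) \<le> ennreal ?K" .
  have D4: "integrable M (\<lambda>\<omega>. (D \<omega>) ^ 4)"
    using D4n by (intro integrableI_bounded) (auto simp: order.strict_trans1)
  have D4': "(\<integral>\<omega>. (D \<omega>) ^ 4 \<partial>M) \<le> ?K"
    using D4n D4 by (subst (asm) nn_integral_eq_integral) auto
  have D2: "square_integrable M D"
    unfolding square_integrable_def
  proof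
    show "integrable M (\<lambda>\<omega>. (D \<omega>)\<^sup>2)"
    proof (rule Bochner_Integration.integrable_bound)
      show "integrable M (\<lambda>\<omega>. 1 + (D \<omega>) ^ 4)" using D4 by simp
      have "x\<^sup>2 \<le> 1 + x ^ 4" for x :: real
      proof -
        have "2 * x\<^sup>2 \<le> x ^ 4 + 1" using sum_squares_bound[of "x\<^sup>2" 1] by simp
        then show ?thesis using zero_le_power2[of x] by linarith
      qed
      then show "AE \<omega> in M. norm ((D \<omega>)\<^sup>2) \<le> norm (1 + (D \<omega>) ^ 4)" by (intro AE_I2) (auto intro!: order_trans[OF _ abs_ge_self])
    qed simp
  qed simp
  have fourth: "(a - b) ^ 4 \<le> 8 * a ^ 4 + 8 * (b::real) ^ 4" for a b
  proof -
    have "((a - b)\<^sup>2)\<^sup>2 \<le> (2 * a\<^sup>2 + 2 * b\<^sup>2)\<^sup>2" by (intro power_mono square_diff_le) auto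
    also have "\<dots> = (2 * a\<^sup>2 - (- 2 * b\<^sup>2))\<^sup>2" by simp
    also have "\<dots> \<le> 2 * (2 * a\<^sup>2)\<^sup>2 + 2 * (- 2 * b\<^sup>2)\<^sup>2" by (rule square_diff_le)
    finally show ?thesis by (simp add: power_mult_distrib)
  qed
  have ED4: "integrable M (\<lambda>\<omega>. (E n \<omega> - D \<omega>) ^ 4)" for n
  proof (rule Bochner_Integration.integrable_bound)
    show "integrable M (\<lambda>\<omega>. 8 * (E n \<omega>) ^ 4 + 8 * (D \<omega>) ^ 4)" using E4 D4 by simp
    show "AE \<omega> in M. norm ((E n \<omega> - D \<omega>) ^ 4) \<le> norm (8 * (E n \<omega>) ^ 4 + 8 * (D \<omega>) ^ 4)"
    proof (rule AE_I2)
      fix \<omega>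
      show "norm ((E n \<omega> - D \<omega>) ^ 4) \<le> norm (8 * (E n \<omega>) ^ 4 + 8 * (D \<omega>) ^ 4)"
        using fourth[of "E n \<omega>" "D \<omega>"] zero_le_even_power[of 4 "E n \<omega> - D \<omega>"] unfolding real_norm_def by simp
    qed
  qed simp
  \<comment> \<open>The criterion is applied to the squared errors, whose second moments are fourth
    moments; the factor \<open>16\<close> is the sum of the two weights \<open>8\<close> in
    \<open>fourth\<close>.\<close>
  have "(\<lambda>n. \<integral>\<omega>. (E n \<omega> - D \<omega>)\<^sup>2 \<partial>M) \<longlonglongrightarrow> 0"
  proof (rule integral_tendsto_zero_of_L2_bounded)
    show "square_integrable M (\<lambda>\<omega>. (E n \<omega> - D \<omega>)\<^sup>2)" for n
      using ED4[of n] by (simp add: square_integrable_def)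
    show "AE \<omega> in M. (\<lambda>n. (E n \<omega> - D \<omega>)\<^sup>2) \<longlonglongrightarrow> 0"
      using lim
    proof eventually_elim
      case (elim \<omega>)
      from tendsto_power[OF tendsto_diff[OF elim tendsto_const[of "D \<omega>"]], of 2]
      show ?case by simp
    qed
    show "(\<integral>\<omega>. ((E n \<omega> - D \<omega>)\<^sup>2)\<^sup>2 \<partial>M) \<le> 16 * ?K" for n
    proof -
      have "(\<integral>\<omega>. (E n \<omega> - D \<omega>) ^ 4 \<partial>M) \<le> (\<integral>\<omega>. 8 * (E n \<omega>) ^ 4 + 8 * (D \<omega>) ^ 4 \<partial>M)"
        using ED4 E4 D4 fourth by (intro integral_mono) auto
      also have "\<dots> = 8 * (\<integral>\<omega>. (E n \<omega>) ^ 4 \<partial>M) + 8 * (\<integral>\<omega>. (D \<omega>) ^ 4 \<partial>M)" using E4 D4 by simp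
      also have "\<dots> \<le> 8 * ?K + 8 * ?K" by (intro add_mono mult_left_mono E4 D4') auto
      finally show ?thesis by simp
    qed
  qed simp
  then show ?thesis using that[OF r(1)] E2 D2 unfolding E_def D_def L2_lim_def by blast
qed

lemma exp_density_square_integrable:
  assumes X: "regular_ito C H X" and st: "0 \<le> s" "s \<le> t"
  shows "square_integrable M (exp_density H X s t)"
  using exp_density_L2_subseq[OF X st] by (metis L2_lim_def)

lemma exp_density_measurable:
  assumes X: "regular_ito C H X" and st: "0 \<le> s" "s \<le> t"
  shows "exp_density H X s t \<in> borel_measurable (F t)"
proof -
  note H = regular_ito_integrand[OF X]
  have "0 \<le> t" using st by simp
  have "X t \<in> borel_measurable (F t)" "X s \<in> borel_measurable (F t)"
    using regular_ito_measurable[OF X \<open>0 \<le> t\<close>] measurable_F_mono[OF regular_ito_measurable[OF X st(1)] st(2)] by auto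
  then show ?thesis
    unfolding exp_density_def[abs_def] using time_integral_measurable[OF regular_mult[OF H H] st] by measurable
qed

lemma exp_density_mult:
  assumes X: "regular_ito C H X" and st: "0 \<le> s" "s \<le> t" "t \<le> v" and \<omega>: "\<omega> \<in> space M"
  shows "exp_density H X s v \<omega> = exp_density H X s t \<omega> * exp_density H X t v \<omega>"
  using time_integral_add[OF regular_mult[OF regular_ito_integrand[OF X] regular_ito_integrand[OF X]] st \<omega>]
  by (simp add: exp_density_def exp_add[symmetric] add_divide_distrib)

lemma exp_density_mean:
  assumes X: "regular_ito C H X" and st: "0 \<le> s" "s \<le> t"
    and g: "g \<in> borel_measurable (F s)" "square_integrable M g"
  shows "(\<integral>\<omega>. g \<omega> * exp_density H X s t \<omega> \<partial>M) = (\<integral>\<omega>. g \<omega> \<partial>M)"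
proof -
  obtain r :: "nat \<Rightarrow> nat" where r: "strict_mono r"
    "L2_lim M (\<lambda>n. exp_sum H s t (r n) (Suc (r n))) (exp_density H X s t)"
    using exp_density_L2_subseq[OF X st] by blast
  have "(\<lambda>n. \<integral>\<omega>. g \<omega> * exp_sum H s t (r n) (Suc (r n)) \<omega> \<partial>M) \<longlonglongrightarrow> (\<integral>\<omega>. g \<omega> * exp_density H X s t \<omega> \<partial>M)"
    by (rule L2_lim_inner[OF L2_lim_const[OF g(2)] r(2)])
  moreover have "(\<integral>\<omega>. g \<omega> * exp_sum H s t n m \<omega> \<partial>M) = (\<integral>\<omega>. g \<omega> \<partial>M)" for n m
    using exp_sum_mean[OF regular_measurable[OF regular_ito_integrand[OF X]] st g(1) square_integrable_integrable[OF g(2)]] by simp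
  ultimately show ?thesis using LIMSEQ_unique[OF tendsto_const] by fastforce
qed

text \<open>The density factorises at \<open>s\<close>, and its part after \<open>s\<close> has mean
  \<open>1\<close> against anything square integrable that is known at \<open>s\<close>.\<close>

lemma exp_density_martingale:
  assumes X: "regular_ito C H X" and st: "0 \<le> s" "s \<le> t"
    and g: "g \<in> borel_measurable (F s)" "\<And>\<omega>. \<omega> \<in> space M \<Longrightarrow> \<bar>g \<omega>\<bar> \<le> K"
  shows "(\<integral>\<omega>. g \<omega> * exp_density H X 0 t \<omega> \<partial>M) = (\<integral>\<omega>. g \<omega> * exp_density H X 0 s \<omega> \<partial>M)"
proof -
  have m: "(\<lambda>\<omega>. g \<omega> * exp_density H X 0 s \<omega>) \<in> borel_measurable (F s)"
    using g(1) exp_density_measurable[OF X order_refl st(1)] by simp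
  have i: "square_integrable M (\<lambda>\<omega>. g \<omega> * exp_density H X 0 s \<omega>)"
    by (rule square_integrable_mult_bounded[OF exp_density_square_integrable[OF X order_refl st(1)] measurable_F[OF g(1)] g(2)])
  have "(\<integral>\<omega>. g \<omega> * exp_density H X 0 t \<omega> \<partial>M) = (\<integral>\<omega>. (g \<omega> * exp_density H X 0 s \<omega>) * exp_density H X s t \<omega> \<partial>M)"
    using exp_density_mult[OF X order_refl st] by (intro Bochner_Integration.integral_cong) auto
  then show ?thesis using exp_density_mean[OF X st m i] by simp
qed

section \<open>Drift of an Ito integral under an exponential density\<close>

lemma correlated_exp_step:
  assumes B': "brownian_space M F B'" and cor: "correlated r B B'" and st: "0 \<le> s" "s < t"
    and c: "c \<in> borel_measurable (F s)" "\<And>\<omega>. \<omega> \<in> space M \<Longrightarrow> \<bar>c \<omega>\<bar> \<le> C"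
    and G: "G \<in> borel_measurable (F s)" "square_integrable M G" and small: "C\<^sup>2 * (t - s) \<le> 1"
  defines "e \<equiv> \<lambda>\<omega>. exp (c \<omega> * (B t \<omega> - B s \<omega>) - (c \<omega>)\<^sup>2 * (t - s) / 2)"
    and "D \<equiv> \<lambda>\<omega>. B' t \<omega> - B' s \<omega> - r * c \<omega> * (t - s)"
  shows "integrable M (\<lambda>\<omega>. G \<omega> * e \<omega> * D \<omega>)"
    and "\<bar>\<integral>\<omega>. G \<omega> * e \<omega> * D \<omega> \<partial>M\<bar> \<le>
      C\<^sup>2 * sqrt (\<integral>\<omega>. (G \<omega>)\<^sup>2 \<partial>M) * sqrt (2 * (1 + r\<^sup>2)) * ((t - s) * sqrt (t - s))"
proof -
  interpret B': brownian_space M F B' by (rule B')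
  define d where "d = t - s"
  have d: "0 < d" using st by (simp add: d_def)
  have st': "s \<le> t" using st by simp
  define b b' where "b \<omega> = B t \<omega> - B s \<omega>" and "b' \<omega> = B' t \<omega> - B' s \<omega>" for \<omega>
  define R where "R \<omega> = exp (c \<omega> * (B t \<omega> - B s \<omega>) - (c \<omega>)\<^sup>2 * (t - s) / 2) - 1 - c \<omega> * (B t \<omega> - B s \<omega>)" for \<omega>
  have GR: "square_integrable M (\<lambda>\<omega>. G \<omega> * R \<omega>)"
    "(\<integral>\<omega>. (G \<omega> * R \<omega>)\<^sup>2 \<partial>M) \<le> (C\<^sup>2 * d)\<^sup>2 * (\<integral>\<omega>. (G \<omega>)\<^sup>2 \<partial>M)"
    using increment_exp_remainder[OF st c G small] unfolding R_def d_def by auto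
  have cM: "c \<in> borel_measurable M" by (rule measurable_F[OF c(1)])
  have Gc: "square_integrable M (\<lambda>\<omega>. c \<omega> * G \<omega>)" "(\<lambda>\<omega>. c \<omega> * G \<omega>) \<in> borel_measurable (F s)"
    using square_integrable_mult_bounded[OF G(2) cM c(2)] c G by auto
  have Gcc: "square_integrable M (\<lambda>\<omega>. c \<omega> * (c \<omega> * G \<omega>))" "(\<lambda>\<omega>. c \<omega> * (c \<omega> * G \<omega>)) \<in> borel_measurable (F s)"
    using square_integrable_mult_bounded[OF Gc(1) cM c(2)] c G by auto
  have one: "(\<lambda>_. 1) \<in> borel_measurable (F s)" "square_integrable M (\<lambda>_. 1::real)"
    by (auto simp: square_integrable_def)
  have sb': "square_integrable M b'" "(\<integral>\<omega>. (b' \<omega>)\<^sup>2 \<partial>M) = d"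
    using B'.increment_square_integrable[OF st(1) st' one] unfolding b'_def d_def by (auto simp: prob_space)
  have sc: "square_integrable M c" by (rule square_integrable_bounded[OF cM c(2)])
  have D_eq: "D \<omega> = b' \<omega> - (r * d) * c \<omega>" for \<omega> by (simp add: D_def b'_def d_def)
  have sD: "square_integrable M D"
    unfolding D_eq[abs_def] by (intro square_integrable_diff square_integrable_cmult sb' sc)
  have "(\<integral>\<omega>. (D \<omega>)\<^sup>2 \<partial>M) \<le> (\<integral>\<omega>. 2 * (b' \<omega>)\<^sup>2 + 2 * (r\<^sup>2 * d) \<partial>M)"
  proof (intro integral_mono)
    show "integrable M (\<lambda>\<omega>. (D \<omega>)\<^sup>2)" "integrable M (\<lambda>\<omega>. 2 * (b' \<omega>)\<^sup>2 + 2 * (r\<^sup>2 * d))"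
      using square_integrable_imp[OF sD] square_integrable_imp[OF sb'(1)] by auto
    fix \<omega> assume \<omega>: "\<omega> \<in> space M"
    have "(c \<omega>)\<^sup>2 \<le> C\<^sup>2" using c(2)[OF \<omega>] by (simp add: abs_le_square_iff[symmetric])
    then have "(c \<omega>)\<^sup>2 * d \<le> C\<^sup>2 * d" using d by (intro mult_right_mono) auto
    also have "\<dots> \<le> 1" using small by (simp add: d_def)
    finally have "(r\<^sup>2 * d) * ((c \<omega>)\<^sup>2 * d) \<le> (r\<^sup>2 * d) * 1" using d by (intro mult_left_mono) auto
    then have "((r * d) * c \<omega>)\<^sup>2 \<le> r\<^sup>2 * d" by (simp add: power2_eq_square mult_ac)
    then show "(D \<omega>)\<^sup>2 \<le> 2 * (b' \<omega>)\<^sup>2 + 2 * (r\<^sup>2 * d)"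
      unfolding D_eq using square_diff_le[of "b' \<omega>" "(r * d) * c \<omega>"] by linarith
  qed
  also have "\<dots> = 2 * (1 + r\<^sup>2) * d"
    using square_integrable_imp[OF sb'(1)] sb'(2) by (simp add: prob_space algebra_simps)
  finally have D2: "(\<integral>\<omega>. (D \<omega>)\<^sup>2 \<partial>M) \<le> 2 * (1 + r\<^sup>2) * d" .
  have Gb: "square_integrable M (\<lambda>\<omega>. c \<omega> * G \<omega> * b \<omega>)"
    unfolding b_def by (rule increment_square_integrable(1)[OF st(1) st' Gc(2,1)])
  have i1: "integrable M (\<lambda>\<omega>. G \<omega> * b' \<omega>)" "(\<integral>\<omega>. G \<omega> * b' \<omega> \<partial>M) = 0"
    unfolding b'_def using B'.increment_mean[OF st(1) st' G(1) square_integrable_integrable[OF G(2)]] by auto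
  have i2: "integrable M (\<lambda>\<omega>. c \<omega> * G \<omega>)" by (rule square_integrable_integrable[OF Gc(1)])
  have i3: "integrable M (\<lambda>\<omega>. c \<omega> * G \<omega> * b \<omega> * b' \<omega>)" by (rule square_integrable_mult[OF Gb sb'(1)])
  have i3': "(\<integral>\<omega>. c \<omega> * G \<omega> * b \<omega> * b' \<omega> \<partial>M) = r * d * (\<integral>\<omega>. c \<omega> * G \<omega> \<partial>M)"
    unfolding b_def b'_def d_def using cor st(1) st' Gc by (simp add: correlated_def)
  have i4: "integrable M (\<lambda>\<omega>. c \<omega> * (c \<omega> * G \<omega>) * b \<omega>)" "(\<integral>\<omega>. c \<omega> * (c \<omega> * G \<omega>) * b \<omega> \<partial>M) = 0"
    unfolding b_def using increment_mean[OF st(1) st' Gcc(2) square_integrable_integrable[OF Gcc(1)]] by auto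
  have i5: "integrable M (\<lambda>\<omega>. (G \<omega> * R \<omega>) * D \<omega>)" by (rule square_integrable_mult[OF GR(1) sD])
  \<comment> \<open>Here \<open>e = 1 + c * b + R\<close>. In the product with
    \<open>D = b' - r * d * c\<close>, the terms \<open>G * b'\<close> and
    \<open>c * c * G * b\<close> are centred, and by the correlation \<open>c * G * b * b'\<close>
    cancels \<open>r * d * c * G\<close> in the mean. Only \<open>G * R * D\<close> is left, with
    \<open>G * R\<close> of order \<open>d\<close> and \<open>D\<close> of order
    \<open>sqrt d\<close> in L2.\<close>
  have eq: "G \<omega> * e \<omega> * D \<omega> = G \<omega> * b' \<omega> - (r * d) * (c \<omega> * G \<omega>) + c \<omega> * G \<omega> * b \<omega> * b' \<omega>
     - (r * d) * (c \<omega> * (c \<omega> * G \<omega>) * b \<omega>) + (G \<omega> * R \<omega>) * D \<omega>" for \<omega>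
  proof -
    have "e \<omega> = 1 + c \<omega> * b \<omega> + R \<omega>" by (simp add: e_def R_def b_def)
    then show ?thesis unfolding D_eq by (simp add: algebra_simps)
  qed
  show "integrable M (\<lambda>\<omega>. G \<omega> * e \<omega> * D \<omega>)"
    unfolding eq using i1 i2 i3 i4 i5 by auto
  have "(\<integral>\<omega>. G \<omega> * e \<omega> * D \<omega> \<partial>M) = 0 - (r * d) * (\<integral>\<omega>. c \<omega> * G \<omega> \<partial>M) + r * d * (\<integral>\<omega>. c \<omega> * G \<omega> \<partial>M)
     - (r * d) * 0 + (\<integral>\<omega>. (G \<omega> * R \<omega>) * D \<omega> \<partial>M)"
    unfolding eq using i1 i2 i3 i3' i4 i5 by simp
  also have "\<dots> = (\<integral>\<omega>. (G \<omega> * R \<omega>) * D \<omega> \<partial>M)" by simp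
  finally have "\<bar>\<integral>\<omega>. G \<omega> * e \<omega> * D \<omega> \<partial>M\<bar> \<le> sqrt (\<integral>\<omega>. (G \<omega> * R \<omega>)\<^sup>2 \<partial>M) * sqrt (\<integral>\<omega>. (D \<omega>)\<^sup>2 \<partial>M)"
    using Cauchy_Schwarz_integral[OF GR(1) sD] by simp
  also have "\<dots> \<le> sqrt ((C\<^sup>2 * d)\<^sup>2 * (\<integral>\<omega>. (G \<omega>)\<^sup>2 \<partial>M)) * sqrt (2 * (1 + r\<^sup>2) * d)"
    by (intro mult_mono real_sqrt_le_mono GR D2) auto
  also have "\<dots> = C\<^sup>2 * sqrt (\<integral>\<omega>. (G \<omega>)\<^sup>2 \<partial>M) * sqrt (2 * (1 + r\<^sup>2)) * (d * sqrt d)"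
    using d by (simp add: real_sqrt_mult)
  finally show "\<bar>\<integral>\<omega>. G \<omega> * e \<omega> * D \<omega> \<partial>M\<bar> \<le>
      C\<^sup>2 * sqrt (\<integral>\<omega>. (G \<omega>)\<^sup>2 \<partial>M) * sqrt (2 * (1 + r\<^sup>2)) * ((t - s) * sqrt (t - s))" by (simp add: d_def)
qed

text \<open>Passing from \<open>m\<close> to \<open>Suc m\<close> cells multiplies the old product
  by a factor of conditional mean \<open>1\<close> and adds a single new term with coefficient
  \<open>G = H' * exp_sum\<close>. That term is bounded by the one-step estimate, and the second
  moment of \<open>G\<close> is uniform over the cells.\<close>

lemma correlated_exp_sum:
  assumes B': "brownian_space M F B'" and cor: "correlated r B B'" and st: "0 \<le> s" "s < t"
    and H: "regular_integrand C H" and H': "regular_integrand C' H'"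
    and small: "C\<^sup>2 * ((t - s) / real (Suc n)) \<le> 1"
  defines "Y \<equiv> \<lambda>m \<omega>. \<Sum>i<m. H' (grid s t n i) \<omega> * (B' (grid s t n (Suc i)) \<omega> - B' (grid s t n i) \<omega>
       - r * H (grid s t n i) \<omega> * (grid s t n (Suc i) - grid s t n i))"
  shows "m \<le> Suc n \<Longrightarrow> \<bar>\<integral>\<omega>. exp_sum H s t n m \<omega> * Y m \<omega> \<partial>M\<bar> \<le>
    real m * (C\<^sup>2 * sqrt (C'\<^sup>2 * exp (C\<^sup>2 * (t - s) * 2)) * sqrt (2 * (1 + r\<^sup>2)) *
      ((t - s) / real (Suc n) * sqrt ((t - s) / real (Suc n))))"
proof -
  interpret B': brownian_space M F B' by (rule B')
  let ?g = "grid s t n"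
  let ?d = "(t - s) / real (Suc n)"
  let ?K = "C\<^sup>2 * sqrt (C'\<^sup>2 * exp (C\<^sup>2 * (t - s) * 2)) * sqrt (2 * (1 + r\<^sup>2)) * (?d * sqrt ?d)"
  have st': "s \<le> t" using st by simp
  have g: "0 \<le> ?g i" "?g i < ?g (Suc i)" "?g i \<le> ?g (Suc i)" for i
  proof -
    show "0 \<le> ?g i" using grid_ge[OF st', of n i] st by simp
    have "0 < ?d" using st by simp
    then show "?g i < ?g (Suc i)" using grid_diff[of s t n i] by linarith
    then show "?g i \<le> ?g (Suc i)" by simp
  qed
  have Hm: "H (?g i) \<in> borel_measurable (F (?g i))" "H' (?g i) \<in> borel_measurable (F (?g i))" for i
    using regular_measurable[OF H g(1)] regular_measurable[OF H' g(1)] by auto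
  define y where "y i \<omega> = H' (?g i) \<omega> * (B' (?g (Suc i)) \<omega> - B' (?g i) \<omega> - r * H (?g i) \<omega> * (?g (Suc i) - ?g i))" for i \<omega>
  have Y: "Y m \<omega> = (\<Sum>i<m. y i \<omega>)" for m \<omega> by (simp add: Y_def y_def)
  have ys: "square_integrable M (y i)" for i
  proof -
    have "square_integrable M (\<lambda>\<omega>. 1 * (B' (?g (Suc i)) \<omega> - B' (?g i) \<omega>))"
      by (rule B'.increment_square_integrable(1)[OF g(1,3)]) (auto simp: square_integrable_def)
    then have 1: "square_integrable M (\<lambda>\<omega>. B' (?g (Suc i)) \<omega> - B' (?g i) \<omega>)" by simp
    have 2: "square_integrable M (H (?g i))"
      by (rule square_integrable_bounded[OF measurable_F[OF Hm(1)] regular_bound[OF H g(1)]])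
    have "square_integrable M (\<lambda>\<omega>. B' (?g (Suc i)) \<omega> - B' (?g i) \<omega> - (r * (?g (Suc i) - ?g i)) * H (?g i) \<omega>)"
      by (intro square_integrable_diff square_integrable_cmult 1 2)
    then have "square_integrable M (\<lambda>\<omega>. B' (?g (Suc i)) \<omega> - B' (?g i) \<omega> - r * H (?g i) \<omega> * (?g (Suc i) - ?g i))"
      by (simp add: mult_ac)
    then show ?thesis unfolding y_def
      by (rule square_integrable_mult_bounded[OF _ measurable_F[OF Hm(2)] regular_bound[OF H' g(1)]])
  qed
  have Ys: "square_integrable M (Y m)" for m
    unfolding Y[abs_def] by (intro square_integrable_sum ys)
  have ym: "y i \<in> borel_measurable (F (?g m))" if "i < m" for i m
  proof -
    have gm: "?g i \<le> ?g m" "?g (Suc i) \<le> ?g m" using grid_mono[OF st'] that by auto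
    show ?thesis unfolding y_def
      using measurable_F_mono[OF Hm(1) gm(1)] measurable_F_mono[OF Hm(2) gm(1)]
        B'.B_measurable_F'[OF g(1) gm(1)] B'.B_measurable_F'[OF g(1) gm(2)] by measurable
  qed
  have Ym: "Y m \<in> borel_measurable (F (?g m))" for m
    unfolding Y[abs_def] by (intro borel_measurable_sum ym) auto
  have Em: "exp_sum H s t n m \<in> borel_measurable (F (?g m))" for m
    by (rule exp_sum_measurable[OF regular_measurable[OF H] st(1) st'])
  have Es: "square_integrable M (exp_sum H s t n m)" "(\<integral>\<omega>. (exp_sum H s t n m \<omega>)\<^sup>2 \<partial>M) \<le> exp (C\<^sup>2 * (t - s) * 2)"
    if "m \<le> Suc n" for m
    using exp_sum_power[OF H st(1) st' that, of 2] measurable_F[OF Em] by (auto simp: square_integrable_def mult_ac)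
  show "m \<le> Suc n \<Longrightarrow> \<bar>\<integral>\<omega>. exp_sum H s t n m \<omega> * Y m \<omega> \<partial>M\<bar> \<le> real m * ?K"
  proof (induction m)
    case 0
    then show ?case by (simp add: Y_def)
  next
    case (Suc m)
    let ?E = "exp_sum H s t n m"
    let ?e = "\<lambda>\<omega>. exp (H (?g m) \<omega> * (B (?g (Suc m)) \<omega> - B (?g m) \<omega>) - (H (?g m) \<omega>)\<^sup>2 * (?g (Suc m) - ?g m) / 2)"
    let ?D = "\<lambda>\<omega>. B' (?g (Suc m)) \<omega> - B' (?g m) \<omega> - r * H (?g m) \<omega> * (?g (Suc m) - ?g m)"
    let ?G = "\<lambda>\<omega>. H' (?g m) \<omega> * ?E \<omega>"
    have m: "m \<le> Suc n" using Suc.prems by simp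
    have EY: "integrable M (\<lambda>\<omega>. ?E \<omega> * Y m \<omega>)" by (rule square_integrable_mult[OF Es(1)[OF m] Ys])
    have EYm: "(\<lambda>\<omega>. ?E \<omega> * Y m \<omega>) \<in> borel_measurable (F (?g m))" using Em Ym by measurable
    note 1 = increment_exp[OF g(1,3) Hm(1) EYm EY]
    have Gm: "?G \<in> borel_measurable (F (?g m))" using Em Hm by measurable
    have Gs: "square_integrable M ?G"
      by (rule square_integrable_mult_bounded[OF Es(1)[OF m] measurable_F[OF Hm(2)] regular_bound[OF H' g(1)]])
    have "(\<integral>\<omega>. (?G \<omega>)\<^sup>2 \<partial>M) \<le> (\<integral>\<omega>. C'\<^sup>2 * (?E \<omega>)\<^sup>2 \<partial>M)"
    proof (intro integral_mono)
      show "integrable M (\<lambda>\<omega>. (?G \<omega>)\<^sup>2)" by (rule square_integrable_imp[OF Gs])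
      show "integrable M (\<lambda>\<omega>. C'\<^sup>2 * (?E \<omega>)\<^sup>2)" using square_integrable_imp[OF Es(1)[OF m]] by simp
      fix \<omega> assume \<omega>: "\<omega> \<in> space M"
      have "(H' (?g m) \<omega>)\<^sup>2 \<le> C'\<^sup>2" using regular_bound[OF H' g(1) \<omega>, of m] by (simp add: abs_le_square_iff[symmetric])
      then show "(?G \<omega>)\<^sup>2 \<le> C'\<^sup>2 * (?E \<omega>)\<^sup>2" by (simp add: power_mult_distrib mult_right_mono)
    qed
    also have "\<dots> \<le> C'\<^sup>2 * exp (C\<^sup>2 * (t - s) * 2)"
      using Es(2)[OF m] by (simp add: mult_left_mono)
    finally have G2: "(\<integral>\<omega>. (?G \<omega>)\<^sup>2 \<partial>M) \<le> C'\<^sup>2 * exp (C\<^sup>2 * (t - s) * 2)" .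
    note 2 = correlated_exp_step[OF B' cor g(1,2) Hm(1) regular_bound[OF H g(1)] Gm Gs]
    have sm: "C\<^sup>2 * (?g (Suc m) - ?g m) \<le> 1" using small by (simp only: grid_diff)
    note 2 = 2[OF _ sm]
    have "\<bar>\<integral>\<omega>. ?G \<omega> * ?e \<omega> * ?D \<omega> \<partial>M\<bar> \<le> C\<^sup>2 * sqrt (\<integral>\<omega>. (?G \<omega>)\<^sup>2 \<partial>M) * sqrt (2 * (1 + r\<^sup>2)) * (?d * sqrt ?d)"
      using 2(2) unfolding grid_diff by simp
    also have "\<dots> \<le> ?K"
      using G2 st by (intro mult_right_mono mult_left_mono real_sqrt_le_mono) auto
    finally have b2: "\<bar>\<integral>\<omega>. ?G \<omega> * ?e \<omega> * ?D \<omega> \<partial>M\<bar> \<le> ?K" .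
    have "(\<integral>\<omega>. exp_sum H s t n (Suc m) \<omega> * Y (Suc m) \<omega> \<partial>M)
       = (\<integral>\<omega>. ?E \<omega> * Y m \<omega> * ?e \<omega> + ?G \<omega> * ?e \<omega> * ?D \<omega> \<partial>M)"
      by (intro Bochner_Integration.integral_cong refl) (simp add: exp_sum_Suc Y_def algebra_simps)
    also have "\<dots> = (\<integral>\<omega>. ?E \<omega> * Y m \<omega> \<partial>M) + (\<integral>\<omega>. ?G \<omega> * ?e \<omega> * ?D \<omega> \<partial>M)"
      using 1 2(1) by simp
    finally show ?case
      using Suc.IH[OF m] b2 by (simp only: of_nat_Suc distrib_right)
  qed
qed

text \<open>Only the conditional correlation of the increments is available, so each grid step contributes
  an error of order \<open>3/2\<close> in the mesh, and these vanish in the limit.\<close>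

lemma exp_density_drift:
  assumes B': "brownian_space M F B'" and cor: "correlated r B B'" and st: "0 \<le> s" "s < t"
    and X: "regular_ito C H X" and X': "brownian_space.regular_ito M F B' C' H' X'"
  shows "(\<integral>\<omega>. exp_density H X s t \<omega> * (X' t \<omega> - X' s \<omega> - r * time_integral (\<lambda>u \<omega>. H' u \<omega> * H u \<omega>) s t \<omega>) \<partial>M) = 0"
proof -
  interpret B': brownian_space M F B' by (rule B')
  have st': "s \<le> t" using st by simp
  note H = regular_ito_integrand[OF X] and H' = B'.regular_ito_integrand[OF X']
  note HH = regular_mult[OF H' H]
  obtain q :: "nat \<Rightarrow> nat" where q: "strict_mono q"
    "L2_lim M (\<lambda>n. exp_sum H s t (q n) (Suc (q n))) (exp_density H X s t)"
    using exp_density_L2_subseq[OF X st(1) st'] by blast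
  let ?S = "\<lambda>n \<omega>. \<Sum>i<Suc n. (H' (grid s t n i) \<omega> * H (grid s t n i) \<omega>) * ((t - s) / real (Suc n))"
  have S: "L2_lim M ?S (time_integral (\<lambda>u \<omega>. H' u \<omega> * H u \<omega>) s t)"
    by (rule bounded_L2_lim[OF measurable_F[OF step_sum_measurable[OF HH st(1) st']] step_sum_bound[OF HH st(1) st']
        measurable_F[OF time_integral_measurable[OF HH st(1) st']] step_sum_tendsto[OF HH st(1) st']])
  have rS: "L2_lim M (\<lambda>n \<omega>. r * ?S n \<omega>) (\<lambda>\<omega>. r * time_integral (\<lambda>u \<omega>. H' u \<omega> * H u \<omega>) s t \<omega>)"
    by (rule L2_lim_mult_bounded[OF S, of _ "\<bar>r\<bar>"]) auto
  define Y where "Y n \<omega> = riemann_sum B' H' s t n \<omega> - r * ?S n \<omega>" for n \<omega>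
  have YL: "L2_lim M Y (\<lambda>\<omega>. X' t \<omega> - X' s \<omega> - r * time_integral (\<lambda>u \<omega>. H' u \<omega> * H u \<omega>) s t \<omega>)"
    unfolding Y_def[abs_def] by (rule L2_lim_diff[OF B'.regular_ito_lim[OF X' st(1) st'] rS])
  have lim: "(\<lambda>n. \<integral>\<omega>. exp_sum H s t (q n) (Suc (q n)) \<omega> * Y (q n) \<omega> \<partial>M) \<longlonglongrightarrow>
     (\<integral>\<omega>. exp_density H X s t \<omega> * (X' t \<omega> - X' s \<omega> - r * time_integral (\<lambda>u \<omega>. H' u \<omega> * H u \<omega>) s t \<omega>) \<partial>M)"
    by (rule L2_lim_inner[OF q(2) L2_lim_subseq[OF YL q(1)]])
  define A where "A = C\<^sup>2 * sqrt (C'\<^sup>2 * exp (C\<^sup>2 * (t - s) * 2)) * sqrt (2 * (1 + r\<^sup>2))"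
  have bound: "\<bar>\<integral>\<omega>. exp_sum H s t n (Suc n) \<omega> * Y n \<omega> \<partial>M\<bar> \<le> A * (t - s) * sqrt ((t - s) / real (Suc n))"
    if "C\<^sup>2 * ((t - s) / real (Suc n)) \<le> 1" for n
  proof -
    have "Y n \<omega> = (\<Sum>i<Suc n. H' (grid s t n i) \<omega> * (B' (grid s t n (Suc i)) \<omega> - B' (grid s t n i) \<omega>
       - r * H (grid s t n i) \<omega> * (grid s t n (Suc i) - grid s t n i)))" for \<omega>
      unfolding Y_def riemann_sum_def grid_diff sum_distrib_left sum_subtractf[symmetric]
      by (intro sum.cong refl) (simp only: right_diff_distrib mult_ac)
    then have "\<bar>\<integral>\<omega>. exp_sum H s t n (Suc n) \<omega> * Y n \<omega> \<partial>M\<bar>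
      \<le> real (Suc n) * (A * ((t - s) / real (Suc n) * sqrt ((t - s) / real (Suc n))))"
      using correlated_exp_sum[OF B' cor st H H' that order_refl] unfolding A_def by presburger
    also have "\<dots> = A * (t - s) * sqrt ((t - s) / real (Suc n))" by (simp add: mult_ac del: of_nat_Suc)
    finally show ?thesis .
  qed
  have l0: "(\<lambda>n. (t - s) / real (Suc n)) \<longlonglongrightarrow> 0"
    using tendsto_mult_right[OF LIMSEQ_inverse_real_of_nat, of "t - s"] by (simp add: divide_inverse mult.commute)
  have l1: "(\<lambda>n. (t - s) / real (Suc (q n))) \<longlonglongrightarrow> 0"
    using LIMSEQ_subseq_LIMSEQ[OF l0 q(1)] by (simp add: o_def)
  \<comment> \<open>The one-step estimate presupposes cells with
    \<open>C\<^sup>2 * d \<le> 1\<close>, \<open>d\<close> being the mesh; this holds from some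
    index on.\<close>
  have "(\<lambda>n. C\<^sup>2 * ((t - s) / real (Suc (q n)))) \<longlonglongrightarrow> C\<^sup>2 * 0" by (rule tendsto_mult_left[OF l1])
  then have ev: "\<forall>\<^sub>F n in sequentially. C\<^sup>2 * ((t - s) / real (Suc (q n))) < 1"
    by (rule order_tendstoD) simp
  have l2: "(\<lambda>n. A * (t - s) * sqrt ((t - s) / real (Suc (q n)))) \<longlonglongrightarrow> A * (t - s) * sqrt 0"
    by (rule tendsto_mult_left[OF tendsto_real_sqrt[OF l1]])
  have "(\<lambda>n. \<bar>\<integral>\<omega>. exp_sum H s t (q n) (Suc (q n)) \<omega> * Y (q n) \<omega> \<partial>M\<bar>) \<longlonglongrightarrow> 0"
  proof (rule real_tendsto_sandwich[OF _ _ tendsto_const])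
    show "\<forall>\<^sub>F n in sequentially. \<bar>\<integral>\<omega>. exp_sum H s t (q n) (Suc (q n)) \<omega> * Y (q n) \<omega> \<partial>M\<bar>
        \<le> A * (t - s) * sqrt ((t - s) / real (Suc (q n)))"
      using ev by eventually_elim (rule bound, simp)
    show "(\<lambda>n. A * (t - s) * sqrt ((t - s) / real (Suc (q n)))) \<longlonglongrightarrow> 0" using l2 by simp
  qed simp
  then have "(\<lambda>n. \<integral>\<omega>. exp_sum H s t (q n) (Suc (q n)) \<omega> * Y (q n) \<omega> \<partial>M) \<longlonglongrightarrow> 0"
    by (rule tendsto_rabs_zero_cancel)
  from LIMSEQ_unique[OF lim this] show ?thesis .
qed

end

section \<open>Limits of random variables\<close>

text \<open>Continuity from below extends the bound from windows \<open>{n..N}\<close> to all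
  \<open>m \<ge> n\<close>. The event that the oscillation beyond \<open>n\<close> exceeds
  \<open>\<epsilon>\<close> for every \<open>n\<close> then has probability at most a multiple of
  \<open>d n\<close>, hence \<open>0\<close>. Countably many values of \<open>\<epsilon>\<close>
  give the Cauchy property.\<close>

lemma (in prob_space) AE_convergent_of_maximal:
  fixes f :: "nat \<Rightarrow> 'a \<Rightarrow> real"
  assumes m[measurable]: "\<And>n. f n \<in> borel_measurable M" and d: "d \<longlonglongrightarrow> 0"
    and max: "\<And>\<epsilon> n N. 0 < \<epsilon> \<Longrightarrow> \<epsilon>\<^sup>2 * prob {x\<in>space M. \<exists>m\<in>{n..N}. \<epsilon> < \<bar>f m x - f n x\<bar>} \<le> d n"
  shows "AE x in M. convergent (\<lambda>n. f n x)"
proof -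
  have 1: "AE x in M. \<exists>n. \<forall>m\<ge>n. \<bar>f m x - f n x\<bar> \<le> \<epsilon>" if e: "0 < \<epsilon>" for \<epsilon>
  proof -
    define G where "G n N = {x\<in>space M. \<exists>m\<in>{n..N}. \<epsilon> < \<bar>f m x - f n x\<bar>}" for n N
    have G[measurable]: "G n N \<in> sets M" for n N unfolding G_def by measurable
    have bound: "\<epsilon>\<^sup>2 * prob (\<Inter>n. \<Union>N. G n N) \<le> d n" for n
    proof -
      have "incseq (G n)" unfolding incseq_def G_def by fastforce
      then have "(\<lambda>N. prob (G n N)) \<longlonglongrightarrow> prob (\<Union>N. G n N)"
        by (intro finite_Lim_measure_incseq) auto
      then have "(\<lambda>N. \<epsilon>\<^sup>2 * prob (G n N)) \<longlonglongrightarrow> \<epsilon>\<^sup>2 * prob (\<Union>N. G n N)" by (rule tendsto_mult_left)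
      then have "\<epsilon>\<^sup>2 * prob (\<Union>N. G n N) \<le> d n"
        by (rule LIMSEQ_le_const2) (use max[OF e] G_def in auto)
      moreover have "prob (\<Inter>n. \<Union>N. G n N) \<le> prob (\<Union>N. G n N)"
        by (intro finite_measure_mono) auto
      ultimately show ?thesis using mult_left_mono[of "prob (\<Inter>n. \<Union>N. G n N)" "prob (\<Union>N. G n N)" "\<epsilon>\<^sup>2"] by simp
    qed
    have "\<epsilon>\<^sup>2 * prob (\<Inter>n. \<Union>N. G n N) \<le> 0"
      by (rule LIMSEQ_le_const[OF d]) (use bound in auto)
    then have "prob (\<Inter>n. \<Union>N. G n N) = 0"
      using e by (auto simp: mult_le_0_iff measure_le_0_iff)
    then have "AE x in M. x \<notin> (\<Inter>n. \<Union>N. G n N)"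
      by (intro AE_not_in) (auto simp: null_sets_def emeasure_eq_measure)
    then show ?thesis using AE_space
    proof eventually_elim
      case (elim x)
      then obtain n where n: "\<And>N. x \<notin> G n N" by auto
      show ?case
      proof (intro exI allI impI)
        fix m assume "n \<le> m"
        then show "\<bar>f m x - f n x\<bar> \<le> \<epsilon>" using n[of m] elim(2) by (auto simp: G_def not_less)
      qed
    qed
  qed
  have "AE x in M. \<forall>k::nat. \<exists>n. \<forall>m\<ge>n. \<bar>f m x - f n x\<bar> \<le> inverse (real (Suc k))"
    unfolding AE_all_countable by (intro allI 1) simp
  then show ?thesis
  proof eventually_elim
    case (elim x)
    have "Cauchy (\<lambda>n. f n x)"
    proof (rule CauchyI)
      fix e :: real assume e: "0 < e"
      obtain k where k: "inverse (real (Suc k)) < e / 2" using reals_Archimedean[of "e/2"] e by auto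
      obtain n where n: "\<And>m. m \<ge> n \<Longrightarrow> \<bar>f m x - f n x\<bar> \<le> inverse (real (Suc k))" using elim by blast
      show "\<exists>N. \<forall>m\<ge>N. \<forall>l\<ge>N. norm (f m x - f l x) < e"
      proof (intro exI allI impI)
        fix m l assume "n \<le> m" "n \<le> l"
        then show "norm (f m x - f l x) < e"
          unfolding real_norm_def using n[OF \<open>n \<le> m\<close>] n[OF \<open>n \<le> l\<close>] k by linarith
      qed
    qed
    then show ?case by (simp add: Cauchy_convergent_iff)
  qed
qed

text \<open>The bound \<open>z \<le> min z K + (z ln z + 1) / ln K\<close> turns an entropy bound into uniform
  integrability.\<close>

lemma (in prob_space) L1_limit_of_entropy_bound:
  fixes Z :: "nat \<Rightarrow> 'a \<Rightarrow> real"
  assumes Z: "\<And>n. integrable M (Z n)" "\<And>n. (\<integral>x. Z n x \<partial>M) = 1" "\<And>n x. 0 < Z n x"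
    and ent: "\<And>n. integrable M (\<lambda>x. Z n x * ln (Z n x))" "\<And>n. (\<integral>x. Z n x * ln (Z n x) \<partial>M) \<le> c"
    and S: "S \<in> borel_measurable M" "\<And>x. 0 \<le> S x" and lim: "AE x in M. (\<lambda>n. Z n x) \<longlonglongrightarrow> S x"
  shows "integrable M S" "(\<lambda>n. \<integral>x. \<bar>Z n x - S x\<bar> \<partial>M) \<longlonglongrightarrow> 0"
proof -
  have Zm[measurable]: "Z n \<in> borel_measurable M" for n using Z(1) by auto
  note [measurable] = S(1)
  \<comment> \<open>This makes \<open>z * ln z + 1\<close> nonnegative, so that the entropy term may
    also be added where \<open>z \<le> K\<close>.\<close>
  have lower: "- 1 \<le> z * ln z" if "0 < z" for z :: real
  proof -
    have "ln (1 / z) \<le> 1 / z - 1" using that by (intro ln_le_minus_one) auto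
    then have "- ln z \<le> 1 / z - 1" using that by (simp add: ln_div)
    then have "z * (- ln z) \<le> z * (1 / z - 1)" using that by (intro mult_left_mono) auto
    then show ?thesis using that by (simp add: algebra_simps)
  qed
  have "(\<integral>\<^sup>+x. ennreal (S x) \<partial>M) = (\<integral>\<^sup>+x. liminf (\<lambda>n. ennreal (Z n x)) \<partial>M)"
  proof (rule nn_integral_cong_AE)
    show "AE x in M. ennreal (S x) = liminf (\<lambda>n. ennreal (Z n x))"
      using lim
    proof eventually_elim
      case (elim x)
      have "(\<lambda>n. ennreal (Z n x)) \<longlonglongrightarrow> ennreal (S x)" by (rule tendsto_ennrealI[OF elim])
      then show ?case using lim_imp_Liminf by (metis trivial_limit_sequentially)
    qed
  qed
  also have "\<dots> \<le> liminf (\<lambda>n. \<integral>\<^sup>+x. ennreal (Z n x) \<partial>M)" by (rule nn_integral_liminf) simp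
  also have "(\<lambda>n. \<integral>\<^sup>+x. ennreal (Z n x) \<partial>M) = (\<lambda>n. 1)"
    using Z less_imp_le[OF Z(3)] by (subst nn_integral_eq_integral) auto
  finally have le: "(\<integral>\<^sup>+x. ennreal (S x) \<partial>M) \<le> 1" by (simp add: Liminf_const)
  show iS: "integrable M S"
    using le S(2) by (intro integrableI_bounded) (auto simp: order.strict_trans1)
  have S1: "(\<integral>x. S x \<partial>M) \<le> 1"
    using le nn_integral_eq_integral[OF iS] S(2) by simp
  have lowb: "1 - (c + 1) / ln K \<le> (\<integral>x. S x \<partial>M)" if K: "1 < K" for K
  proof -
    have lnK: "0 < ln K" using K by simp
    have "(\<lambda>n. \<integral>x. min (Z n x) K \<partial>M) \<longlonglongrightarrow> (\<integral>x. min (S x) K \<partial>M)"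
    proof (rule integral_dominated_convergence[where w="\<lambda>_. K"])
      show "AE x in M. (\<lambda>n. min (Z n x) K) \<longlonglongrightarrow> min (S x) K"
        using lim by eventually_elim (rule tendsto_min[OF _ tendsto_const])
      show "AE x in M. norm (min (Z n x) K) \<le> K" for n
        using less_imp_le[OF Z(3)] K by (intro AE_I2) (auto simp: min_def)
    qed auto
    moreover have "1 - (c + 1) / ln K \<le> (\<integral>x. min (Z n x) K \<partial>M)" for n
    proof -
      have i: "integrable M (\<lambda>x. min (Z n x) K)"
        by (rule integrable_const_bound[of _ K]) (use less_imp_le[OF Z(3)] K in \<open>auto simp: min_def\<close>)
      have "(\<integral>x. Z n x \<partial>M) \<le> (\<integral>x. min (Z n x) K + (Z n x * ln (Z n x) + 1) / ln K \<partial>M)"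
      proof (intro integral_mono)
        fix x
        show "Z n x \<le> min (Z n x) K + (Z n x * ln (Z n x) + 1) / ln K"
        proof (cases "Z n x \<le> K")
          case True
          then show ?thesis using lower[OF Z(3)[of n x]] lnK by simp
        next
          case False
          then have "ln K \<le> ln (Z n x)" using K by simp
          then have "Z n x * ln K \<le> Z n x * ln (Z n x)" using Z(3)[of n x] by (intro mult_left_mono) auto
          then have "Z n x \<le> Z n x * ln (Z n x) / ln K" using lnK by (simp add: pos_le_divide_eq)
          also have "\<dots> \<le> (Z n x * ln (Z n x) + 1) / ln K" using lnK by (intro divide_right_mono) auto
          finally show ?thesis using False K by simp
        qed
      qed (use Z ent i in auto)
      also have "\<dots> = (\<integral>x. min (Z n x) K \<partial>M) + ((\<integral>x. Z n x * ln (Z n x) \<partial>M) + 1) / ln K"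
        using ent(1) i by (simp add: prob_space)
      also have "\<dots> \<le> (\<integral>x. min (Z n x) K \<partial>M) + (c + 1) / ln K"
        using ent(2) lnK by (intro add_left_mono divide_right_mono add_right_mono) auto
      finally show ?thesis using Z(2) by simp
    qed
    ultimately have "1 - (c + 1) / ln K \<le> (\<integral>x. min (S x) K \<partial>M)"
      by (intro LIMSEQ_le_const[of "\<lambda>n. \<integral>x. min (Z n x) K \<partial>M"]) auto
    also have "\<dots> \<le> (\<integral>x. S x \<partial>M)"
      using iS by (intro integral_mono) auto
    finally show ?thesis .
  qed
  \<comment> \<open>With \<open>K = exp (Suc n)\<close> the loss is at most
    \<open>(c + 1) / Suc n\<close>, so the limit keeps the whole mass.\<close>
  have "1 \<le> (\<integral>x. S x \<partial>M)"
  proof (rule LIMSEQ_le_const2)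
    have "(\<lambda>k. 1 - (c + 1) * inverse (real (Suc k))) \<longlonglongrightarrow> 1 - (c + 1) * 0"
      by (intro tendsto_diff tendsto_const tendsto_mult_left LIMSEQ_inverse_real_of_nat)
    then show "(\<lambda>k. 1 - (c + 1) * inverse (real (Suc k))) \<longlonglongrightarrow> 1" by simp
    show "\<exists>N. \<forall>n\<ge>N. 1 - (c + 1) * inverse (real (Suc n)) \<le> (\<integral>x. S x \<partial>M)"
      using lowb[of "exp (real (Suc _))"] by (auto simp: divide_inverse)
  qed
  then have S1': "(\<integral>x. S x \<partial>M) = 1" using S1 by simp
  \<comment> \<open>Scheffe: for nonnegative functions of equal mass, almost everywhere convergence
    is convergence in L1.\<close>
  have "(\<lambda>n. \<integral>\<^sup>+x. norm (Z n x - S x) \<partial>M) \<longlonglongrightarrow> 0"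
  proof (rule Scheffe_lemma2[OF Zm iS lim])
    fix n
    have "(\<integral>\<^sup>+x. norm (Z n x) \<partial>M) = 1"
      using nn_integral_eq_integral[OF Z(1)[of n]] Z(2)[of n] less_imp_le[OF Z(3)] by (simp add: abs_of_pos[OF Z(3)])
    moreover have "(\<integral>\<^sup>+x. norm (S x) \<partial>M) = 1"
      using nn_integral_eq_integral[OF iS] S1' S(2) by simp
    ultimately show "(\<integral>\<^sup>+x. norm (Z n x) \<partial>M) \<le> (\<integral>\<^sup>+x. norm (S x) \<partial>M)" by simp
  qed
  moreover have "(\<integral>\<^sup>+x. norm (Z n x - S x) \<partial>M) = ennreal (\<integral>x. \<bar>Z n x - S x\<bar> \<partial>M)" for n
    using Z(1) iS by (subst nn_integral_eq_integral) auto
  ultimately have "(\<lambda>n. ennreal (\<integral>x. \<bar>Z n x - S x\<bar> \<partial>M)) \<longlonglongrightarrow> ennreal 0" by simp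
  then show "(\<lambda>n. \<integral>x. \<bar>Z n x - S x\<bar> \<partial>M) \<longlonglongrightarrow> 0" by (rule tendsto_ennrealD) auto
qed

text \<open>Convergence in L1 carries integrals over every event to the limit, and these integrals
  characterise the conditional expectation.\<close>

lemma (in filtered_space) martingale_of_L1_limit:
  assumes ad: "adapted F S" and i: "\<And>t. 0 \<le> t \<Longrightarrow> integrable M (S t)"
    and Z: "\<And>n t. 0 \<le> t \<Longrightarrow> integrable M (Z n t)"
    and mart: "\<And>n s t A. 0 \<le> s \<Longrightarrow> s \<le> t \<Longrightarrow> A \<in> sets (F s) \<Longrightarrow>
       (\<integral>x. indicator A x * Z n t x \<partial>M) = (\<integral>x. indicator A x * Z n s x \<partial>M)"
    and lim: "\<And>t. 0 \<le> t \<Longrightarrow> (\<lambda>n. \<integral>x. \<bar>Z n t x - S t x\<bar> \<partial>M) \<longlonglongrightarrow> 0"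
  shows "martingale M F S"
  unfolding martingale_def
proof (intro conjI allI impI ad i)
  fix s t :: real assume "0 \<le> s \<and> s \<le> t"
  then have st: "0 \<le> s" "s \<le> t" "0 \<le> t" by auto
  interpret sigma_finite_subalgebra M "F s" by (rule sigma_finite_subalgebra_F)
  have conv: "(\<lambda>n. \<integral>x. indicator A x * Z n v x \<partial>M) \<longlonglongrightarrow> (\<integral>x. indicator A x * S v x \<partial>M)"
    if A: "A \<in> sets M" and v: "0 \<le> v" for A v
  proof -
    have iA: "integrable M (\<lambda>x. indicator A x * g x)" if "integrable M g" for g :: "'a \<Rightarrow> real"
      using integrable_real_mult_indicator[OF A that] by (simp add: mult.commute)
    have "\<bar>(\<integral>x. indicator A x * Z n v x \<partial>M) - (\<integral>x. indicator A x * S v x \<partial>M)\<bar> \<le> (\<integral>x. \<bar>Z n v x - S v x\<bar> \<partial>M)" for n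
    proof -
      have "(\<integral>x. indicator A x * Z n v x \<partial>M) - (\<integral>x. indicator A x * S v x \<partial>M) = (\<integral>x. indicator A x * (Z n v x - S v x) \<partial>M)"
        using iA[OF Z[OF v]] iA[OF i[OF v]] by (simp add: right_diff_distrib)
      also have "\<bar>\<dots>\<bar> \<le> (\<integral>x. \<bar>indicator A x * (Z n v x - S v x)\<bar> \<partial>M)" by (rule integral_abs_bound)
      also have "\<dots> \<le> (\<integral>x. \<bar>Z n v x - S v x\<bar> \<partial>M)"
      proof (rule integral_mono)
        show "integrable M (\<lambda>x. \<bar>indicator A x * (Z n v x - S v x)\<bar>)" "integrable M (\<lambda>x. \<bar>Z n v x - S v x\<bar>)"
          using iA[of "\<lambda>x. Z n v x - S v x"] Z[OF v] i[OF v] by auto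
      qed (auto simp: indicator_def)
      finally show ?thesis .
    qed
    then have "(\<lambda>n. \<bar>(\<integral>x. indicator A x * Z n v x \<partial>M) - (\<integral>x. indicator A x * S v x \<partial>M)\<bar>) \<longlonglongrightarrow> 0"
      by (intro real_tendsto_sandwich[OF _ _ tendsto_const lim[OF v]] always_eventually) auto
    then show ?thesis by (rule LIM_zero_cancel[OF tendsto_rabs_zero_cancel])
  qed
  show "AE x in M. real_cond_exp M (F s) (S t) x = S s x"
  proof (rule real_cond_exp_charact)
    show "S s \<in> borel_measurable (F s)" using ad st by (simp add: adapted_def)
    fix A assume A: "A \<in> sets (F s)"
    have "(\<lambda>n. \<integral>x. indicator A x * Z n s x \<partial>M) \<longlonglongrightarrow> (\<integral>x. indicator A x * S t x \<partial>M)"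
      using conv[OF sets_F[OF A] st(3)] by (simp only: mart[OF st(1,2) A])
    from LIMSEQ_unique[OF this conv[OF sets_F[OF A] st(1)]]
    have "(\<integral>x. indicator A x * S t x \<partial>M) = (\<integral>x. indicator A x * S s x \<partial>M)" .
    then show "set_lebesgue_integral M A (S t) = set_lebesgue_integral M A (S s)"
      by (simp add: set_lebesgue_integral_def)
  qed (rule i[OF st(3)], rule i[OF st(1)])
qed

text \<open>The factor \<open>g\<close> is pulled out of the conditional expectation; the triple
  product is integrable because \<open>g\<close> times one increment and the other increment are
  both square integrable.\<close>

lemma (in filtered_space) correlatedI:
  assumes B: "brownian_space M F B" and B': "brownian_space M F B'"
    and ce: "\<And>s t. 0 \<le> s \<Longrightarrow> s \<le> t \<Longrightarrow>
      AE \<omega> in M. real_cond_exp M (F s) (\<lambda>\<omega>. (B t \<omega> - B s \<omega>) * (B' t \<omega> - B' s \<omega>)) \<omega> = r * (t - s)"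
  shows "correlated r B B'"
  unfolding correlated_def
proof (intro allI impI)
  interpret B: brownian_space M F B by (rule B)
  interpret B': brownian_space M F B' by (rule B')
  fix s t g assume a: "0 \<le> s \<and> s \<le> t \<and> g \<in> borel_measurable (F s) \<and> square_integrable M g"
  then have st: "0 \<le> s" "s \<le> t" and g: "g \<in> borel_measurable (F s)" "square_integrable M g" by auto
  interpret sigma_finite_subalgebra M "F s" by (rule sigma_finite_subalgebra_F)
  let ?D = "\<lambda>\<omega>. (B t \<omega> - B s \<omega>) * (B' t \<omega> - B' s \<omega>)"
  have "square_integrable M (\<lambda>\<omega>. 1 * (B' t \<omega> - B' s \<omega>))"
    by (rule B'.increment_square_integrable(1)[OF st]) (auto simp: square_integrable_def)
  then have "integrable M (\<lambda>\<omega>. (g \<omega> * (B t \<omega> - B s \<omega>)) * (B' t \<omega> - B' s \<omega>))"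
    using square_integrable_mult[OF B.increment_square_integrable(1)[OF st g]] by simp
  then have i: "integrable M (\<lambda>\<omega>. g \<omega> * ?D \<omega>)" by (simp add: mult.assoc)
  have m: "?D \<in> borel_measurable M"
    using B.B_measurable[of s] B.B_measurable[of t] B'.B_measurable[of s] B'.B_measurable[of t] st by simp
  have "(\<integral>\<omega>. g \<omega> * ?D \<omega> \<partial>M) = (\<integral>\<omega>. g \<omega> * real_cond_exp M (F s) ?D \<omega> \<partial>M)"
    using real_cond_exp_intg(2)[OF i g(1) m] by simp
  also have "\<dots> = (\<integral>\<omega>. g \<omega> * (r * (t - s)) \<partial>M)"
    using ce[OF st] g measurable_F[OF g(1)] by (intro integral_cong_AE) auto
  finally have "(\<integral>\<omega>. g \<omega> * ?D \<omega> \<partial>M) = r * (t - s) * (\<integral>\<omega>. g \<omega> \<partial>M)"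
    by (simp only: integral_mult_left_zero mult.commute)
  then show "(\<integral>\<omega>. g \<omega> * (B t \<omega> - B s \<omega>) * (B' t \<omega> - B' s \<omega>) \<partial>M) = r * (t - s) * (\<integral>\<omega>. g \<omega> \<partial>M)"
    by (simp only: mult.assoc)
qed

text \<open>Tonelli exchanges the integrals over time and paths, so that a bound on the weighted
  second moment at each time can be integrated. The weight \<open>Z\<close> is that of the final
  time throughout.\<close>

lemma (in filtered_space) weighted_time_integral_le:
  assumes H: "regular_integrand C H" and t: "0 \<le> t"
    and Z: "Z \<in> borel_measurable M" "\<And>\<omega>. 0 \<le> Z \<omega>" "integrable M Z"
    and b: "\<And>u. 0 < u \<Longrightarrow> u \<le> t \<Longrightarrow> (\<integral>\<omega>. Z \<omega> * (H u \<omega> * H u \<omega>) \<partial>M) \<le> b u"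
  shows "ennreal (\<integral>\<omega>. Z \<omega> * time_integral (\<lambda>u \<omega>. H u \<omega> * H u \<omega>) 0 t \<omega> \<partial>M) \<le> (\<integral>\<^sup>+u\<in>{0<..t}. ennreal (b u) \<partial>lborel)"
proof -
  note H2 = regular_mult[OF H H]
  let ?G = "\<lambda>\<omega> u. indicator {0<..t} u * (H u \<omega> * H u \<omega>)"
  have Gm[measurable]: "(\<lambda>(\<omega>, u). ?G \<omega> u) \<in> borel_measurable (M \<Otimes>\<^sub>M lborel)"
  proof -
    have "(\<lambda>z. (fst z, snd z)) \<in> M \<Otimes>\<^sub>M lborel \<rightarrow>\<^sub>M F t \<Otimes>\<^sub>M borel"
      by (intro measurable_Pair measurable_compose[OF measurable_fst measurable_F[of "\<lambda>x. x" t]])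
         (auto cong: measurable_cong_sets)
    from measurable_compose[OF this regular_joint[OF H2 order_refl t]] show ?thesis by simp
  qed
  interpret P: pair_sigma_finite M "lborel :: real measure" ..
  have "ennreal (\<integral>\<omega>. Z \<omega> * time_integral (\<lambda>u \<omega>. H u \<omega> * H u \<omega>) 0 t \<omega> \<partial>M)
     \<le> (\<integral>\<^sup>+\<omega>. ennreal (Z \<omega> * time_integral (\<lambda>u \<omega>. H u \<omega> * H u \<omega>) 0 t \<omega>) \<partial>M)"
    by (rule ennreal_integral_le) (auto simp: time_integral_def Z(2))
  also have "\<dots> = (\<integral>\<^sup>+\<omega>. (\<integral>\<^sup>+u. ennreal (Z \<omega> * ?G \<omega> u) \<partial>lborel) \<partial>M)"
  proof (intro nn_integral_cong)
    fix \<omega> assume \<omega>: "\<omega> \<in> space M"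
    note i = regular_path_integrable[OF H2 order_refl t \<omega>]
    have "(\<integral>\<^sup>+u. ennreal (Z \<omega> * ?G \<omega> u) \<partial>lborel) = ennreal (\<integral>u. Z \<omega> * ?G \<omega> u \<partial>lborel)"
      using i Z(2) by (intro nn_integral_eq_integral) auto
    then show "ennreal (Z \<omega> * time_integral (\<lambda>u \<omega>. H u \<omega> * H u \<omega>) 0 t \<omega>) = (\<integral>\<^sup>+u. ennreal (Z \<omega> * ?G \<omega> u) \<partial>lborel)"
      by (simp add: time_integral_def)
  qed
  also have "\<dots> = (\<integral>\<^sup>+u. (\<integral>\<^sup>+\<omega>. ennreal (Z \<omega> * ?G \<omega> u) \<partial>M) \<partial>lborel)"
  proof (rule P.Fubini'[symmetric])
    have "(\<lambda>z. ennreal (Z (fst z) * (\<lambda>(\<omega>, u). ?G \<omega> u) z)) \<in> borel_measurable (M \<Otimes>\<^sub>M lborel)"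
      using Z(1) Gm by measurable
    then show "(\<lambda>(\<omega>, u). ennreal (Z \<omega> * ?G \<omega> u)) \<in> borel_measurable (M \<Otimes>\<^sub>M lborel)"
      by (simp add: case_prod_beta')
  qed
  also have "\<dots> \<le> (\<integral>\<^sup>+u\<in>{0<..t}. ennreal (b u) \<partial>lborel)"
  proof (intro nn_integral_mono)
    fix u :: real
    show "(\<integral>\<^sup>+\<omega>. ennreal (Z \<omega> * ?G \<omega> u) \<partial>M) \<le> ennreal (b u) * indicator {0<..t} u"
    proof (cases "u \<in> {0<..t}")
      case True
      then have u: "0 \<le> u" "0 < u" "u \<le> t" by auto
      have Hu: "(\<lambda>\<omega>. H u \<omega> * H u \<omega>) \<in> borel_measurable M"
        using measurable_F[OF regular_measurable[OF H2 u(1)]] .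
      have "integrable M (\<lambda>\<omega>. Z \<omega> * (H u \<omega> * H u \<omega>))"
      proof (rule Bochner_Integration.integrable_bound)
        show "integrable M (\<lambda>\<omega>. (C * C) * Z \<omega>)" using Z(3) by simp
        show "AE \<omega> in M. norm (Z \<omega> * (H u \<omega> * H u \<omega>)) \<le> norm (C * C * Z \<omega>)"
        proof (rule AE_I2)
          fix \<omega> assume "\<omega> \<in> space M"
          from regular_bound[OF H2 u(1) this] have "H u \<omega> * H u \<omega> \<le> C * C" by simp
          then have "Z \<omega> * (H u \<omega> * H u \<omega>) \<le> Z \<omega> * (C * C)" using Z(2) by (intro mult_left_mono)
          then show "norm (Z \<omega> * (H u \<omega> * H u \<omega>)) \<le> norm (C * C * Z \<omega>)"
            using Z(2)[of \<omega>] by (simp add: abs_mult mult.commute)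
        qed
      qed (use Z(1) Hu in simp)
      then have "(\<integral>\<^sup>+\<omega>. ennreal (Z \<omega> * (H u \<omega> * H u \<omega>)) \<partial>M) = ennreal (\<integral>\<omega>. Z \<omega> * (H u \<omega> * H u \<omega>) \<partial>M)"
        using Z(2) by (intro nn_integral_eq_integral) auto
      then show ?thesis using True b[OF u(2,3)] by (simp add: ennreal_leI)
    qed simp
  qed
  finally show ?thesis .
qed

section \<open>Paths of the variance process\<close>

lemma exit_time_nonneg: "0 \<le> exit_time Y A \<omega>"
  unfolding exit_time_def by (rule INF_greatest) simp

lemma before_exit_time: "0 \<le> t \<Longrightarrow> ereal t < exit_time Y A \<omega> \<Longrightarrow> Y t \<omega> \<in> A"
  unfolding exit_time_def by (rule ccontr) (use INF_lower[of t "{t. 0 \<le> t \<and> Y t \<omega> \<notin> A}" ereal] in auto)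

lemma exit_time_mono: "A \<subseteq> A' \<Longrightarrow> exit_time Y A \<omega> \<le> exit_time Y A' \<omega>"
  unfolding exit_time_def by (rule INF_superset_mono) auto

lemma zeta_n_mono: "n \<le> m \<Longrightarrow> zeta_n Y n \<omega> \<le> zeta_n Y m \<omega>"
  unfolding zeta_n_def
proof (rule exit_time_mono)
  assume nm: "n \<le> m"
  show "{ereal (1 / real n)<..<ereal (real n)} \<subseteq> {ereal (1 / real m)<..<ereal (real m)}"
  \<comment> \<open>Division by zero gives \<open>1 / real 0 = 0\<close>, so the interval for
    \<open>n = 0\<close> is empty.\<close>
  proof (cases "n = 0")
    case False
    then have "1 / real m \<le> 1 / real n" using nm by (simp add: frac_le)
    moreover have "real n \<le> real m" using nm by simp
    ultimately show ?thesis by (intro subsetI) (auto intro: order.strict_trans1[of "ereal (1 / real m)" "ereal (1 / real n)"]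
        order.strict_trans2[of _ "ereal (real n)"])
  qed (auto dest: order.strict_trans)
qed

lemma zeta_n_le_zeta: "zeta_n Y n \<omega> \<le> zeta Y \<omega>"
  unfolding zeta_n_def zeta_def
proof (rule exit_time_mono, rule subsetI)
  fix x assume x: "x \<in> {ereal (1 / real n)<..<ereal (real n)}"
  have pos: "0 < r" if "1 / real n < r" for r
    by (rule order.strict_trans1[OF _ that]) simp
  show "x \<in> {0<..<\<infinity>}" using x by (cases x) (auto dest: pos)
qed

text \<open>On a compact interval \<open>[0, v]\<close> with \<open>u < v < zeta\<close>, the path
  attains a positive minimum and a finite maximum, so it stays in \<open>(1/n, n)\<close> for large
  \<open>n\<close>. Going a little beyond \<open>u\<close> makes the final inequality
  strict.\<close>

lemma less_zeta_imp_less_zeta_n: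
  assumes c: "continuous_on {0..} (\<lambda>t. Y t \<omega>)" and u: "0 \<le> u" "ereal u < zeta Y \<omega>"
  obtains N where "\<And>n. N \<le> n \<Longrightarrow> ereal u < zeta_n Y n \<omega>"
proof -
  obtain v where v: "u < v" "ereal v < zeta Y \<omega>"
    using ereal_dense2[OF u(2)] by auto
  have c': "continuous_on {0..v} (\<lambda>t. Y t \<omega>)" by (rule continuous_on_subset[OF c]) auto
  have K: "compact ((\<lambda>t. Y t \<omega>) ` {0..v})" by (rule compact_continuous_image[OF c' compact_Icc])
  have ne: "(\<lambda>t. Y t \<omega>) ` {0..v} \<noteq> {}" using u v by auto
  have J: "0 < Y t \<omega> \<and> Y t \<omega> < \<infinity>" if "t \<in> {0..v}" for t
  proof -
    have "ereal t < zeta Y \<omega>" using that v(2) by (auto intro: order.strict_trans1[of _ "ereal v"])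
    then show ?thesis using before_exit_time[of t Y "{0<..<\<infinity>}" \<omega>] that by (auto simp: zeta_def)
  qed
  obtain a where a: "a \<in> (\<lambda>t. Y t \<omega>) ` {0..v}" "\<forall>y\<in>(\<lambda>t. Y t \<omega>) ` {0..v}. a \<le> y"
    using compact_attains_inf[OF K ne] by blast
  obtain b where b: "b \<in> (\<lambda>t. Y t \<omega>) ` {0..v}" "\<forall>y\<in>(\<lambda>t. Y t \<omega>) ` {0..v}. y \<le> b"
    using compact_attains_sup[OF K ne] by blast
  have "0 < a" "a < \<infinity>" "0 < b" "b < \<infinity>" using a(1) b(1) J by auto
  then obtain a' b' where ab: "a = ereal a'" "b = ereal b'" "0 < a'" by (cases a; cases b) auto
  obtain N1 where N1: "inverse (real (Suc N1)) < a'" using reals_Archimedean[OF ab(3)] by auto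
  obtain N2 :: nat where N2: "b' < real N2" using reals_Archimedean2 by blast
  show ?thesis
  proof (rule that[of "max (Suc N1) N2"])
    fix n assume n: "max (Suc N1) N2 \<le> n"
    have "1 / real n \<le> 1 / real (Suc N1)" using n by (intro divide_left_mono) auto
    then have n1: "1 / real n < a'" using N1 by (simp add: inverse_eq_divide)
    have n2: "b' < real n" using n N2 by simp
    have "ereal v \<le> zeta_n Y n \<omega>"
      unfolding zeta_n_def exit_time_def
    proof (rule INF_greatest)
      fix t assume t: "t \<in> {t. 0 \<le> t \<and> Y t \<omega> \<notin> {ereal (1 / real n)<..<ereal (real n)}}"
      show "ereal v \<le> ereal t"
      proof (rule ccontr)
        assume "\<not> ereal v \<le> ereal t"
        then have "t \<in> {0..v}" using t by auto
        then have "a \<le> Y t \<omega>" "Y t \<omega> \<le> b" using a(2) b(2) by auto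
        then have "Y t \<omega> \<in> {ereal (1 / real n)<..<ereal (real n)}"
          using n1 n2 ab by (cases "Y t \<omega>") auto
        then show False using t by auto
      qed
    qed
    then show "ereal u < zeta_n Y n \<omega>" using v(1) by (auto intro: order.strict_trans2[of _ "ereal v"])
  qed
qed

lemma before_zeta_n:
  assumes "0 \<le> u" "ereal u < zeta_n Y n \<omega>"
  obtains y where "Y u \<omega> = ereal y" "0 < y" "y < real n" "0 < n"
proof -
  have y: "ereal (1 / real n) < Y u \<omega>" "Y u \<omega> < ereal (real n)"
    using before_exit_time[OF assms(1) assms(2)[unfolded zeta_n_def]] by auto
  then obtain r where r: "Y u \<omega> = ereal r" by (cases "Y u \<omega>") auto
  have "0 \<le> 1 / real n" by simp
  then have "0 < r" using y r by (metis less_ereal.simps(1) order.strict_trans1)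
  moreover have "r < real n" using y r by simp
  moreover from this \<open>0 < r\<close> have "0 < n" by (cases n) auto
  ultimately show ?thesis using r that by blast
qed

lemma sqrt_Y_n_cases:
  assumes "0 \<le> u"
  obtains y where "ereal u < zeta_n Y n \<omega>" "Y u \<omega> = ereal y" "0 < y" "y < real n" "sqrt_Y_n Y n u \<omega> = sqrt y"
  | "\<not> ereal u < zeta_n Y n \<omega>" "sqrt_Y_n Y n u \<omega> = 0"
proof (cases "ereal u < zeta_n Y n \<omega>")
  case True
  obtain y where "Y u \<omega> = ereal y" "0 < y" "y < real n" by (rule before_zeta_n[OF assms True])
  then show ?thesis using True by (intro that(1)[of y]) (auto simp: sqrt_Y_n_def)
next
  case False
  then show ?thesis by (intro that(2)) (auto simp: sqrt_Y_n_def)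
qed

text \<open>Lets the event that \<open>zeta_n\<close> lies after \<open>u\<close> be read off from
  the integrand at time \<open>u\<close>; its measurability at \<open>u\<close> then makes
  \<open>zeta_n\<close>, capped at \<open>t\<close>, a stopping time.\<close>

lemma sqrt_Y_n_pos_iff: "0 \<le> u \<Longrightarrow> 0 < sqrt_Y_n Y n u \<omega> \<longleftrightarrow> ereal u < zeta_n Y n \<omega>"
  by (rule sqrt_Y_n_cases[of u Y n \<omega>]) auto

lemma sqrt_Y_n_square:
  "0 \<le> u \<Longrightarrow> sqrt_Y_n Y n u \<omega> * sqrt_Y_n Y n u \<omega> = (if ereal u < zeta_n Y n \<omega> then real_of_ereal (Y u \<omega>) else 0)"
  by (rule sqrt_Y_n_cases[of u Y n \<omega>]) auto

lemma sqrt_Y_n_bound: "0 \<le> u \<Longrightarrow> \<bar>sqrt_Y_n Y n u \<omega>\<bar> \<le> sqrt (real n)"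
  by (rule sqrt_Y_n_cases[of u Y n \<omega>]) auto

text \<open>Before \<open>zeta_n\<close> the variance is finite and continuous, after it the
  integrand is constantly \<open>0\<close>; each side is an open set of times, so only
  \<open>zeta_n\<close> itself can be a discontinuity.\<close>

lemma sqrt_Y_n_continuous:
  assumes c: "continuous_on {0..} (\<lambda>t. Y t \<omega>)" and u: "0 \<le> u" "ereal u \<noteq> zeta_n Y n \<omega>"
  shows "continuous (at u within {0..}) (\<lambda>u. sqrt_Y_n Y n u \<omega>)"
proof (cases "ereal u < zeta_n Y n \<omega>")
  case True
  obtain y where y: "Y u \<omega> = ereal y" using before_zeta_n[OF u(1) True] by metis
  have e: "\<forall>\<^sub>F v in at u within {0..}. ereal v < zeta_n Y n \<omega>"
  proof -
    have "(ereal \<longlongrightarrow> ereal u) (at u within {0..})" by (intro tendsto_intros)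
    from order_tendstoD(2)[OF this True] show ?thesis .
  qed
  have "((\<lambda>v. Y v \<omega>) \<longlongrightarrow> Y u \<omega>) (at u within {0..})"
    using c u(1) unfolding continuous_on_def by blast
  then have "((\<lambda>v. Y v \<omega>) \<longlongrightarrow> ereal y) (at u within {0..})" unfolding y .
  then have "((\<lambda>v. sqrt (real_of_ereal (Y v \<omega>))) \<longlongrightarrow> sqrt y) (at u within {0..})"
    by (intro tendsto_real_sqrt lim_real_of_ereal[unfolded o_def])
  then have "((\<lambda>v. sqrt_Y_n Y n v \<omega>) \<longlongrightarrow> sqrt y) (at u within {0..})"
  proof (rule Lim_transform_eventually)
    show "\<forall>\<^sub>F v in at u within {0..}. sqrt (real_of_ereal (Y v \<omega>)) = sqrt_Y_n Y n v \<omega>"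
      using e by eventually_elim (simp add: sqrt_Y_n_def)
  qed
  then show ?thesis using True y by (simp add: continuous_within sqrt_Y_n_def)
next
  case False
  then have lt: "zeta_n Y n \<omega> < ereal u" using u(2) by auto
  have e: "\<forall>\<^sub>F v in at u within {0..}. zeta_n Y n \<omega> < ereal v"
  proof -
    have "(ereal \<longlongrightarrow> ereal u) (at u within {0..})" by (intro tendsto_intros)
    from order_tendstoD(1)[OF this lt] show ?thesis .
  qed
  have "((\<lambda>v. sqrt_Y_n Y n v \<omega>) \<longlongrightarrow> 0) (at u within {0..})"
  proof (rule Lim_transform_eventually[OF tendsto_const])
    show "\<forall>\<^sub>F v in at u within {0..}. 0 = sqrt_Y_n Y n v \<omega>"
      using e by eventually_elim (auto simp: sqrt_Y_n_def)
  qed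
  then show ?thesis using False by (simp add: continuous_within sqrt_Y_n_def)
qed

lemma stopped_at_facts:
  assumes "0 \<le> t" "0 \<le> \<sigma>"
  shows "ereal (stopped_at t \<sigma>) = min (ereal t) \<sigma>" "0 \<le> stopped_at t \<sigma>" "stopped_at t \<sigma> \<le> t"
    "u < stopped_at t \<sigma> \<longleftrightarrow> u < t \<and> ereal u < \<sigma>"
    "stopped_at t \<sigma> < u \<Longrightarrow> u \<le> t \<Longrightarrow> \<sigma> < ereal u"
proof -
  have "\<bar>min (ereal t) \<sigma>\<bar> \<noteq> \<infinity>" using assms by (cases \<sigma>) (auto simp: min_def)
  then show eq: "ereal (stopped_at t \<sigma>) = min (ereal t) \<sigma>" by (simp add: ereal_real')
  have le: "ereal 0 \<le> ereal (stopped_at t \<sigma>)" "ereal (stopped_at t \<sigma>) \<le> ereal t"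
    unfolding eq using assms by (simp_all add: zero_ereal_def)
  then show "0 \<le> stopped_at t \<sigma>" "stopped_at t \<sigma> \<le> t" by (simp_all only: ereal_less_eq(3))
  have "ereal u < ereal (stopped_at t \<sigma>) \<longleftrightarrow> ereal u < ereal t \<and> ereal u < \<sigma>"
    unfolding eq by simp
  then show "u < stopped_at t \<sigma> \<longleftrightarrow> u < t \<and> ereal u < \<sigma>" by (simp only: less_ereal.simps(1))
  assume u: "stopped_at t \<sigma> < u" "u \<le> t"
  then have "ereal (stopped_at t \<sigma>) < ereal u" by (simp only: less_ereal.simps(1))
  then have "min (ereal t) \<sigma> < ereal u" unfolding eq .
  then show "\<sigma> < ereal u" using u(2) by (auto simp: min_less_iff_disj)
qed

text \<open>Every time before \<open>zeta\<close> lies before \<open>zeta_n\<close> for large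
  \<open>n\<close>, so the squared integrands increase to the variance and monotone convergence
  applies. Infinite values are included, as all integrals are taken in
  \<open>ennreal\<close>.\<close>

lemma integrated_variance_eq_SUP:
  assumes c: "continuous_on {0..} (\<lambda>t. Y t \<omega>)" and t: "0 \<le> t"
    and m: "\<And>n. (\<lambda>u. indicator {0<..t} u * (sqrt_Y_n Y n u \<omega> * sqrt_Y_n Y n u \<omega>)) \<in> borel_measurable borel"
  shows "integrated_variance Y t \<omega> =
    (SUP n. \<integral>\<^sup>+u. ennreal (indicator {0<..t} u * (sqrt_Y_n Y n u \<omega> * sqrt_Y_n Y n u \<omega>)) \<partial>lborel)"
proof -
  let ?f = "\<lambda>n u. ennreal (indicator {0<..t} u * (sqrt_Y_n Y n u \<omega> * sqrt_Y_n Y n u \<omega>))"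
  let ?s = "stopped_at t (zeta Y \<omega>)"
  note s = stopped_at_facts[OF t, of "zeta Y \<omega>"]
  have z: "0 \<le> zeta Y \<omega>" unfolding zeta_def by (rule exit_time_nonneg)
  have val: "?f n u = (if u \<in> {0<..t} \<and> ereal u < zeta_n Y n \<omega> then e2ennreal (Y u \<omega>) else 0)" for n u
  proof (cases "u \<in> {0<..t} \<and> ereal u < zeta_n Y n \<omega>")
    case True
    then obtain y where "Y u \<omega> = ereal y" using before_zeta_n[of u Y n \<omega>] by auto
    then show ?thesis using True by (simp add: sqrt_Y_n_square e2ennreal_ereal)
  next
    case False
    then show ?thesis by (auto simp: sqrt_Y_n_def indicator_def)
  qed
  have inc: "incseq ?f"
    unfolding incseq_def le_fun_def val using order.strict_trans2[OF _ zeta_n_mono[of _ _ Y \<omega>]] by auto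
  \<comment> \<open>At \<open>0\<close> and at the stopped time the two sides may differ, since the
    interval of \<open>integrated_variance\<close> is closed there; two points are a null
    set.\<close>
  have sup: "(SUP n. ?f n u) = e2ennreal (Y u \<omega>) * indicator {0..?s} u" if "u \<noteq> 0" "u \<noteq> ?s" for u
  proof (cases "u \<in> {0<..<?s}")
    case True
    then have u: "0 < u" "u \<le> t" "ereal u < zeta Y \<omega>" using s[OF z] by auto
    obtain N where N: "\<And>n. N \<le> n \<Longrightarrow> ereal u < zeta_n Y n \<omega>"
      using less_zeta_imp_less_zeta_n[OF c _ u(3)] u(1) by auto
    have "(SUP n. ?f n u) = e2ennreal (Y u \<omega>)"
    proof (rule antisym)
      show "(SUP n. ?f n u) \<le> e2ennreal (Y u \<omega>)" by (rule SUP_least) (simp add: val del: ennreal_indicator)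
      have "e2ennreal (Y u \<omega>) = ?f N u" unfolding val using N u by simp
      also have "\<dots> \<le> (SUP n. ?f n u)" by (rule SUP_upper) simp
      finally show "e2ennreal (Y u \<omega>) \<le> (SUP n. ?f n u)" .
    qed
    then show ?thesis using True by simp
  next
    case False
    have f0: "?f n u = 0" for n
    proof -
      have "\<not> (u \<in> {0<..t} \<and> ereal u < zeta_n Y n \<omega>)"
      proof
        assume a: "u \<in> {0<..t} \<and> ereal u < zeta_n Y n \<omega>"
        then have "ereal u < zeta Y \<omega>" using zeta_n_le_zeta[of Y n \<omega>] by (auto intro: order.strict_trans2)
        then show False using a False that s(5)[OF z, of u] by (auto simp: not_less)
      qed
      then show ?thesis unfolding val by (rule if_not_P)
    qed
    have "(SUP n. ?f n u) = 0" unfolding f0 by simp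
    then show ?thesis using False that by (auto simp: indicator_def)
  qed
  have "integrated_variance Y t \<omega> = (\<integral>\<^sup>+u. (SUP n. ?f n u) \<partial>lborel)"
    unfolding integrated_variance_def
  proof (rule nn_integral_cong_AE)
    have "AE u in lborel. u \<notin> {0, ?s}" by (intro AE_not_in countable_imp_null_set_lborel) auto
    then show "AE u in lborel. e2ennreal (Y u \<omega>) * indicator {0..?s} u = (SUP n. ?f n u)"
      by eventually_elim (use sup in auto)
  qed
  also have "\<dots> = (SUP n. \<integral>\<^sup>+u. ?f n u \<partial>lborel)"
    by (rule nn_integral_monotone_convergence_SUP[OF inc]) (use m in simp)
  finally show ?thesis .
qed

context filtered_space
begin

text \<open>All discontinuities of a path lie in a singleton. If \<open>zeta_n\<close> is infinite
  its real value is junk, but then there is no discontinuity at all.\<close>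

lemma regular_sqrt_Y_n:
  assumes p: "progressively_measurable F (sqrt_Y_n Y n)" and c: "continuous_paths M Y"
  shows "regular_integrand (sqrt (real n)) (sqrt_Y_n Y n)"
  unfolding regular_integrand_def
proof (intro conjI allI impI ballI p sqrt_Y_n_bound)
  fix \<omega> assume \<omega>: "\<omega> \<in> space M"
  then have c: "continuous_on {0..} (\<lambda>t. Y t \<omega>)" using c by (simp add: continuous_paths_def)
  have "{u. 0 \<le> u \<and> \<not> continuous (at u within {0..}) (\<lambda>u. sqrt_Y_n Y n u \<omega>)} \<subseteq> {real_of_ereal (zeta_n Y n \<omega>)}"
  proof safe
    fix u :: real assume "0 \<le> u" "\<not> continuous (at u within {0..}) (\<lambda>u. sqrt_Y_n Y n u \<omega>)"
    then have "ereal u = zeta_n Y n \<omega>" using sqrt_Y_n_continuous[where Y=Y and \<omega>=\<omega> and n=n, OF c] by blast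
    then show "u = real_of_ereal (zeta_n Y n \<omega>)" by (metis real_of_ereal.simps(1))
  qed
  then show "countable {u. 0 \<le> u \<and> \<not> continuous (at u within {0..}) (\<lambda>u. sqrt_Y_n Y n u \<omega>)}"
    by (rule countable_subset) simp
qed

lemma integrated_variance_time_integral:
  assumes H: "\<And>n. regular_integrand (sqrt (real n)) (sqrt_Y_n Y n)" and c: "continuous_paths M Y"
    and t: "0 \<le> t" and \<omega>: "\<omega> \<in> space M"
  defines "T \<equiv> \<lambda>n. time_integral (\<lambda>u \<omega>. sqrt_Y_n Y n u \<omega> * sqrt_Y_n Y n u \<omega>) 0 t \<omega>"
  shows "integrated_variance Y t \<omega> = (SUP n. ennreal (T n))" "incseq T" "0 \<le> T n"
proof -
  note H2 = regular_mult[OF H H]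
  have c': "continuous_on {0..} (\<lambda>t. Y t \<omega>)" using c \<omega> by (simp add: continuous_paths_def)
  note i = regular_path_integrable[OF H2 order_refl t \<omega>]
  have sq: "0 \<le> indicator {0<..t} u * (sqrt_Y_n Y n u \<omega> * sqrt_Y_n Y n u \<omega>)" for n u by simp
  have "(\<integral>\<^sup>+u. ennreal (indicator {0<..t} u * (sqrt_Y_n Y n u \<omega> * sqrt_Y_n Y n u \<omega>)) \<partial>lborel) = ennreal (T n)" for n
    unfolding T_def time_integral_def by (intro nn_integral_eq_integral i AE_I2 sq)
  then show "integrated_variance Y t \<omega> = (SUP n. ennreal (T n))"
    using integrated_variance_eq_SUP[where Y=Y and \<omega>=\<omega>, OF c' t regular_path_measurable[OF H2 order_refl t \<omega>]] by simp
  show "0 \<le> T n" unfolding T_def time_integral_def using sq by simp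
  show "incseq T"
  proof (rule incseq_SucI)
    fix n
    show "T n \<le> T (Suc n)"
      unfolding T_def time_integral_def
    proof (intro integral_mono i)
      fix u
      show "indicator {0<..t} u * (sqrt_Y_n Y n u \<omega> * sqrt_Y_n Y n u \<omega>)
         \<le> indicator {0<..t} u * (sqrt_Y_n Y (Suc n) u \<omega> * sqrt_Y_n Y (Suc n) u \<omega>)"
      proof (cases "u \<in> {0<..t} \<and> ereal u < zeta_n Y n \<omega>")
        case True
        then have "ereal u < zeta_n Y (Suc n) \<omega>" using zeta_n_mono[of n "Suc n" Y \<omega>] by (auto intro: order.strict_trans2)
        then show ?thesis using True by (simp add: sqrt_Y_n_square)
      next
        case False
        then have "indicator {0<..t} u * (sqrt_Y_n Y n u \<omega> * sqrt_Y_n Y n u \<omega>) = (0::real)"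
          by (auto simp: sqrt_Y_n_def indicator_def)
        then show ?thesis using sq[of u "Suc n"] by linarith
      qed
    qed
  qed
qed

lemma integrated_variance_measurable:
  assumes H: "\<And>n. regular_integrand (sqrt (real n)) (sqrt_Y_n Y n)" and c: "continuous_paths M Y" and t: "0 \<le> t"
  shows "integrated_variance Y t \<in> borel_measurable (F t)"
proof -
  have [measurable]: "time_integral (\<lambda>u \<omega>. sqrt_Y_n Y n u \<omega> * sqrt_Y_n Y n u \<omega>) 0 t \<in> borel_measurable (F t)" for n
    by (rule time_integral_measurable[OF regular_mult[OF H H] order_refl t])
  have "(\<lambda>\<omega>. SUP n. ennreal (time_integral (\<lambda>u \<omega>. sqrt_Y_n Y n u \<omega> * sqrt_Y_n Y n u \<omega>) 0 t \<omega>)) \<in> borel_measurable (F t)"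
    by measurable
  then show ?thesis
    by (rule measurable_cong[THEN iffD1, rotated])
       (simp add: space_F integrated_variance_time_integral(1)[OF H c t])
qed

end

text \<open>If the drift integral does not exist, its value is the junk value \<open>0\<close>, so the bound needs no
  integrability.\<close>

lemma variance_drift_bound:
  assumes par: "0 < \<kappa>" "0 < \<theta>" and t: "0 \<le> t" and nn: "\<And>u. 0 \<le> u \<Longrightarrow> 0 \<le> Y u \<omega>"
    and eq: "Y (stopped_at t (zeta_n Y n \<omega>)) \<omega> =
      ereal (x0 + (LBINT u:{0..stopped_at t (zeta_n Y n \<omega>)}. \<kappa> * (\<theta> - real_of_ereal (Y u \<omega>))) + \<xi> * v)"
  shows "sqrt_Y_n Y n t \<omega> * sqrt_Y_n Y n t \<omega> \<le> x0 + \<kappa> * \<theta> * t + \<xi> * v"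
proof -
  define s where "s = stopped_at t (zeta_n Y n \<omega>)"
  have z: "0 \<le> zeta_n Y n \<omega>" unfolding zeta_n_def by (rule exit_time_nonneg)
  note s = stopped_at_facts[OF t z, folded s_def]
  let ?f = "\<lambda>u. indicator {0..s} u *\<^sub>R (\<kappa> * (\<theta> - real_of_ereal (Y u \<omega>)))"
  have "(LBINT u:{0..s}. \<kappa> * (\<theta> - real_of_ereal (Y u \<omega>))) \<le> \<kappa> * \<theta> * t"
  proof (cases "integrable lborel ?f")
    case True
    have "integral\<^sup>L lborel ?f \<le> (\<integral>u. \<kappa> * \<theta> * indicator {0..s} u \<partial>lborel)"
    proof (rule integral_mono[OF True])
      show "integrable lborel (\<lambda>u. \<kappa> * \<theta> * indicator {0..s} u :: real)"
        using s by (intro integrable_mult_right integrable_real_indicator) auto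
      fix u
      \<comment> \<open>Mean reversion contributes with a favourable sign and is dropped; only
        \<open>\<kappa> * \<theta>\<close> remains of the drift.\<close>
      have "0 \<le> \<kappa> * real_of_ereal (Y u \<omega>)" if "0 \<le> u"
        using par nn[OF that] by (simp add: real_of_ereal_pos)
      then show "?f u \<le> \<kappa> * \<theta> * indicator {0..s} u"
        by (auto simp: indicator_def right_diff_distrib)
    qed
    also have "\<dots> = \<kappa> * \<theta> * s" using s by simp
    also have "\<dots> \<le> \<kappa> * \<theta> * t" using par s by (intro mult_left_mono) auto
    finally show ?thesis unfolding set_lebesgue_integral_def .
  next
    case False
    then have "(LBINT u:{0..s}. \<kappa> * (\<theta> - real_of_ereal (Y u \<omega>))) = 0"
      unfolding set_lebesgue_integral_def by (rule not_integrable_integral_eq)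
    then show ?thesis using par t by simp
  qed
  \<comment> \<open>Once \<open>zeta_n\<close> has been reached the left side is \<open>0\<close>
    while the stopped variance is nonnegative, so the stopped equation bounds the squared integrand
    at all times.\<close>
  moreover have "sqrt_Y_n Y n t \<omega> * sqrt_Y_n Y n t \<omega> \<le> real_of_ereal (Y s \<omega>)"
  proof (cases "ereal t < zeta_n Y n \<omega>")
    case True
    then have "s = t" using s(1) by simp
    then show ?thesis using True t by (simp add: sqrt_Y_n_square)
  next
    case False
    then show ?thesis using t nn[OF s(2)] by (simp add: sqrt_Y_n_square real_of_ereal_pos)
  qed
  moreover have "real_of_ereal (Y s \<omega>) = x0 + (LBINT u:{0..s}. \<kappa> * (\<theta> - real_of_ereal (Y u \<omega>))) + \<xi> * v"
    unfolding eq[folded s_def] by simp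
  ultimately show ?thesis by linarith
qed

section \<open>The Heston model\<close>

locale heston_model = filtered_space M F for M :: "'a measure" and F +
  fixes \<kappa> \<theta> \<xi> \<rho> x0 :: real and W W1 :: "real \<Rightarrow> 'a \<Rightarrow> real" and Y :: "real \<Rightarrow> 'a \<Rightarrow> ereal"
    and I :: "nat \<Rightarrow> real \<Rightarrow> 'a \<Rightarrow> real"
  assumes params: "0 < \<kappa>" "0 < \<theta>" "0 < \<xi>" "\<rho> \<le> 1" "0 < x0"
    and W: "brownian_motion M F W" and W1: "brownian_motion M F W1"
    and correlated_W: "correlated \<rho> W1 W"
    and variance: "heston_variance M F \<kappa> \<theta> \<xi> x0 W Y"
    and stock_integral: "\<And>n. is_ito_integral M F W1 (sqrt_Y_n Y n) (I n)"
begin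

sublocale W: brownian_space M F W by unfold_locales (rule W)
sublocale W1: brownian_space M F W1 by unfold_locales (rule W1)

abbreviation H :: "nat \<Rightarrow> real \<Rightarrow> 'a \<Rightarrow> real" where "H n \<equiv> sqrt_Y_n Y n"

abbreviation T :: "nat \<Rightarrow> real \<Rightarrow> 'a \<Rightarrow> real" where
  "T n t \<equiv> time_integral (\<lambda>u \<omega>. H n u \<omega> * H n u \<omega>) 0 t"

abbreviation Z :: "nat \<Rightarrow> real \<Rightarrow> 'a \<Rightarrow> real" where
  "Z n t \<equiv> W1.exp_density (H n) (I n) 0 t"

lemma continuous_Y: "continuous_paths M Y"
  using variance by (simp add: heston_variance_def)

lemma H_regular: "regular_integrand (sqrt (real n)) (H n)"
  using stock_integral[of n] by (intro regular_sqrt_Y_n continuous_Y) (simp add: is_ito_integral_def)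

lemma H2_regular: "regular_integrand (sqrt (real n) * sqrt (real n)) (\<lambda>u \<omega>. H n u \<omega> * H n u \<omega>)"
  by (rule regular_mult[OF H_regular H_regular])

lemma I_regular: "W1.regular_ito (sqrt (real n)) (H n) (I n)"
  by (rule W1.regular_itoI[OF stock_integral H_regular])

text \<open>Condenses the variance equation into the one-sided bound on which all moment estimates
  rest. \<open>V\<close> has the same integrand as \<open>I n\<close> but is driven by
  \<open>W\<close> instead of \<open>W1\<close>.\<close>

lemma variance_integral:
  obtains V where "W.regular_ito (sqrt (real n)) (H n) V"
    "AE \<omega> in M. \<forall>t\<ge>0. H n t \<omega> * H n t \<omega> \<le> x0 + \<kappa> * \<theta> * t + \<xi> * V t \<omega>"
proof -
  obtain V where V: "is_ito_integral M F W (H n) V" and eq: "AE \<omega> in M. \<forall>t\<ge>0.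
           Y (stopped_at t (zeta_n Y n \<omega>)) \<omega> = ereal (x0
               + (LBINT u:{0..stopped_at t (zeta_n Y n \<omega>)}. \<kappa> * (\<theta> - real_of_ereal (Y u \<omega>)))
               + \<xi> * V t \<omega>)"
    using variance unfolding heston_variance_def by blast
  have nn: "0 \<le> Y u \<omega>" if "\<omega> \<in> space M" "0 \<le> u" for u \<omega>
    using variance that unfolding heston_variance_def by blast
  show ?thesis
  proof (rule that[OF W.regular_itoI[OF V H_regular]])
    show "AE \<omega> in M. \<forall>t\<ge>0. H n t \<omega> * H n t \<omega> \<le> x0 + \<kappa> * \<theta> * t + \<xi> * V t \<omega>"
      using eq AE_space
    proof eventually_elim
      case (elim \<omega>)
      show ?case
      proof (intro allI impI)
        fix t :: real assume t: "0 \<le> t"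
        show "H n t \<omega> * H n t \<omega> \<le> x0 + \<kappa> * \<theta> * t + \<xi> * V t \<omega>"
          by (rule variance_drift_bound[where Y=Y and \<omega>=\<omega>, OF params(1,2) t nn[OF elim(2)]]) (use elim(1) t in blast)+
      qed
    qed
  qed
qed

lemma Z_square_integrable: "0 \<le> t \<Longrightarrow> square_integrable M (Z n t)"
  by (rule W1.exp_density_square_integrable[OF I_regular order_refl])

lemma Z_pos: "0 < Z n t \<omega>"
  by (simp add: W1.exp_density_def)

lemma Z_mean: "0 \<le> t \<Longrightarrow> (\<integral>\<omega>. Z n t \<omega> \<partial>M) = 1"
  using W1.exp_density_mean[OF I_regular order_refl, of t "\<lambda>_. 1" n] by (simp add: square_integrable_def prob_space)

lemma T_measurable: "0 \<le> t \<Longrightarrow> T n t \<in> borel_measurable M"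
  by (rule measurable_F[OF time_integral_measurable[OF H2_regular order_refl]])

lemma T_nonneg: "0 \<le> T n t \<omega>"
  by (simp add: time_integral_def)

lemma T_square_integrable: "0 \<le> t \<Longrightarrow> square_integrable M (T n t)"
  by (rule square_integrable_bounded[OF T_measurable time_integral_bound[OF H2_regular order_refl]])

lemma H2_measurable: "0 \<le> t \<Longrightarrow> (\<lambda>\<omega>. H n t \<omega> * H n t \<omega>) \<in> borel_measurable M"
  by (rule measurable_F[OF regular_measurable[OF H2_regular]])

lemma H2_square_integrable: "0 \<le> t \<Longrightarrow> square_integrable M (\<lambda>\<omega>. H n t \<omega> * H n t \<omega>)"
  by (rule square_integrable_bounded[OF H2_measurable regular_bound[OF H2_regular]])

section \<open>Moments of the integrand under the original measure and weighted by
  \<open>Z\<close>\<close>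

lemma mean_H2:
  assumes t: "0 \<le> t"
  shows "(\<integral>\<omega>. H n t \<omega> * H n t \<omega> \<partial>M) \<le> x0 + \<kappa> * \<theta> * t"
proof -
  obtain V where V: "W.regular_ito (sqrt (real n)) (H n) V"
    and le: "AE \<omega> in M. \<forall>t\<ge>0. H n t \<omega> * H n t \<omega> \<le> x0 + \<kappa> * \<theta> * t + \<xi> * V t \<omega>"
    by (rule variance_integral)
  note V2 = W.regular_ito_square_integrable_0[OF V t]
  have iV: "integrable M (V t)" by (rule square_integrable_integrable[OF V2(1)])
  have "(\<integral>\<omega>. V t \<omega> \<partial>M) = (\<integral>\<omega>. V t \<omega> - V 0 \<omega> \<partial>M)"
    using V2 W.regular_ito_square_integrable[OF V order_refl t]
    by (intro integral_cong_AE) (auto simp: square_integrable_def)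
  also have "\<dots> = 0"
    using W.regular_ito_orthogonal[OF V order_refl t, of "\<lambda>_. 1"] by (simp add: square_integrable_def)
  finally have V0: "(\<integral>\<omega>. V t \<omega> \<partial>M) = 0" .
  have "(\<integral>\<omega>. H n t \<omega> * H n t \<omega> \<partial>M) \<le> (\<integral>\<omega>. x0 + \<kappa> * \<theta> * t + \<xi> * V t \<omega> \<partial>M)"
  proof (rule integral_mono_AE)
    show "integrable M (\<lambda>\<omega>. H n t \<omega> * H n t \<omega>)" by (rule square_integrable_integrable[OF H2_square_integrable[OF t]])
    show "integrable M (\<lambda>\<omega>. x0 + \<kappa> * \<theta> * t + \<xi> * V t \<omega>)" using iV by simp
    show "AE \<omega> in M. H n t \<omega> * H n t \<omega> \<le> x0 + \<kappa> * \<theta> * t + \<xi> * V t \<omega>"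
      using le by eventually_elim (use t in blast)
  qed
  also have "\<dots> = x0 + \<kappa> * \<theta> * t" using iV V0 by (simp add: prob_space)
  finally show ?thesis .
qed

text \<open>The second moment at each \<open>u \<le> t\<close> is replaced by its bound at
  \<open>t\<close>; what matters is that no \<open>n\<close> appears, so the limit of the
  \<open>T n t\<close> is integrable.\<close>

lemma mean_T:
  assumes t: "0 \<le> t"
  shows "(\<integral>\<omega>. T n t \<omega> \<partial>M) \<le> (x0 + \<kappa> * \<theta> * t) * t"
proof -
  let ?a = "x0 + \<kappa> * \<theta> * t"
  have a: "0 \<le> ?a" using params t by simp
  have "ennreal (\<integral>\<omega>. 1 * T n t \<omega> \<partial>M) \<le> (\<integral>\<^sup>+u\<in>{0<..t}. ennreal ?a \<partial>lborel)"
  proof (rule weighted_time_integral_le[OF H_regular t])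
    fix u assume u: "0 < u" "u \<le> t"
    have "(\<integral>\<omega>. 1 * (H n u \<omega> * H n u \<omega>) \<partial>M) \<le> x0 + \<kappa> * \<theta> * u" using mean_H2[of u n] u by simp
    also have "\<dots> \<le> ?a" using u params by simp
    finally show "(\<integral>\<omega>. 1 * (H n u \<omega> * H n u \<omega>) \<partial>M) \<le> ?a" .
  qed auto
  also have "\<dots> = ennreal (?a * t)" using t a by (subst nn_integral_cmult_indicator) (auto simp: ennreal_mult)
  finally show ?thesis using a t by (simp add: ennreal_le_iff)
qed

text \<open>Under the weight \<open>Z n t\<close>, driven by \<open>W1\<close>, an integral against
  the correlated \<open>W\<close> acquires the drift \<open>\<rho>\<close> times the product of the
  integrands, and here both integrands are \<open>H n\<close>.\<close>

lemma Z_V_drift: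
  assumes V: "W.regular_ito (sqrt (real n)) (H n) V" and t: "0 < t"
  shows "(\<integral>\<omega>. Z n t \<omega> * V t \<omega> \<partial>M) = \<rho> * (\<integral>\<omega>. Z n t \<omega> * T n t \<omega> \<partial>M)"
proof -
  have t': "0 \<le> t" using t by simp
  note Zs = Z_square_integrable[OF t', of n]
  note Vs = W.regular_ito_square_integrable[OF V order_refl t']
  note V2 = W.regular_ito_square_integrable_0[OF V t']
  note i = square_integrable_mult[OF Zs Vs] square_integrable_mult[OF Zs T_square_integrable[OF t']]
    square_integrable_mult[OF Zs V2(1)]
  have "0 = (\<integral>\<omega>. Z n t \<omega> * (V t \<omega> - V 0 \<omega> - \<rho> * T n t \<omega>) \<partial>M)"
    using W1.exp_density_drift[OF W.brownian_space_axioms correlated_W order_refl t I_regular V] by simp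
  also have "\<dots> = (\<integral>\<omega>. Z n t \<omega> * (V t \<omega> - V 0 \<omega>) - \<rho> * (Z n t \<omega> * T n t \<omega>) \<partial>M)"
    by (intro Bochner_Integration.integral_cong refl) (simp add: algebra_simps)
  also have "\<dots> = (\<integral>\<omega>. Z n t \<omega> * (V t \<omega> - V 0 \<omega>) \<partial>M) - \<rho> * (\<integral>\<omega>. Z n t \<omega> * T n t \<omega> \<partial>M)"
    using i by simp
  also have "(\<integral>\<omega>. Z n t \<omega> * (V t \<omega> - V 0 \<omega>) \<partial>M) = (\<integral>\<omega>. Z n t \<omega> * V t \<omega> \<partial>M)"
    using V2(2) i by (intro integral_cong_AE) auto
  finally show ?thesis by simp
qed

lemma tilted_mean_H2:
  assumes t: "0 < t"
  shows "(\<integral>\<omega>. Z n t \<omega> * (H n t \<omega> * H n t \<omega>) \<partial>M) \<le> x0 + \<kappa> * \<theta> * t + \<xi> * (\<integral>\<omega>. Z n t \<omega> * T n t \<omega> \<partial>M)"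
proof -
  have t': "0 \<le> t" using t by simp
  obtain V where V: "W.regular_ito (sqrt (real n)) (H n) V"
    and le: "AE \<omega> in M. \<forall>t\<ge>0. H n t \<omega> * H n t \<omega> \<le> x0 + \<kappa> * \<theta> * t + \<xi> * V t \<omega>"
    by (rule variance_integral)
  note Zs = Z_square_integrable[OF t', of n]
  note iZ = square_integrable_integrable[OF Zs]
  note V2 = W.regular_ito_square_integrable_0[OF V t']
  note iZV = square_integrable_mult[OF Zs V2(1)]
  let ?a = "x0 + \<kappa> * \<theta> * t"
  have "(\<integral>\<omega>. Z n t \<omega> * (H n t \<omega> * H n t \<omega>) \<partial>M) \<le> (\<integral>\<omega>. ?a * Z n t \<omega> + \<xi> * (Z n t \<omega> * V t \<omega>) \<partial>M)"
  proof (rule integral_mono_AE)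
    show "integrable M (\<lambda>\<omega>. Z n t \<omega> * (H n t \<omega> * H n t \<omega>))"
      by (rule square_integrable_mult[OF Zs H2_square_integrable[OF t']])
    show "integrable M (\<lambda>\<omega>. ?a * Z n t \<omega> + \<xi> * (Z n t \<omega> * V t \<omega>))" using iZ iZV by simp
    show "AE \<omega> in M. Z n t \<omega> * (H n t \<omega> * H n t \<omega>) \<le> ?a * Z n t \<omega> + \<xi> * (Z n t \<omega> * V t \<omega>)"
      using le
    proof eventually_elim
      case (elim \<omega>)
      then have "Z n t \<omega> * (H n t \<omega> * H n t \<omega>) \<le> Z n t \<omega> * (?a + \<xi> * V t \<omega>)"
        using t' less_imp_le[OF Z_pos] by (intro mult_left_mono) auto
      then show ?case by (simp add: algebra_simps)
    qed
  qed
  also have "\<dots> = ?a + \<xi> * (\<rho> * (\<integral>\<omega>. Z n t \<omega> * T n t \<omega> \<partial>M))"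
    using iZ iZV Z_mean[OF t'] Z_V_drift[OF V t] by simp
  \<comment> \<open>Since the weighted mean of \<open>T n t\<close> is nonnegative,
    \<open>\<rho> \<le> 1\<close> allows the correlation to be replaced by \<open>1\<close>.\<close>
  also have "\<dots> \<le> ?a + \<xi> * (1 * (\<integral>\<omega>. Z n t \<omega> * T n t \<omega> \<partial>M))"
    using params T_nonneg less_imp_le[OF Z_pos]
    by (intro add_left_mono mult_left_mono mult_right_mono) auto
  finally show ?thesis by simp
qed

text \<open>The martingale property of the weight: the other factor is bounded and known at
  \<open>u\<close>, so the final weight may be replaced by the one at \<open>u\<close>.\<close>

lemma tilted_H2_eq:
  assumes "0 \<le> u" "u \<le> t"
  shows "(\<integral>\<omega>. Z n t \<omega> * (H n u \<omega> * H n u \<omega>) \<partial>M) = (\<integral>\<omega>. Z n u \<omega> * (H n u \<omega> * H n u \<omega>) \<partial>M)"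
  using W1.exp_density_martingale[OF I_regular assms regular_measurable[OF H2_regular assms(1)] regular_bound[OF H2_regular assms(1)], of n n]
  by (simp add: mult.commute)

text \<open>Gronwall's argument for \<open>u \<mapsto> E (Z u * (H u)\<^sup>2)\<close>: its supremum \<open>m\<close> with weight
  \<open>exp (- 2 * \<xi> * u)\<close> satisfies \<open>m \<le> a + m / 2\<close>.\<close>

lemma tilted_mean_T:
  assumes t: "0 < t"
  shows "(\<integral>\<omega>. Z n t \<omega> * T n t \<omega> \<partial>M) \<le> (x0 + \<kappa> * \<theta> * t) * exp (2 * \<xi> * t) / \<xi>"
proof -
  define a where "a = x0 + \<kappa> * \<theta> * t"
  define y where "y u = (\<integral>\<omega>. Z n u \<omega> * (H n u \<omega> * H n u \<omega>) \<partial>M)" for u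
  define m where "m = (SUP u\<in>{0<..t}. exp (- 2 * \<xi> * u) * y u)"
  have \<xi>: "0 < \<xi>" using params by simp
  have a0: "0 \<le> a" using params t by (simp add: a_def)
  have y0: "0 \<le> y u" for u unfolding y_def using less_imp_le[OF Z_pos] by simp
  \<comment> \<open>A bound depending on \<open>n\<close>, needed for the supremum \<open>m\<close>
    to be finite; it does not survive in the conclusion.\<close>
  have yn: "y u \<le> real n" if u: "0 \<le> u" for u
  proof -
    have "y u \<le> (\<integral>\<omega>. real n * Z n u \<omega> \<partial>M)"
      unfolding y_def
    proof (rule integral_mono)
      show "integrable M (\<lambda>\<omega>. Z n u \<omega> * (H n u \<omega> * H n u \<omega>))"
        by (rule square_integrable_mult[OF Z_square_integrable[OF u] H2_square_integrable[OF u]])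
      show "integrable M (\<lambda>\<omega>. real n * Z n u \<omega>)"
        using square_integrable_integrable[OF Z_square_integrable[OF u]] by simp
      fix \<omega> assume "\<omega> \<in> space M"
      from regular_bound[OF H2_regular u this, of n] have "H n u \<omega> * H n u \<omega> \<le> real n" by simp
      then have "Z n u \<omega> * (H n u \<omega> * H n u \<omega>) \<le> Z n u \<omega> * real n" using less_imp_le[OF Z_pos] by (intro mult_left_mono)
      then show "Z n u \<omega> * (H n u \<omega> * H n u \<omega>) \<le> real n * Z n u \<omega>" by (simp add: mult.commute)
    qed
    then show ?thesis using Z_mean[OF u, of n] by simp
  qed
  have bdd: "bdd_above ((\<lambda>u. exp (- 2 * \<xi> * u) * y u) ` {0<..t})"
  proof (rule bdd_aboveI2)
    fix u assume u: "u \<in> {0<..t}"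
    have "exp (- 2 * \<xi> * u) * y u \<le> 1 * real n"
      using u \<xi> yn[of u] y0[of u] by (intro mult_mono) auto
    then show "exp (- 2 * \<xi> * u) * y u \<le> real n" by simp
  qed
  have ee: "exp (2 * \<xi> * u) * exp (- 2 * \<xi> * u) = 1" for u by (simp add: mult_exp_exp)
  have ym: "y u \<le> m * exp (2 * \<xi> * u)" if u: "0 < u" "u \<le> t" for u
  proof -
    have "exp (- 2 * \<xi> * u) * y u \<le> m" unfolding m_def using u by (intro cSUP_upper bdd) auto
    then have "exp (2 * \<xi> * u) * (exp (- 2 * \<xi> * u) * y u) \<le> exp (2 * \<xi> * u) * m" by (intro mult_left_mono) auto
    then have "y u \<le> exp (2 * \<xi> * u) * m"
      by (simp only: mult.assoc[symmetric, of "exp (2 * \<xi> * u)"] ee mult_1_left)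
    then show ?thesis by (simp only: mult.commute)
  qed
  have m0: "0 \<le> m"
    using ym[of t] y0[of t] t by (auto simp: zero_le_mult_iff dest: order_trans)
  have ZT: "(\<integral>\<omega>. Z n u \<omega> * T n u \<omega> \<partial>M) \<le> m * exp (2 * \<xi> * u) / (2 * \<xi>)" if u: "0 < u" "u \<le> t" for u
  proof -
    have u': "0 \<le> u" using u by simp
    have "ennreal (\<integral>\<omega>. Z n u \<omega> * T n u \<omega> \<partial>M) \<le> (\<integral>\<^sup>+v\<in>{0<..u}. ennreal (m * exp (2 * \<xi> * v)) \<partial>lborel)"
    proof (rule weighted_time_integral_le[OF H_regular u'])
      show "Z n u \<in> borel_measurable M" "integrable M (Z n u)"
        using Z_square_integrable[OF u', of n] square_integrable_integrable by (auto simp: square_integrable_measurable)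
      show "0 \<le> Z n u \<omega>" for \<omega> using Z_pos less_imp_le by blast
      fix v assume v: "0 < v" "v \<le> u"
      \<comment> \<open>The weight is moved from \<open>u\<close> back to \<open>v\<close>, where
        the definition of \<open>m\<close> gives the bound.\<close>
      show "(\<integral>\<omega>. Z n u \<omega> * (H n v \<omega> * H n v \<omega>) \<partial>M) \<le> m * exp (2 * \<xi> * v)"
        using tilted_H2_eq[of v u n] ym[of v] v u unfolding y_def by simp
    qed
    also have "\<dots> \<le> (\<integral>\<^sup>+v\<in>{0..u}. ennreal (m * exp (2 * \<xi> * v)) \<partial>lborel)"
      by (intro nn_integral_mono) (auto simp: indicator_def)
    \<comment> \<open>Integrating the exponential with rate \<open>2 * \<xi>\<close> yields the
      factor \<open>1 / (2 * \<xi>)\<close>, which against the coefficient \<open>\<xi>\<close> of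
      the integral inequality becomes \<open>1 / 2\<close>.\<close>
    also have "\<dots> = ennreal (m * exp (2 * \<xi> * u) / (2 * \<xi>) - m * exp (2 * \<xi> * 0) / (2 * \<xi>))"
    proof (rule nn_integral_FTC_Icc)
      fix v :: real
      show "((\<lambda>v. m * exp (2 * \<xi> * v) / (2 * \<xi>)) has_real_derivative m * exp (2 * \<xi> * v)) (at v)"
        using \<xi> by (auto intro!: derivative_eq_intros)
      show "0 \<le> m * exp (2 * \<xi> * v)" using m0 by simp
    qed (use u' in auto)
    also have "\<dots> \<le> ennreal (m * exp (2 * \<xi> * u) / (2 * \<xi>))"
      using m0 \<xi> by (intro ennreal_leI) simp
    finally show ?thesis using m0 \<xi> by (simp add: ennreal_le_iff)
  qed
  have "m \<le> a + m / 2"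
  proof -
    have "(SUP u\<in>{0<..t}. exp (- 2 * \<xi> * u) * y u) \<le> a + m / 2"
    proof (rule cSUP_least)
      show "{0<..t} \<noteq> {}" using t by auto
      fix u assume "u \<in> {0<..t}"
      then have u: "0 < u" "u \<le> t" by auto
      have "y u \<le> x0 + \<kappa> * \<theta> * u + \<xi> * (\<integral>\<omega>. Z n u \<omega> * T n u \<omega> \<partial>M)"
        unfolding y_def by (rule tilted_mean_H2[OF u(1)])
      also have "\<dots> \<le> a + \<xi> * (m * exp (2 * \<xi> * u) / (2 * \<xi>))"
        using ZT[OF u] u params unfolding a_def by (intro add_mono mult_left_mono) auto
      also have "\<dots> = a + m * exp (2 * \<xi> * u) / 2" using \<xi> by simp
      finally have "exp (- 2 * \<xi> * u) * y u \<le> exp (- 2 * \<xi> * u) * (a + m * exp (2 * \<xi> * u) / 2)"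
        by (intro mult_left_mono) auto
      also have "\<dots> = exp (- 2 * \<xi> * u) * a + m / 2 * (exp (- 2 * \<xi> * u) * exp (2 * \<xi> * u))"
        by (simp add: algebra_simps)
      also have "exp (- 2 * \<xi> * u) * exp (2 * \<xi> * u) = 1" using ee[of u] by (simp only: mult.commute)
      also have "exp (- 2 * \<xi> * u) * a + m / 2 * 1 \<le> 1 * a + m / 2 * 1"
        using a0 \<xi> u by (intro add_right_mono mult_right_mono) auto
      finally show "exp (- 2 * \<xi> * u) * y u \<le> a + m / 2" by simp
    qed
    then show "m \<le> a + m / 2" by (simp only: m_def[symmetric])
  qed
  then have "m \<le> 2 * a" by simp
  then have "m * exp (2 * \<xi> * t) / (2 * \<xi>) \<le> 2 * a * exp (2 * \<xi> * t) / (2 * \<xi>)"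
    using \<xi> by (intro divide_right_mono mult_right_mono) auto
  also have "\<dots> = a * exp (2 * \<xi> * t) / \<xi>" by simp
  finally show ?thesis using ZT[OF t order_refl] unfolding a_def by linarith
qed

text \<open>\<open>ln Z\<close> is \<open>I n t - I n 0 - T n t\<close> plus half of
  \<open>T n t\<close>. The first part is centred under the weight: it is the drift formula for
  \<open>W1\<close> paired with itself, where the correlation is \<open>1\<close>. What remains is
  half the weighted mean of \<open>T n t\<close>; the half is then given away.\<close>

lemma Z_entropy:
  assumes t: "0 \<le> t"
  shows "integrable M (\<lambda>\<omega>. Z n t \<omega> * ln (Z n t \<omega>))"
    and "(\<integral>\<omega>. Z n t \<omega> * ln (Z n t \<omega>) \<partial>M) \<le> (x0 + \<kappa> * \<theta> * t) * exp (2 * \<xi> * t) / \<xi>"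
proof -
  note Zs = Z_square_integrable[OF t, of n]
  note Is = W1.regular_ito_square_integrable[OF I_regular order_refl t, of n]
  have ln: "ln (Z n t \<omega>) = (I n t \<omega> - I n 0 \<omega> - T n t \<omega>) + 1 / 2 * T n t \<omega>" for \<omega>
    by (simp add: W1.exp_density_def)
  have i1: "integrable M (\<lambda>\<omega>. Z n t \<omega> * (I n t \<omega> - I n 0 \<omega> - T n t \<omega>))"
    by (rule square_integrable_mult[OF Zs square_integrable_diff[OF Is T_square_integrable[OF t]]])
  have i2: "integrable M (\<lambda>\<omega>. Z n t \<omega> * T n t \<omega>)" by (rule square_integrable_mult[OF Zs T_square_integrable[OF t]])
  have eq: "(\<lambda>\<omega>. Z n t \<omega> * ln (Z n t \<omega>)) = (\<lambda>\<omega>. Z n t \<omega> * (I n t \<omega> - I n 0 \<omega> - T n t \<omega>) + 1 / 2 * (Z n t \<omega> * T n t \<omega>))"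
    unfolding ln by (simp add: algebra_simps)
  show "integrable M (\<lambda>\<omega>. Z n t \<omega> * ln (Z n t \<omega>))"
    unfolding eq using i1 i2 by simp
  show "(\<integral>\<omega>. Z n t \<omega> * ln (Z n t \<omega>) \<partial>M) \<le> (x0 + \<kappa> * \<theta> * t) * exp (2 * \<xi> * t) / \<xi>"
  proof (cases "t = 0")
    case True
    then have "Z n t \<omega> = 1" for \<omega> by (simp add: W1.exp_density_def time_integral_def)
    then show ?thesis using params t by simp
  next
    case False
    then have t': "0 < t" using t by simp
    have "(\<integral>\<omega>. Z n t \<omega> * (I n t \<omega> - I n 0 \<omega> - T n t \<omega>) \<partial>M) = 0"
      using W1.exp_density_drift[OF W1.brownian_space_axioms W1.correlated_self order_refl t' I_regular I_regular, of n n] by simp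
    then have "(\<integral>\<omega>. Z n t \<omega> * ln (Z n t \<omega>) \<partial>M) = 1 / 2 * (\<integral>\<omega>. Z n t \<omega> * T n t \<omega> \<partial>M)"
      unfolding eq using i1 i2 by simp
    also have "\<dots> \<le> (\<integral>\<omega>. Z n t \<omega> * T n t \<omega> \<partial>M)"
      using T_nonneg less_imp_le[OF Z_pos] by simp
    finally show ?thesis using tilted_mean_T[OF t', of n] by simp
  qed
qed

text \<open>Monotone convergence turns the bound on the means of \<open>T n t\<close>, uniform in
  \<open>n\<close>, into a finite mean of the integrated variance.\<close>

lemma integrated_variance_finite:
  assumes t: "0 \<le> t"
  shows "AE \<omega> in M. integrated_variance Y t \<omega> \<noteq> \<infinity>"
proof -
  note IV = integrated_variance_time_integral[OF H_regular continuous_Y t]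
  have [measurable]: "T n t \<in> borel_measurable M" for n by (rule T_measurable[OF t])
  have "(\<integral>\<^sup>+\<omega>. integrated_variance Y t \<omega> \<partial>M) = (\<integral>\<^sup>+\<omega>. (SUP n. ennreal (T n t \<omega>)) \<partial>M)"
    by (intro nn_integral_cong IV(1))
  also have "\<dots> = (SUP n. \<integral>\<^sup>+\<omega>. ennreal (T n t \<omega>) \<partial>M)"
  proof (rule nn_integral_monotone_convergence_SUP_AE)
    show "AE \<omega> in M. ennreal (T n t \<omega>) \<le> ennreal (T (Suc n) t \<omega>)" for n
      using IV(2) by (intro AE_I2 ennreal_leI) (auto simp: incseq_Suc_iff)
  qed simp
  also have "\<dots> \<le> ennreal ((x0 + \<kappa> * \<theta> * t) * t)"
  proof (rule SUP_least)
    fix n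
    have "(\<integral>\<^sup>+\<omega>. ennreal (T n t \<omega>) \<partial>M) = ennreal (\<integral>\<omega>. T n t \<omega> \<partial>M)"
      using T_nonneg square_integrable_integrable[OF T_square_integrable[OF t]] by (intro nn_integral_eq_integral) auto
    then show "(\<integral>\<^sup>+\<omega>. ennreal (T n t \<omega>) \<partial>M) \<le> ennreal ((x0 + \<kappa> * \<theta> * t) * t)"
      using mean_T[OF t, of n] by (simp add: ennreal_leI)
  qed
  finally have "(\<integral>\<^sup>+\<omega>. integrated_variance Y t \<omega> \<partial>M) \<noteq> \<infinity>" by (auto simp: top_unique)
  then show ?thesis
    using measurable_F[OF integrated_variance_measurable[OF H_regular continuous_Y t]]
    by (intro nn_integral_PInf_AE) auto
qed

section \<open>Almost sure convergence of the stock integrals\<close>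

lemma stopping_set:
  assumes "0 \<le> t" "0 \<le> u" "u < t"
  shows "{\<omega>\<in>space M. u < stopped_at t (zeta_n Y m \<omega>)} \<in> sets (F u)"
proof -
  have [measurable]: "H m u \<in> borel_measurable (F u)" by (rule regular_measurable[OF H_regular assms(2)])
  have "{\<omega>\<in>space M. u < stopped_at t (zeta_n Y m \<omega>)} = {\<omega>\<in>space (F u). 0 < H m u \<omega>}"
  proof -
    have "u < stopped_at t (zeta_n Y m \<omega>) \<longleftrightarrow> 0 < H m u \<omega>" for \<omega>
    proof -
      have "0 \<le> zeta_n Y m \<omega>" unfolding zeta_n_def by (rule exit_time_nonneg)
      from stopped_at_facts(4)[OF assms(1) this, of u] show ?thesis
        unfolding sqrt_Y_n_pos_iff[OF assms(2)] using assms(3) by blast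
    qed
    then show ?thesis by (simp only: space_F)
  qed
  also have "\<dots> \<in> sets (F u)" by measurable
  finally show ?thesis .
qed

text \<open>Let \<open>s\<close> be \<open>zeta_n Y m\<close> capped at \<open>t\<close>. Before
  \<open>s\<close> the integrands of \<open>I N\<close> and \<open>I m\<close> agree, so these
  integrals coincide at \<open>s\<close>; after \<open>s\<close> the integrands of
  \<open>I m\<close> and \<open>I n\<close> vanish, so these integrals no longer move.\<close>

lemma stopped_difference:
  assumes t: "0 \<le> t" and nm: "n \<le> m" "m \<le> N"
  shows "AE \<omega> in M. I m t \<omega> - I n t \<omega> =
    I N (stopped_at t (zeta_n Y m \<omega>)) \<omega> - I n (stopped_at t (zeta_n Y m \<omega>)) \<omega>"
proof -
  let ?s = "\<lambda>\<omega>. stopped_at t (zeta_n Y m \<omega>)"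
  have z: "0 \<le> zeta_n Y m \<omega>" for \<omega> unfolding zeta_n_def by (rule exit_time_nonneg)
  note s = stopped_at_facts[OF t z]
  have s': "0 \<le> ?s \<omega> \<and> ?s \<omega> \<le> t" for \<omega> using s(2,3) by blast
  have "AE \<omega> in M. I N (?s \<omega>) \<omega> - I m (?s \<omega>) \<omega> = 0"
  proof (rule W1.regular_ito_stopped_zero[OF W1.regular_ito_diff[OF I_regular I_regular] t s' stopping_set[OF t]])
    fix u \<omega> assume u: "0 \<le> u" "u < ?s \<omega>"
    then have "ereal u < zeta_n Y m \<omega>" using s(4) by blast
    then have "ereal u < zeta_n Y N \<omega>" using zeta_n_mono[OF nm(2), of Y \<omega>] by (rule order.strict_trans2)
    with \<open>ereal u < zeta_n Y m \<omega>\<close> show "H N u \<omega> - H m u \<omega> = 0" by (simp add: sqrt_Y_n_def)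
  qed
  moreover have "AE \<omega> in M. I k (?s \<omega>) \<omega> = I k t \<omega>" if k: "k \<le> m" for k
  proof (rule W1.regular_ito_stopped_const[OF I_regular t s' stopping_set[OF t]])
    fix u \<omega> assume u: "?s \<omega> < u" "u \<le> t"
    have "zeta_n Y k \<omega> \<le> zeta_n Y m \<omega>" by (rule zeta_n_mono[OF k])
    also have "\<dots> < ereal u" by (rule s(5)[OF u])
    finally show "H k u \<omega> = 0" by (simp add: sqrt_Y_n_def)
  qed
  from this[OF order_refl] this[OF nm(1)] have "AE \<omega> in M. I m (?s \<omega>) \<omega> = I m t \<omega>" "AE \<omega> in M. I n (?s \<omega>) \<omega> = I n t \<omega>" by auto
  ultimately show ?thesis by eventually_elim simp
qed

text \<open>At each time \<open>H n\<close> equals \<open>H N\<close> or \<open>0\<close>, so the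
  square of \<open>H N - H n\<close> is the difference of their squares, and the isometry gives the
  second moment.\<close>

lemma difference_second_moment:
  assumes t: "0 \<le> t" and nN: "n \<le> N"
  shows "(\<integral>\<omega>. ((I N t \<omega> - I n t \<omega>) - (I N 0 \<omega> - I n 0 \<omega>))\<^sup>2 \<partial>M) = (\<integral>\<omega>. T N t \<omega> \<partial>M) - (\<integral>\<omega>. T n t \<omega> \<partial>M)"
proof -
  have "space M \<in> sets (F 0)" using sets.top[of "F 0"] by (simp add: space_F)
  from W1.regular_ito_isometry[OF W1.regular_ito_diff[OF I_regular I_regular] order_refl t this, of N n]
  have "(\<integral>\<omega>. ((I N t \<omega> - I n t \<omega>) - (I N 0 \<omega> - I n 0 \<omega>))\<^sup>2 \<partial>M) =
    (\<integral>\<omega>. time_integral (\<lambda>u \<omega>. (H N u \<omega> - H n u \<omega>) * (H N u \<omega> - H n u \<omega>)) 0 t \<omega> \<partial>M)"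
    by (simp add: indicator_def cong: Bochner_Integration.integral_cong)
  also have "\<dots> = (\<integral>\<omega>. T N t \<omega> - T n t \<omega> \<partial>M)"
  proof (intro Bochner_Integration.integral_cong refl)
    fix \<omega> assume \<omega>: "\<omega> \<in> space M"
    note i = regular_path_integrable[OF H2_regular order_refl t \<omega>]
    have "time_integral (\<lambda>u \<omega>. (H N u \<omega> - H n u \<omega>) * (H N u \<omega> - H n u \<omega>)) 0 t \<omega>
      = (\<integral>u. indicator {0<..t} u * (H N u \<omega> * H N u \<omega>) - indicator {0<..t} u * (H n u \<omega> * H n u \<omega>) \<partial>lborel)"
      unfolding time_integral_def
    proof (intro Bochner_Integration.integral_cong refl)
      fix u :: real
      have "ereal u < zeta_n Y N \<omega>" if "ereal u < zeta_n Y n \<omega>"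
        using that zeta_n_mono[OF nN, of Y \<omega>] by (rule order.strict_trans2)
      then have "H n u \<omega> = H N u \<omega> \<or> H n u \<omega> = 0" by (auto simp: sqrt_Y_n_def)
      then show "indicator {0<..t} u * ((H N u \<omega> - H n u \<omega>) * (H N u \<omega> - H n u \<omega>)) =
        indicator {0<..t} u * (H N u \<omega> * H N u \<omega>) - indicator {0<..t} u * (H n u \<omega> * H n u \<omega>)" by auto
    qed
    also have "\<dots> = T N t \<omega> - T n t \<omega>" unfolding time_integral_def using i by simp
    finally show "time_integral (\<lambda>u \<omega>. (H N u \<omega> - H n u \<omega>) * (H N u \<omega> - H n u \<omega>)) 0 t \<omega> = T N t \<omega> - T n t \<omega>" .
  qed
  also have "\<dots> = (\<integral>\<omega>. T N t \<omega> \<partial>M) - (\<integral>\<omega>. T n t \<omega> \<partial>M)"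
    using square_integrable_integrable[OF T_square_integrable[OF t]] by simp
  finally show ?thesis .
qed

text \<open>For \<open>n \<le> m \<le> N\<close> the values \<open>I m t\<close> lie on one path, that of \<open>I N\<close> stopped at the times
  \<open>zeta_n Y m\<close>, so the maximal inequality for \<open>I N - I n\<close> controls them all at once and gives
  convergence of the full sequence.\<close>

lemma I_convergent:
  assumes t: "0 \<le> t"
  shows "AE \<omega> in M. convergent (\<lambda>n. I n t \<omega>)"
proof -
  define e where "e n = (\<integral>\<omega>. T n t \<omega> \<partial>M)" for n
  have inc: "incseq e"
  proof (rule incseq_SucI)
    show "e n \<le> e (Suc n)" for n
      unfolding e_def
      using square_integrable_integrable[OF T_square_integrable[OF t]]
        integrated_variance_time_integral(2)[OF H_regular continuous_Y t]
      by (intro integral_mono) (auto simp: incseq_Suc_iff)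
  qed
  have "\<forall>i. e i \<le> (x0 + \<kappa> * \<theta> * t) * t" unfolding e_def by (intro allI mean_T[OF t])
  \<comment> \<open>The second moment of the difference between stages \<open>n\<close> and
    \<open>N\<close> is \<open>e N - e n\<close>; the tail \<open>L - e n\<close> of this bounded
    increasing sequence bounds it for all \<open>N\<close> at once.\<close>
  from incseq_convergent[OF inc this] obtain L where eL: "e \<longlonglongrightarrow> L" "\<forall>i. e i \<le> L" by blast
  then have L: "e \<longlonglongrightarrow> L" "\<And>n. e n \<le> L" by auto
  have Im: "I n t \<in> borel_measurable M" for n
    using measurable_F[OF W1.regular_ito_measurable[OF I_regular t]] .
  show ?thesis
  proof (rule AE_convergent_of_maximal[where d="\<lambda>n. L - e n"])
    show "I n t \<in> borel_measurable M" for n by (rule Im)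
    have "(\<lambda>n. L - e n) \<longlonglongrightarrow> L - L" by (intro tendsto_diff tendsto_const L)
    then show "(\<lambda>n. L - e n) \<longlonglongrightarrow> 0" by simp
    fix \<epsilon> :: real and n N :: nat assume \<epsilon>: "0 < \<epsilon>"
    let ?G = "{\<omega>\<in>space M. \<exists>m\<in>{n..N}. \<epsilon> < \<bar>I m t \<omega> - I n t \<omega>\<bar>}"
    show "\<epsilon>\<^sup>2 * prob ?G \<le> L - e n"
    proof (cases "n \<le> N")
      case False
      then have "?G = {}" by auto
      then have "prob ?G = 0" by (simp only: measure_empty)
      then show ?thesis using L(2)[of n] by simp
    next
      case True
      define X where "X u \<omega> = I N u \<omega> - I n u \<omega>" for u \<omega>
      have X: "W1.regular_ito (sqrt (real N) + sqrt (real n)) (\<lambda>u \<omega>. H N u \<omega> - H n u \<omega>) X"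
        unfolding X_def[abs_def] by (rule W1.regular_ito_diff[OF I_regular I_regular])
      obtain E where E: "E \<in> sets M" "\<epsilon>\<^sup>2 * prob E \<le> (\<integral>\<omega>. (X t \<omega> - X 0 \<omega>)\<^sup>2 \<partial>M)"
        "\<And>\<omega> u. \<omega> \<in> space M \<Longrightarrow> u \<in> {0..t} \<Longrightarrow> \<epsilon> < \<bar>X u \<omega> - X 0 \<omega>\<bar> \<Longrightarrow> \<omega> \<in> E"
        using W1.regular_ito_maximal[OF X t \<epsilon>] by metis
      have "AE \<omega> in M. \<forall>m\<in>{n..N}. I m t \<omega> - I n t \<omega> =
          I N (stopped_at t (zeta_n Y m \<omega>)) \<omega> - I n (stopped_at t (zeta_n Y m \<omega>)) \<omega>"
        using stopped_difference[OF t] by (intro AE_finite_allI) auto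
      moreover have "AE \<omega> in M. X 0 \<omega> = 0" using X by (simp add: W1.regular_ito_def)
      ultimately have "AE \<omega> in M. \<omega> \<in> ?G \<longrightarrow> \<omega> \<in> E"
      proof eventually_elim
        case (elim \<omega>)
        show ?case
        proof
          assume "\<omega> \<in> ?G"
          then obtain m where m: "m \<in> {n..N}" "\<epsilon> < \<bar>I m t \<omega> - I n t \<omega>\<bar>" and \<omega>: "\<omega> \<in> space M" by auto
          let ?s = "stopped_at t (zeta_n Y m \<omega>)"
          have "0 \<le> zeta_n Y m \<omega>" unfolding zeta_n_def by (rule exit_time_nonneg)
          then have "?s \<in> {0..t}" using stopped_at_facts(2,3)[OF t] by simp
          moreover have "I m t \<omega> - I n t \<omega> = X ?s \<omega> - X 0 \<omega>" using elim m(1) unfolding X_def by simp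
          ultimately show "\<omega> \<in> E" using m(2) E(3)[OF \<omega>] by metis
        qed
      qed
      then have "prob ?G \<le> prob E" by (rule finite_measure_mono_AE) (rule E(1))
      then have "\<epsilon>\<^sup>2 * prob ?G \<le> \<epsilon>\<^sup>2 * prob E" by (intro mult_left_mono) auto
      also have "\<dots> \<le> e N - e n"
        using E(2) difference_second_moment[OF t True] unfolding X_def e_def by simp
      also have "\<dots> \<le> L - e n" using L(2)[of N] by simp
      finally show ?thesis .
    qed
  qed
qed

section \<open>The price as an L1 limit of exponential martingales\<close>

lemma heston_price_nonneg: "0 \<le> heston_price Y I t \<omega>"
  by (simp add: heston_price_def)

lemma heston_price_measurable:
  assumes t: "0 \<le> t"
  shows "heston_price Y I t \<in> borel_measurable (F t)"
proof -
  have [measurable]: "I n t \<in> borel_measurable (F t)" for n by (rule W1.regular_ito_measurable[OF I_regular t])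
  have [measurable]: "integrated_variance Y t \<in> borel_measurable (F t)"
    by (rule integrated_variance_measurable[OF H_regular continuous_Y t])
  have [measurable]: "(\<lambda>\<omega>. lim (\<lambda>n. I n t \<omega>)) \<in> borel_measurable (F t)"
    by (rule borel_measurable_lim_metric) measurable
  show ?thesis unfolding heston_price_def[abs_def] by measurable
qed

text \<open>Both ingredients of the exponent converge: \<open>I n t\<close> by the maximal
  inequality and \<open>T n t\<close> by monotone convergence to the finite integrated variance. The
  term \<open>I n 0\<close> in \<open>Z n t\<close> is \<open>0\<close> almost surely.\<close>

lemma Z_tendsto_price:
  assumes t: "0 \<le> t"
  shows "AE \<omega> in M. (\<lambda>n. Z n t \<omega>) \<longlonglongrightarrow> heston_price Y I t \<omega>"
proof -
  have "AE \<omega> in M. \<forall>n. I n 0 \<omega> = 0"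
    using I_regular by (simp add: W1.regular_ito_def AE_all_countable)
  then show ?thesis
    using I_convergent[OF t] integrated_variance_finite[OF t] AE_space
  proof eventually_elim
    case (elim \<omega>)
    note IV = integrated_variance_time_integral[OF H_regular continuous_Y t elim(4)]
    obtain v where v: "integrated_variance Y t \<omega> = ennreal v" "0 \<le> v"
      using elim(3) by (cases "integrated_variance Y t \<omega>") auto
    have "(\<lambda>n. ennreal (T n t \<omega>)) \<longlonglongrightarrow> (SUP n. ennreal (T n t \<omega>))"
      using IV(2) by (intro LIMSEQ_SUP) (auto simp: incseq_def ennreal_leI)
    then have "(\<lambda>n. ennreal (T n t \<omega>)) \<longlonglongrightarrow> ennreal v" using IV(1) v by simp
    then have T: "(\<lambda>n. T n t \<omega>) \<longlonglongrightarrow> v" by (rule tendsto_ennrealD) (use T_nonneg v in auto)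
    have I: "(\<lambda>n. I n t \<omega>) \<longlonglongrightarrow> lim (\<lambda>n. I n t \<omega>)" using elim(2) by (simp add: convergent_LIMSEQ_iff)
    have "(\<lambda>n. exp (I n t \<omega> - T n t \<omega> / 2)) \<longlonglongrightarrow> exp (lim (\<lambda>n. I n t \<omega>) - v / 2)"
      by (intro tendsto_exp tendsto_diff tendsto_divide tendsto_const I T) simp
    then show ?case
      using elim(1) v by (simp add: heston_price_def W1.exp_density_def)
  qed
qed

text \<open>The entropy bound may grow with \<open>t\<close> but is free of \<open>n\<close>, so the
  L1 criterion applies at each fixed time.\<close>

lemma price_L1_limit:
  assumes t: "0 \<le> t"
  shows "integrable M (heston_price Y I t)" "(\<lambda>n. \<integral>\<omega>. \<bar>Z n t \<omega> - heston_price Y I t \<omega>\<bar> \<partial>M) \<longlonglongrightarrow> 0"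
  using L1_limit_of_entropy_bound[where Z="\<lambda>n. Z n t" and S="heston_price Y I t",
      OF square_integrable_integrable[OF Z_square_integrable[OF t]] Z_mean[OF t] Z_pos Z_entropy[OF t]
        measurable_F[OF heston_price_measurable[OF t]] heston_price_nonneg Z_tendsto_price[OF t]]
  by auto

lemma martingale_price:
  assumes S: "\<And>t \<omega>. 0 \<le> t \<Longrightarrow> \<omega> \<in> space M \<Longrightarrow> S t \<omega> = heston_price Y I t \<omega>"
  shows "martingale M F S"
proof (rule martingale_of_L1_limit[where Z=Z])
  show "adapted F S"
    unfolding adapted_def
  proof (intro allI impI)
    fix t :: real assume t: "0 \<le> t"
    show "S t \<in> borel_measurable (F t)"
      using heston_price_measurable[OF t] S[OF t] by (subst measurable_cong[where g="heston_price Y I t"]) (auto simp: space_F)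
  qed
  fix t :: real assume t: "0 \<le> t"
  show "integrable M (S t)"
    using price_L1_limit(1)[OF t] S[OF t] by (subst Bochner_Integration.integrable_cong[OF refl, where g="heston_price Y I t"]) auto
  have "(\<integral>\<omega>. \<bar>Z n t \<omega> - S t \<omega>\<bar> \<partial>M) = (\<integral>\<omega>. \<bar>Z n t \<omega> - heston_price Y I t \<omega>\<bar> \<partial>M)" for n
    using S[OF t] by (intro Bochner_Integration.integral_cong) auto
  then show "(\<lambda>n. \<integral>\<omega>. \<bar>Z n t \<omega> - S t \<omega>\<bar> \<partial>M) \<longlonglongrightarrow> 0"
    using price_L1_limit(2)[OF t] by simp
  show "integrable M (Z n t)" for n
    by (rule square_integrable_integrable[OF Z_square_integrable[OF t]])
next
  fix n s t A assume st: "0 \<le> s" "s \<le> t" and A: "A \<in> sets (F s)"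
  show "(\<integral>\<omega>. indicator A \<omega> * Z n t \<omega> \<partial>M) = (\<integral>\<omega>. indicator A \<omega> * Z n s \<omega> \<partial>M)"
    by (rule W1.exp_density_martingale[OF I_regular st, where K=1]) (use A in \<open>auto simp: indicator_def\<close>)
qed

end

theorem proposition5p1:
  fixes M :: "'a measure" and F :: "real \<Rightarrow> 'a measure"
    and \<kappa> \<theta> \<xi> \<rho> x0 :: real
    and W W1 W2 :: "real \<Rightarrow> 'a \<Rightarrow> real"
    and Y :: "real \<Rightarrow> 'a \<Rightarrow> ereal"
    and I :: "nat \<Rightarrow> real \<Rightarrow> 'a \<Rightarrow> real"
    and S :: "real \<Rightarrow> 'a \<Rightarrow> real"
  assumes params: "\<kappa> > 0" "\<theta> > 0" "\<xi> > 0" "-1 \<le> \<rho>" "\<rho> \<le> 1" "x0 > 0"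
    and filtered: "filtered_prob_space M F"
    and W: "brownian_motion M F W"
    and W1: "brownian_motion M F W1"
    and correlation: "\<And>s t. 0 \<le> s \<Longrightarrow> s \<le> t \<Longrightarrow>
      AE \<omega> in M. real_cond_exp M (F s) (\<lambda>\<omega>. (W1 t \<omega> - W1 s \<omega>) * (W t \<omega> - W s \<omega>)) \<omega> = \<rho> * (t - s)"
    and W2: "brownian_motion M (natural_filtration M W2) W2"
    and W1_eq: "AE \<omega> in M. \<forall>t\<ge>0. W1 t \<omega> = \<rho> * W t \<omega> + sqrt (1 - \<rho>\<^sup>2) * W2 t \<omega>"
    and indep: "independent_processes M W2 (\<lambda>t \<omega>. (Y t \<omega>, W t \<omega>))"
    and variance: "heston_variance M F \<kappa> \<theta> \<xi> x0 W Y"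
    and stock_integral: "\<And>n. is_ito_integral M F W1 (sqrt_Y_n Y n) (I n)"
    and stock: "\<And>t \<omega>. 0 \<le> t \<Longrightarrow> \<omega> \<in> space M \<Longrightarrow> S t \<omega> = heston_price Y I t \<omega>"
  shows "martingale M F S"
proof -
  interpret filtered_space M F
    using filtered by (auto simp: filtered_space_def filtered_space_axioms_def filtered_prob_space_def)
  have bW: "brownian_space M F W" by unfold_locales (rule W)
  have bW1: "brownian_space M F W1" by unfold_locales (rule W1)
  have "correlated \<rho> W1 W"
    by (rule correlatedI[OF bW1 bW correlation])
  then interpret heston_model M F \<kappa> \<theta> \<xi> \<rho> x0 W W1 Y I
    using params W W1 variance stock_integral by unfold_locales auto
  show ?thesis by (rule martingale_price[OF stock])
qed

end
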